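(* The first three moments $X_0(f),X_1(f),X_2(f)$ of the Vlasov dynamics are associated to the subgroup inclusion of the symmetry group of the Bloch--Iserles system into the symmetry group of the Vlasov dynamics, i.e. the inclusion of the Jacobi group $\operatorname{Jac}(V,\Omega)$ into the quantomorphism group $\operatorname{Diff}(V,\Omega)\times_B\mathbb{R}\simeq\operatorname{Aut}(V\times\mathbb{R},\alpha-\mathbf{d}s)$. These moments are given by the Poisson map obtained by taking the dual map to the associated Lie algebra inclusion $\mathfrak{jac}(V,\Omega)\hookrightarrow\mathcal{F}(V)$.
   Context: Setting. $V=\mathbb{R}^{2k}\ni\mathbf{z}=(\mathbf{q},\mathbf{p})$ carries the constant symplectic form $\Omega=\mathbf{d}\mathbf{q}\wedge\mathbf{d}\mathbf{p}$ (the same letter denotes its matrix, $\Omega(u,v)=u^T\Omega v$), and $\alpha=\frac12(\mathbf{q}\cdot\mathbf{d}\mathbf{p}-\mathbf{p}\cdot\mathbf{d}\mathbf{q})$. Vlasov side. $\mathcal{F}(V)$ is the Lie algebra of smooth functions on $V$ with the Poisson bracket $\{f,g\}=\Omega(X_f,X_g)$, where $\mathbf{i}_{X_f}\Omega=\mathbf{d}f$. Its dual $\mathcal{F}(V)^*$ consists of distributions (densities) $f$ on $V$, paired with functions by $\int_V f\,h\,d\mathbf{z}$. Vlasov dynamics is the Lie--Poisson dynamics $\partial_t f+\{f,\delta H/\delta f\}=0$ on $\mathcal{F}(V)^*$. The moments are $X_0(f)=\int_V f\,d\mathbf{z}$, $X_1(f)=\int_V\mathbf{z}f\,d\mathbf{z}$,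 $X_2(f)=\frac12\int_V\mathbf{z}\mathbf{z}^Tf\,d\mathbf{z}$. Quantomorphism group (the symmetry group of the Vlasov dynamics). $\operatorname{Diff}(V,\Omega)$ is the (identity component of the) group of symplectic diffeomorphisms of $V$. $\operatorname{Diff}(V,\Omega)\times_B\mathbb{R}$ is its central extension with product $(\eta_1,a_1)(\eta_2,a_2)=(\eta_1\circ\eta_2,\,a_1+a_2+B(\eta_1,\eta_2))$, $B(\eta_1,\eta_2)=\int_0^{\eta_2(0)}(\eta_1^*\alpha-\alpha)$. It is isomorphic to the group $\operatorname{Aut}(V\times\mathbb{R},\alpha-\mathbf{d}s)$ of quantomorphisms, i.e. (identity component of the group of) diffeomorphisms of $V\times\mathbb{R}$ preserving $\alpha-\mathbf{d}s$, via $(\eta,a)\mapsto\big[(\mathbf{z},s)\mapsto(\eta(\mathbf{z}),\,s+a+\int_0^{\mathbf{z}}(\eta^*\alpha-\alpha))\big]$. Its Lie algebra, consisting of pairs $(X_f,u)$ with $u\in\mathbb{R}$, is identified with $\mathcal{F}(V)$ via $(X_f,u)\mapsto u+f-f(0)$. Jacobi group (the symmetry group of the Bloch--Iserles system $\dot X=[X^2,\mathbb{N}]$ on real symmetric $(2k+1)\times(2k+1)$ matrices, where $\mathbb{N}$ is a constant antisymmetric matrix of corank one with invertible $2k\times2k$ block $\bar{\mathbb{N}}=-\Omega^{-1}$ and zeros elsewhere). $\operatorname{Jac}(V,\Omega)=\operatorname{Sp}(V,\Omega)\times V\times\mathbb{R}$ with product $(g_1,\mathbf{v}_1,a_1)(g_2,\mathbf{v}_2,a_2)=(g_1g_2,\,\mathbf{v}_1+g_1\mathbf{v}_2,\,a_1+a_2+\frac12\Omega(\mathbf{v}_1,g_1\mathbf{v}_2))$;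 its Lie algebra is $\mathfrak{jac}(V,\Omega)=\mathfrak{sp}(V,\Omega)\times V\times\mathbb{R}$. The inclusions referred to. The group inclusion is $\operatorname{Jac}(V,\Omega)\hookrightarrow\operatorname{Diff}(V,\Omega)\times_B\mathbb{R}$, $(g,\mathbf{v},a)\mapsto(\tau_{\mathbf{v}}\circ g,a)$, with $\tau_{\mathbf{v}}(\mathbf{z})=\mathbf{z}+\mathbf{v}$. The associated Lie algebra inclusion is its tangent map at the identity followed by the identification with $\mathcal{F}(V)$ above. The target $\mathfrak{jac}(V,\Omega)^*$ of the dual map is identified with the space of triples $(X_2,X_1,X_0)\in\operatorname{Sym}(V)^*\times V\times\mathbb{R}$ by the dual of the linear isomorphism $\operatorname{Sym}(V)\times V^*\times\mathbb{R}\to\mathfrak{jac}(V,\Omega)$, $(S_2,S_1,S_0)\mapsto(-\Omega^{-1}S_2,-\Omega^{-1}S_1^T,S_0)$, where $\operatorname{Sym}(V)$ is the space of symmetric $2k\times 2k$ matrices, $S_1$ is a row vector, and triples are paired by $\operatorname{Tr}(X_2S_2)+S_1X_1+X_0S_0$. "Poisson map" is with respect to the Lie--Poisson brackets $\{F,G\}(\mu)=\langle\mu,[\delta F/\delta\mu,\delta G/\delta\mu]\rangle$ on the duals of the two Lie algebras. *)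

theory Defs
  imports "HOL-Analysis.Analysis" "HOL-Algebra.Group"
begin

section \<open>Smooth maps, diffeomorphisms, one-forms\<close>

primrec iter_deriv ::
  "'a::real_normed_vector list \<Rightarrow> ('a \<Rightarrow> 'b::real_normed_vector) \<Rightarrow> 'a \<Rightarrow> 'b" where
  "iter_deriv [] f = f"
| "iter_deriv (v # vs) f = iter_deriv vs (\<lambda>x. frechet_derivative f (at x) v)"

definition smooth :: "('a::real_normed_vector \<Rightarrow> 'b::real_normed_vector) \<Rightarrow> bool" where
  "smooth f \<longleftrightarrow> (\<forall>vs x. iter_deriv vs f differentiable (at x))"

definition diffeo :: "('a::real_normed_vector \<Rightarrow> 'a) \<Rightarrow> bool" where
  "diffeo f \<longleftrightarrow> bij f \<and> smooth f \<and> smooth (inv_into UNIV f)"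

text \<open>The identity component of a group \<open>\<G>\<close> of diffeomorphisms consists of the elements that are
  joined to the identity by a smooth isotopy inside \<open>\<G>\<close>, i.e. by a level-preserving
  diffeomorphism \<open>(t, x) \<mapsto> (t, H t x)\<close> whose levels all belong to \<open>\<G>\<close>.\<close>

definition identity_component :: "('a::real_normed_vector \<Rightarrow> 'a) set \<Rightarrow> ('a \<Rightarrow> 'a) set" where
  "identity_component \<G> =
     {f. \<exists>H :: real \<Rightarrow> 'a \<Rightarrow> 'a. diffeo (\<lambda>(t, x). (t, H t x)) \<and> (\<forall>t. H t \<in> \<G>) \<and>
           H 0 = id \<and> H 1 = f}"

text \<open>A one-form maps a base point and a tangent vector to a number.\<close>

definition pullback ::
  "('a::real_normed_vector \<Rightarrow> 'b::real_normed_vector) \<Rightarrow> ('b \<Rightarrow> 'b \<Rightarrow> real) \<Rightarrow> 'a \<Rightarrow> 'a \<Rightarrow> real" where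
  "pullback \<eta> \<beta> x v = \<beta> (\<eta> x) (frechet_derivative \<eta> (at x) v)"

text \<open>The integral of a one-form from \<open>0\<close> to \<open>x\<close>, taken along the straight segment. It is used for
  closed forms on a vector space only, for which the integral does not depend on the path.\<close>

definition integral_from_0 :: "('a::real_normed_vector \<Rightarrow> 'a \<Rightarrow> real) \<Rightarrow> 'a \<Rightarrow> real" where
  "integral_from_0 \<beta> x = integral {0..1} (\<lambda>t. \<beta> (t *\<^sub>R x) x)"

section \<open>Tangent vectors and Lie bracket of a group embedded in a normed space\<close>

definition curve_at_one ::
  "('a::real_normed_vector, 'm) monoid_scheme \<Rightarrow> (real \<Rightarrow> 'a) \<Rightarrow> 'a \<Rightarrow> bool" where
  "curve_at_one G c A \<longleftrightarrow>
     (\<forall>t. c t \<in> carrier G) \<and> smooth c \<and> c 0 = \<one>\<^bsub>G\<^esub> \<and> (c has_vector_derivative A) (at 0)"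

definition group_Ad ::
  "('a::real_normed_vector, 'm) monoid_scheme \<Rightarrow> 'a \<Rightarrow> 'a \<Rightarrow> 'a" where
  "group_Ad G x B =
     (THE D. \<forall>c. curve_at_one G c B \<longrightarrow>
        ((\<lambda>s. x \<otimes>\<^bsub>G\<^esub> c s \<otimes>\<^bsub>G\<^esub> (inv\<^bsub>G\<^esub> x)) has_vector_derivative D) (at 0))"

definition group_bracket ::
  "('a::real_normed_vector, 'm) monoid_scheme \<Rightarrow> 'a \<Rightarrow> 'a \<Rightarrow> 'a" where
  "group_bracket G A B =
     (THE D. \<forall>c. curve_at_one G c A \<longrightarrow>
        ((\<lambda>t. group_Ad G (c t) B) has_vector_derivative D) (at 0))"

section \<open>Lie--Poisson structures\<close>

text \<open>A dual space \<open>D\<close> of a Lie algebra with underlying set \<open>L\<close> is a set of functionals on \<open>L\<close>, and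
  the pairing is evaluation. Functionals are required to vanish outside \<open>L\<close>, so that equal
  elements of the dual are equal as HOL functions.\<close>

definition has_functional_derivative ::
  "('a \<Rightarrow> real) set \<Rightarrow> 'a set \<Rightarrow> (('a \<Rightarrow> real) \<Rightarrow> real) \<Rightarrow> ('a \<Rightarrow> real) \<Rightarrow> 'a \<Rightarrow> bool" where
  "has_functional_derivative D L F \<mu> x \<longleftrightarrow>
     x \<in> L \<and>
     (\<forall>\<nu>\<in>D. ((\<lambda>\<epsilon>. F (\<lambda>y. \<mu> y + \<epsilon> * \<nu> y)) has_real_derivative \<nu> x) (at 0))"

definition functional_derivative ::
  "('a \<Rightarrow> real) set \<Rightarrow> 'a set \<Rightarrow> (('a \<Rightarrow> real) \<Rightarrow> real) \<Rightarrow> ('a \<Rightarrow> real) \<Rightarrow> 'a" where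
  "functional_derivative D L F \<mu> = (THE x. has_functional_derivative D L F \<mu> x)"

definition lie_poisson ::
  "('a \<Rightarrow> real) set \<Rightarrow> 'a set \<Rightarrow> ('a \<Rightarrow> 'a \<Rightarrow> 'a) \<Rightarrow>
   (('a \<Rightarrow> real) \<Rightarrow> real) \<Rightarrow> (('a \<Rightarrow> real) \<Rightarrow> real) \<Rightarrow> ('a \<Rightarrow> real) \<Rightarrow> real" where
  "lie_poisson D L br F G \<mu> =
     \<mu> (br (functional_derivative D L F \<mu>) (functional_derivative D L G \<mu>))"

text \<open>\<open>C\<close> is the set of smooth functions on the target \<open>D\<^sub>2\<close>. Existence and uniqueness of the
  functional derivatives entering the two brackets are part of the requirement.\<close>

definition poisson_map ::
  "('a \<Rightarrow> real) set \<Rightarrow> 'a set \<Rightarrow> ('a \<Rightarrow> 'a \<Rightarrow> 'a) \<Rightarrow>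
   ('b \<Rightarrow> real) set \<Rightarrow> 'b set \<Rightarrow> ('b \<Rightarrow> 'b \<Rightarrow> 'b) \<Rightarrow> (('b \<Rightarrow> real) \<Rightarrow> real) set \<Rightarrow>
   (('a \<Rightarrow> real) \<Rightarrow> ('b \<Rightarrow> real)) \<Rightarrow> bool" where
  "poisson_map D\<^sub>1 L\<^sub>1 br\<^sub>1 D\<^sub>2 L\<^sub>2 br\<^sub>2 C J \<longleftrightarrow>
     J ` D\<^sub>1 \<subseteq> D\<^sub>2 \<and>
     (\<forall>F\<in>C. \<forall>\<mu>\<in>D\<^sub>2. \<exists>!x. has_functional_derivative D\<^sub>2 L\<^sub>2 F \<mu> x) \<and>
     (\<forall>F\<in>C. \<forall>\<mu>\<in>D\<^sub>1. \<exists>!x. has_functional_derivative D\<^sub>1 L\<^sub>1 (F \<circ> J) \<mu> x) \<and>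
     (\<forall>F\<in>C. \<forall>G\<in>C. \<forall>\<mu>\<in>D\<^sub>1.
        lie_poisson D\<^sub>1 L\<^sub>1 br\<^sub>1 (F \<circ> J) (G \<circ> J) \<mu> = lie_poisson D\<^sub>2 L\<^sub>2 br\<^sub>2 F G (J \<mu>))"

text \<open>The dual of a map \<open>i\<close> defined on \<open>L\<close>.\<close>

definition dual_map :: "'b set \<Rightarrow> ('b \<Rightarrow> 'a) \<Rightarrow> ('a \<Rightarrow> real) \<Rightarrow> 'b \<Rightarrow> real" where
  "dual_map L i \<mu> = (\<lambda>y. if y \<in> L then \<mu> (i y) else 0)"

section \<open>The phase space\<close>

text \<open>With \<open>k = CARD('k)\<close>, the phase space is \<open>\<real>\<^sup>2\<^sup>k\<close>; the coordinates \<open>q\<^sub>i\<close> and \<open>p\<^sub>i\<close> of \<open>z\<close> are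
  \<open>z $ Inl i\<close> and \<open>z $ Inr i\<close>.\<close>

type_synonym 'k phase = "(real, 'k + 'k) vec"
type_synonym 'k phase_mat = "((real, 'k + 'k) vec, 'k + 'k) vec"
type_synonym 'k triple = "'k phase_mat \<times> 'k phase \<times> real"

definition \<Omega>mat :: "'k::finite phase_mat" where
  "\<Omega>mat = (\<chi> i j. case (i, j) of
       (Inl a, Inr b) \<Rightarrow> if a = b then 1 else 0
     | (Inr a, Inl b) \<Rightarrow> if a = b then -1 else 0
     | _ \<Rightarrow> 0)"

definition \<Omega> :: "'k::finite phase \<Rightarrow> 'k phase \<Rightarrow> real" where
  "\<Omega> u v = u \<bullet> (\<Omega>mat *v v)"

definition \<alpha> :: "'k::finite phase \<Rightarrow> 'k phase \<Rightarrow> real" where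
  "\<alpha> z v = (1 / 2) * ((\<Sum>i\<in>UNIV. z $ Inl i * v $ Inr i) - (\<Sum>i\<in>UNIV. z $ Inr i * v $ Inl i))"

section \<open>Functions on phase space and their dual\<close>

definition smooth_functions :: "('k::finite phase \<Rightarrow> real) set" where
  "smooth_functions = {f. smooth f}"

definition ham_vf :: "('k::finite phase \<Rightarrow> real) \<Rightarrow> 'k phase \<Rightarrow> 'k phase" where
  "ham_vf f z = (THE X. \<forall>v. \<Omega> X v = frechet_derivative f (at z) v)"

definition poisson_bracket ::
  "('k::finite phase \<Rightarrow> real) \<Rightarrow> ('k phase \<Rightarrow> real) \<Rightarrow> 'k phase \<Rightarrow> real" where
  "poisson_bracket f g z = \<Omega> (ham_vf f z) (ham_vf g z)"

text \<open>The dual of the space of all smooth functions: linear functionals that are continuous for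
  uniform convergence of all derivatives on compact sets, i.e. distributions (of compact
  support).\<close>

definition distributions :: "(('k::finite phase \<Rightarrow> real) \<Rightarrow> real) set" where
  "distributions =
     {T. (\<forall>f\<in>smooth_functions. \<forall>g\<in>smooth_functions. \<forall>a b.
            T (\<lambda>z. a * f z + b * g z) = a * T f + b * T g) \<and>
         (\<exists>K N C. compact K \<and>
            (\<forall>f\<in>smooth_functions. \<forall>M.
               (\<forall>z\<in>K. \<forall>vs. set vs \<subseteq> Basis \<and> length vs \<le> N \<longrightarrow> \<bar>iter_deriv vs f z\<bar> \<le> M) \<longrightarrow>
               \<bar>T f\<bar> \<le> C * max 0 M)) \<and>
         (\<forall>f. f \<notin> smooth_functions \<longrightarrow> T f = 0)}"

definition compact_density :: "('k::finite phase \<Rightarrow> real) \<Rightarrow> bool" where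
  "compact_density f \<longleftrightarrow> integrable lborel f \<and> (\<exists>K. compact K \<and> (\<forall>z. z \<notin> K \<longrightarrow> f z = 0))"

definition density_functional :: "('k::finite phase \<Rightarrow> real) \<Rightarrow> ('k phase \<Rightarrow> real) \<Rightarrow> real" where
  "density_functional f h =
     (if h \<in> smooth_functions then \<integral>z. f z * h z \<partial>lborel else 0)"

section \<open>Moments\<close>

definition moments :: "(('k::finite phase \<Rightarrow> real) \<Rightarrow> real) \<Rightarrow> 'k triple" where
  "moments T = ((1 / 2) *\<^sub>R (\<chi> i j. T (\<lambda>z. z $ i * z $ j)), (\<chi> i. T (\<lambda>z. z $ i)), T (\<lambda>z. 1))"

definition density_moments :: "('k::finite phase \<Rightarrow> real) \<Rightarrow> 'k triple" where
  "density_moments f =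
     ((1 / 2) *\<^sub>R (\<integral>z. f z *\<^sub>R (\<chi> i j. z $ i * z $ j) \<partial>lborel),
      \<integral>z. f z *\<^sub>R z \<partial>lborel,
      \<integral>z. f z \<partial>lborel)"

section \<open>The quantomorphism group\<close>

definition symplectic_diffeos :: "('k::finite phase \<Rightarrow> 'k phase) set" where
  "symplectic_diffeos =
     {\<eta>. diffeo \<eta> \<and>
         (\<forall>z u v. \<Omega> (frechet_derivative \<eta> (at z) u) (frechet_derivative \<eta> (at z) v) = \<Omega> u v)}"

definition Diff\<Omega> :: "('k::finite phase \<Rightarrow> 'k phase) set" where
  "Diff\<Omega> = identity_component symplectic_diffeos"

definition \<alpha>_defect :: "('k::finite phase \<Rightarrow> 'k phase) \<Rightarrow> 'k phase \<Rightarrow> 'k phase \<Rightarrow> real" where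
  "\<alpha>_defect \<eta> z v = pullback \<eta> \<alpha> z v - \<alpha> z v"

definition cocycle_B :: "('k::finite phase \<Rightarrow> 'k phase) \<Rightarrow> ('k phase \<Rightarrow> 'k phase) \<Rightarrow> real" where
  "cocycle_B \<eta>\<^sub>1 \<eta>\<^sub>2 = integral_from_0 (\<alpha>_defect \<eta>\<^sub>1) (\<eta>\<^sub>2 0)"

definition quant_group :: "(('k::finite phase \<Rightarrow> 'k phase) \<times> real) monoid" where
  "quant_group =
     \<lparr>carrier = Diff\<Omega> \<times> UNIV,
      mult = (\<lambda>(\<eta>\<^sub>1, a\<^sub>1) (\<eta>\<^sub>2, a\<^sub>2). (\<eta>\<^sub>1 \<circ> \<eta>\<^sub>2, a\<^sub>1 + a\<^sub>2 + cocycle_B \<eta>\<^sub>1 \<eta>\<^sub>2)),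
      one = (id, 0)\<rparr>"

definition contact_form :: "'k::finite phase \<times> real \<Rightarrow> 'k phase \<times> real \<Rightarrow> real" where
  "contact_form = (\<lambda>(z, s) (v, r). \<alpha> z v - r)"

definition aut_group :: "('k::finite phase \<times> real \<Rightarrow> 'k phase \<times> real) monoid" where
  "aut_group =
     \<lparr>carrier = identity_component {\<phi>. diffeo \<phi> \<and> pullback \<phi> contact_form = contact_form},
      mult = (\<circ>),
      one = id\<rparr>"

definition quant_to_aut ::
  "('k::finite phase \<Rightarrow> 'k phase) \<times> real \<Rightarrow> 'k phase \<times> real \<Rightarrow> 'k phase \<times> real" where
  "quant_to_aut = (\<lambda>(\<eta>, a) (z, s). (\<eta> z, s + a + integral_from_0 (\<alpha>_defect \<eta>) z))"

text \<open>The identification of the Lie algebra of pairs \<open>(X\<^sub>f, u)\<close> with the smooth functions.\<close>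

definition quant_lie_to_fun :: "('k::finite phase \<Rightarrow> 'k phase) \<times> real \<Rightarrow> 'k phase \<Rightarrow> real" where
  "quant_lie_to_fun = (\<lambda>(X, u).
     THE h. \<exists>f\<in>smooth_functions. X = ham_vf f \<and> h = (\<lambda>z. u + f z - f 0))"

section \<open>The Jacobi group\<close>

definition jac_group :: "'k::finite triple monoid" where
  "jac_group =
     \<lparr>carrier = {(g, v, a). transpose g ** \<Omega>mat ** g = \<Omega>mat},
      mult = (\<lambda>(g\<^sub>1, v\<^sub>1, a\<^sub>1) (g\<^sub>2, v\<^sub>2, a\<^sub>2).
        (g\<^sub>1 ** g\<^sub>2, v\<^sub>1 + g\<^sub>1 *v v\<^sub>2, a\<^sub>1 + a\<^sub>2 + (1 / 2) * \<Omega> v\<^sub>1 (g\<^sub>1 *v v\<^sub>2))),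
      one = (mat 1, 0, 0)\<rparr>"

definition jac :: "'k::finite triple set" where
  "jac = {(\<xi>, v, a). transpose \<xi> ** \<Omega>mat + \<Omega>mat ** \<xi> = 0}"

definition jac_bracket :: "'k::finite triple \<Rightarrow> 'k triple \<Rightarrow> 'k triple" where
  "jac_bracket = group_bracket jac_group"

definition group_inclusion :: "'k::finite triple \<Rightarrow> ('k phase \<Rightarrow> 'k phase) \<times> real" where
  "group_inclusion = (\<lambda>(g, v, a). ((\<lambda>z. z + v) \<circ> (\<lambda>z. g *v z), a))"

text \<open>The tangent map at the identity of the group inclusion: the velocity of the image of any curve
  with the given velocity, where curves of diffeomorphisms are differentiated pointwise.\<close>

definition tangent_inclusion :: "'k::finite triple \<Rightarrow> ('k phase \<Rightarrow> 'k phase) \<times> real" where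
  "tangent_inclusion A =
     (THE W. \<forall>c. curve_at_one jac_group c A \<longrightarrow>
        (\<forall>z. ((\<lambda>t. fst (group_inclusion (c t)) z) has_vector_derivative fst W z) (at 0)) \<and>
        ((\<lambda>t. snd (group_inclusion (c t))) has_real_derivative snd W) (at 0))"

definition lie_inclusion :: "'k::finite triple \<Rightarrow> 'k phase \<Rightarrow> real" where
  "lie_inclusion A = quant_lie_to_fun (tangent_inclusion A)"

section \<open>The dual of the Jacobi Lie algebra\<close>

definition jac_dual :: "('k::finite triple \<Rightarrow> real) set" where
  "jac_dual =
     {\<phi>. (\<forall>A\<in>jac. \<forall>B\<in>jac. \<forall>a b. \<phi> (a *\<^sub>R A + b *\<^sub>R B) = a * \<phi> A + b * \<phi> B) \<and>
         (\<forall>A. A \<notin> jac \<longrightarrow> \<phi> A = 0)}"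

text \<open>The set below represents both the triples \<open>(S\<^sub>2, S\<^sub>1, S\<^sub>0)\<close>, with the row vector \<open>S\<^sub>1\<close> written as
  an ordinary vector, and the dual triples \<open>(X\<^sub>2, X\<^sub>1, X\<^sub>0)\<close>, with the dual of the symmetric matrices
  represented by symmetric matrices through the trace pairing.\<close>

definition sym_triples :: "'k::finite triple set" where
  "sym_triples = {(S\<^sub>2, S\<^sub>1, S\<^sub>0). transpose S\<^sub>2 = S\<^sub>2}"

definition triple_pairing :: "'k::finite triple \<Rightarrow> 'k triple \<Rightarrow> real" where
  "triple_pairing = (\<lambda>(X\<^sub>2, X\<^sub>1, X\<^sub>0) (S\<^sub>2, S\<^sub>1, S\<^sub>0). trace (X\<^sub>2 ** S\<^sub>2) + S\<^sub>1 \<bullet> X\<^sub>1 + X\<^sub>0 * S\<^sub>0)"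

definition triple_to_jac :: "'k::finite triple \<Rightarrow> 'k triple" where
  "triple_to_jac = (\<lambda>(S\<^sub>2, S\<^sub>1, S\<^sub>0). (- (matrix_inv \<Omega>mat ** S\<^sub>2), - (matrix_inv \<Omega>mat *v S\<^sub>1), S\<^sub>0))"

text \<open>The dual of \<open>triple_to_jac\<close>.\<close>

definition jac_dual_to_triple :: "('k::finite triple \<Rightarrow> real) \<Rightarrow> 'k triple" where
  "jac_dual_to_triple \<phi> =
     (THE X. X \<in> sym_triples \<and> (\<forall>S\<in>sym_triples. triple_pairing X S = \<phi> (triple_to_jac S)))"

text \<open>The symmetric triples form a linear subspace, so its smooth functions are the restrictions of
  smooth functions on the ambient space of all triples.\<close>

definition smooth_on_jac_dual :: "(('k::finite triple \<Rightarrow> real) \<Rightarrow> real) set" where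
  "smooth_on_jac_dual =
     {F. \<exists>F'. smooth F' \<and> (\<forall>\<phi>\<in>jac_dual. F \<phi> = F' (jac_dual_to_triple \<phi>))}"

end

(*
  A contact diffeomorphism preserves the Reeb field, so it is a shift in the fibre direction composed
  with a lift of the symplectic map eta that it induces on V. The lift differs from eta by a potential
  of the closed form eta^* alpha - alpha, which exists by the Poincare lemma; the composition rule
  for these potentials is the cocycle B, and differentiation under the integral carries everything
  over to isotopies.

  That the Jacobi group lands in the identity component rests on the generation of Sp(V) by
  transvections x |-> x + c Omega(u, x) u, each of which is joined to the identity by varying c. The
  same transvections, multiplied together, supply a curve with any prescribed velocity in jac, so that
  the Lie bracket and the tangent map are determined. The Lie algebra inclusion sends (xi, v, a) to the
  Hamiltonian a + Omega(xi z, z)/2 + Omega(v, z), which for the triple (S_2, S_1, S_0) is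
  S_0 + S_1 z + z^T S_2 z / 2; dualising gives the moments. The dual map is Poisson because
  d(F o J)/dT is the image of dF/dmu under the Lie algebra homomorphism.
*)

theory Submission
  imports Defs
begin

text \<open>The bracket, the tangent map, Hamiltonian fields and functional derivatives are definite
  descriptions. Each needs a witness before it can be computed with, and this shapes the proof.
  Transvections are preferred to matrix exponentials because \<open>transvection u (t * c)\<close>
  is affine in t and is inverted by changing the sign of c, so that the smoothness of the isotopy
  and of its inverse can be read off. Functional derivatives on distributions are transported from
  the finite-dimensional side, where a gradient represents them; they are unique because point
  evaluations are distributions. The factor 1/2 of the second moment is that of the Hamiltonian: z^T
  S_2 z / 2 has the gradient S_2 z and hence the field -\<Omega>^{-1} S_2 z, which is where the
  identification of triples with \<open>jac\<close> comes from. The dual consists of compactly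
  supported distributions, since every smooth function occurs as a test function. A density with
  merely finite second moments may fall outside it; such a density can still be paired with
  quadratic polynomials, and the moment formula is proved for it separately.\<close>

section \<open>Smooth maps\<close>

text \<open>Closure properties of smooth maps are proved by induction on the order of differentiability,
  because the derivatives of sums, products and composites are again of these forms.\<close>

primrec Ck :: "nat \<Rightarrow> ('a::real_normed_vector \<Rightarrow> 'b::real_normed_vector) \<Rightarrow> bool" where
  "Ck 0 f \<longleftrightarrow> (\<forall>x. f differentiable (at x))"
| "Ck (Suc n) f \<longleftrightarrow>
     (\<forall>x. f differentiable (at x)) \<and> (\<forall>v. Ck n (\<lambda>x. frechet_derivative f (at x) v))"

lemma Ck_iff_iter_deriv:
  "Ck n f \<longleftrightarrow> (\<forall>vs. length vs \<le> n \<longrightarrow> (\<forall>x. iter_deriv vs f differentiable (at x)))"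
proof (induction n arbitrary: f)
  case (Suc n)
  have "(\<forall>vs. length vs \<le> Suc n \<longrightarrow> P vs) \<longleftrightarrow>
      P [] \<and> (\<forall>v vs. length vs \<le> n \<longrightarrow> P (v # vs))" for P :: "'a list \<Rightarrow> bool"
    by (metis Suc_le_mono length_Cons list.exhaust list.size(3) zero_le)
  then show ?case using Suc by auto
qed simp

lemma smooth_iff_Ck: "smooth f \<longleftrightarrow> (\<forall>n. Ck n f)"
  by (auto simp: smooth_def Ck_iff_iter_deriv)

lemma Ck_SucD: "Ck (Suc n) f \<Longrightarrow> Ck n f"
  by (auto simp: Ck_iff_iter_deriv)

lemma Ck_has_derivative: "Ck n f \<Longrightarrow> (f has_derivative frechet_derivative f (at x)) (at x)"
  by (cases n) (auto simp: frechet_derivative_works)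

lemma Ck_SucI:
  assumes "\<And>x. (f has_derivative f' x) (at x)" "\<And>v. Ck n (\<lambda>x. f' x v)"
  shows "Ck (Suc n) f"
proof -
  have "frechet_derivative f (at x) = f' x" for x
    using frechet_derivative_at[OF assms(1)] by simp
  then show ?thesis using assms by (auto simp: differentiable_def)
qed

lemma Ck_0I: "(\<And>x. (f has_derivative f' x) (at x)) \<Longrightarrow> Ck 0 f"
  by (auto simp: differentiable_def)

lemma Ck_const: "Ck n (\<lambda>x. c)"
proof (induction n arbitrary: c)
  case 0
  show ?case by (rule Ck_0I) (rule has_derivative_const)
next
  case (Suc n)
  show ?case by (rule Ck_SucI) (rule has_derivative_const, rule Suc)
qed

lemma Ck_bounded_linear: "bounded_linear f \<Longrightarrow> Ck n f"
  by (cases n) (auto intro!: Ck_const Ck_SucI Ck_0I bounded_linear_imp_has_derivative simp del: Ck.simps)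

lemma Ck_add: "Ck n f \<Longrightarrow> Ck n g \<Longrightarrow> Ck n (\<lambda>x. f x + g x)"
proof (induction n arbitrary: f g)
  case 0
  then show ?case by simp
next
  case (Suc n)
  show ?case
  proof (rule Ck_SucI)
    show "((\<lambda>x. f x + g x) has_derivative
        (\<lambda>v. frechet_derivative f (at x) v + frechet_derivative g (at x) v)) (at x)" for x
      using Suc.prems by (intro has_derivative_add) (rule Ck_has_derivative, assumption)+
  qed (use Suc in auto)
qed

lemma Ck_sum: "(\<And>i. i \<in> I \<Longrightarrow> Ck n (f i)) \<Longrightarrow> Ck n (\<lambda>x. \<Sum>i\<in>I. f i x)"
  by (induction I rule: infinite_finite_induct) (auto intro: Ck_const Ck_add)

text \<open>Stated for an arbitrary bounded bilinear map to serve scaling, inner products, \<Omega>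
  and matrix products alike: the product rule yields two terms of the same kind, of one order
  less.\<close>

lemma Ck_bilinear:
  assumes "bounded_bilinear h"
  shows "Ck n f \<Longrightarrow> Ck n g \<Longrightarrow> Ck n (\<lambda>x. h (f x) (g x))"
proof (induction n arbitrary: f g)
  case 0
  show ?case
    by (rule Ck_0I, rule bounded_bilinear.FDERIV[OF assms])
       (use 0 in \<open>auto simp: frechet_derivative_works\<close>)
next
  case (Suc n)
  show ?case
  proof (rule Ck_SucI)
    show "((\<lambda>x. h (f x) (g x)) has_derivative (\<lambda>v. h (f x) (frechet_derivative g (at x) v) +
        h (frechet_derivative f (at x) v) (g x))) (at x)" for x
      using Suc.prems by (intro bounded_bilinear.FDERIV[OF assms]) (rule Ck_has_derivative, assumption)+
  next
    fix v
    have f: "Ck n f" and g: "Ck n g" using Suc.prems by (auto intro: Ck_SucD)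
    show "Ck n (\<lambda>x. h (f x) (frechet_derivative g (at x) v) +
        h (frechet_derivative f (at x) v) (g x))"
      using Suc.prems by (intro Ck_add Suc.IH f g) simp_all
  qed
qed

text \<open>\<open>Ck\<close> speaks of derivatives in fixed directions only. Expanding the
  direction in a basis reduces a direction that moves with the point to finitely many fixed ones
  with varying coefficients.\<close>

lemma has_derivative_linear_apply:
  fixes f' :: "'a::euclidean_space \<Rightarrow> 'b::real_normed_vector"
  assumes "(f has_derivative f') F"
  shows "f' v = (\<Sum>b\<in>Basis. (v \<bullet> b) *\<^sub>R f' b)"
proof -
  interpret bounded_linear f' using assms by (rule has_derivative_bounded_linear)
  show ?thesis
    by (subst euclidean_representation[of v, symmetric]) (simp only: sum scale)
qed

text \<open>The chain rule differentiates f in the direction Dg(x) v, which depends on x; its basis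
  expansion consists of products and composites of order n. Hence the Euclidean domain of f.\<close>

lemma Ck_compose:
  fixes f :: "'a::euclidean_space \<Rightarrow> 'b::real_normed_vector"
    and g :: "'c::real_normed_vector \<Rightarrow> 'a"
  shows "Ck n f \<Longrightarrow> Ck n g \<Longrightarrow> Ck n (\<lambda>x. f (g x))"
proof (induction n arbitrary: f)
  case 0
  then show ?case by (auto intro: differentiable_compose)
next
  case (Suc n)
  have g: "Ck n g" using Suc.prems by (auto intro: Ck_SucD)
  show ?case
  proof (rule Ck_SucI)
    show "((\<lambda>x. f (g x)) has_derivative (\<lambda>v. \<Sum>b\<in>Basis. (frechet_derivative g (at x) v \<bullet> b) *\<^sub>R
        frechet_derivative f (at (g x)) b)) (at x)" for x
      by (subst has_derivative_linear_apply[OF Ck_has_derivative[OF Suc.prems(1)], symmetric])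
        (rule has_derivative_compose[OF Ck_has_derivative[OF Suc.prems(2)] Ck_has_derivative[OF Suc.prems(1)]])
  next
    fix v
    have 1: "Ck n (\<lambda>x. frechet_derivative f (at (g x)) b)" for b
      using Suc.prems by (intro Suc.IH g) simp
    have 2: "Ck n (\<lambda>x. frechet_derivative g (at x) v \<bullet> b)" for b
      using Suc.prems by (intro Ck_bilinear[OF bounded_bilinear_inner] Ck_const) simp
    show "Ck n (\<lambda>x. \<Sum>b\<in>Basis. (frechet_derivative g (at x) v \<bullet> b) *\<^sub>R frechet_derivative f (at (g x)) b)"
      by (intro Ck_sum Ck_bilinear[OF bounded_bilinear_scaleR] 1 2)
  qed
qed

lemma smooth_has_derivative: "smooth f \<Longrightarrow> (f has_derivative frechet_derivative f (at x)) (at x)"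
  by (metis smooth_iff_Ck Ck_has_derivative)

lemma smooth_frechet_linear: "smooth f \<Longrightarrow> linear (frechet_derivative f (at x))"
  using smooth_has_derivative has_derivative_linear by blast

lemma smooth_deriv: "smooth f \<Longrightarrow> smooth (\<lambda>x. frechet_derivative f (at x) v)"
  unfolding smooth_iff_Ck by (metis Ck.simps(2))

lemma smoothI:
  assumes "\<And>x. (f has_derivative f' x) (at x)" "\<And>v. smooth (\<lambda>x. f' x v)"
  shows "smooth f"
  unfolding smooth_iff_Ck
proof
  fix n
  show "Ck n f"
    using assms Ck_SucI[of f f'] Ck_0I[of f f'] by (cases n) (auto simp: smooth_iff_Ck simp del: Ck.simps)
qed

lemma smooth_const: "smooth (\<lambda>x. c)"
  by (simp add: smooth_iff_Ck Ck_const)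

lemma smooth_bounded_linear: "bounded_linear f \<Longrightarrow> smooth f"
  by (simp add: smooth_iff_Ck Ck_bounded_linear)

lemma smooth_linear: "linear f \<Longrightarrow> smooth f" for f :: "'a::euclidean_space \<Rightarrow> 'b::real_normed_vector"
  by (simp add: smooth_bounded_linear linear_conv_bounded_linear)

lemma smooth_ident: "smooth (\<lambda>x. x)"
  by (simp add: smooth_bounded_linear)

lemma smooth_add: "smooth f \<Longrightarrow> smooth g \<Longrightarrow> smooth (\<lambda>x. f x + g x)"
  by (simp add: smooth_iff_Ck Ck_add)

lemma smooth_sum: "(\<And>i. i \<in> I \<Longrightarrow> smooth (f i)) \<Longrightarrow> smooth (\<lambda>x. \<Sum>i\<in>I. f i x)"
  by (simp add: smooth_iff_Ck Ck_sum)

lemma smooth_bilinear: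
  "bounded_bilinear h \<Longrightarrow> smooth f \<Longrightarrow> smooth g \<Longrightarrow> smooth (\<lambda>x. h (f x) (g x))"
  by (simp add: smooth_iff_Ck Ck_bilinear)

lemmas smooth_scaleR = smooth_bilinear[OF bounded_bilinear_scaleR]
lemmas smooth_inner = smooth_bilinear[OF bounded_bilinear_inner]

lemma smooth_mult: "smooth f \<Longrightarrow> smooth g \<Longrightarrow> smooth (\<lambda>x. f x * g x)"
  for f :: "'a::real_normed_vector \<Rightarrow> real"
  by (rule smooth_bilinear[OF bounded_bilinear_mult])

text \<open>\<open>smooth_compose\<close> asks for a Euclidean space in the middle. A bounded linear
  outer map commutes with differentiation, so every order reduces to the same order of f in any
  normed space.\<close>

lemma smooth_bounded_linear_compose:
  assumes "bounded_linear h" "smooth f"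
  shows "smooth (\<lambda>x. h (f x))"
proof (rule smoothI)
  show "((\<lambda>x. h (f x)) has_derivative (\<lambda>v. h (frechet_derivative f (at x) v))) (at x)" for x
    by (rule bounded_linear.has_derivative[OF assms(1) smooth_has_derivative[OF assms(2)]])
  have "smooth (\<lambda>x. h (g x))" if "smooth g" for g
    unfolding smooth_iff_Ck
  proof
    fix n
    have "\<forall>n. Ck n g" using that by (simp add: smooth_iff_Ck)
    then have "Ck n g" by simp
    then show "Ck n (\<lambda>x. h (g x))"
    proof (induction n arbitrary: g)
      case 0
      then show ?case
        by (auto simp: differentiable_def intro: bounded_linear.has_derivative[OF assms(1)])
    next
      case (Suc n)
      show ?case
        by (rule Ck_SucI, rule bounded_linear.has_derivative[OF assms(1) Ck_has_derivative[OF Suc.prems]])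
           (use Suc in auto)
    qed
  qed
  then show "smooth (\<lambda>x. h (frechet_derivative f (at x) v))" for v
    using smooth_deriv[OF assms(2)] by blast
qed

lemmas smooth_fst = smooth_bounded_linear_compose[OF bounded_linear_fst]
lemmas smooth_snd = smooth_bounded_linear_compose[OF bounded_linear_snd]
lemmas smooth_uminus = smooth_bounded_linear_compose[OF bounded_linear_minus[OF bounded_linear_ident]]

lemma smooth_diff: "smooth f \<Longrightarrow> smooth g \<Longrightarrow> smooth (\<lambda>x. f x - g x)"
  using smooth_add[OF _ smooth_uminus, of f g] by simp

lemma smooth_Pair: "smooth f \<Longrightarrow> smooth g \<Longrightarrow> smooth (\<lambda>x. (f x, g x))"
proof -
  assume fg: "smooth f" "smooth g"
  have "bounded_linear (\<lambda>y. (y, 0))" "bounded_linear (\<lambda>y. (0, y))"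
    by (auto intro!: bounded_linear_Pair bounded_linear_ident bounded_linear_zero)
  from smooth_add[OF smooth_bounded_linear_compose[OF this(1) fg(1)]
      smooth_bounded_linear_compose[OF this(2) fg(2)]]
  show ?thesis by simp
qed

lemma smooth_compose:
  fixes f :: "'a::euclidean_space \<Rightarrow> 'b::real_normed_vector"
  shows "smooth f \<Longrightarrow> smooth g \<Longrightarrow> smooth (\<lambda>x. f (g x))"
  by (simp add: smooth_iff_Ck Ck_compose)

text \<open>A direction that moves is handled by the basis expansion once more. The integrands of
  the potentials contain derivatives of this kind.\<close>

lemma smooth_frechet:
  fixes f :: "'a::euclidean_space \<Rightarrow> 'b::real_normed_vector"
  assumes "smooth f" "smooth g" "smooth h"
  shows "smooth (\<lambda>x. frechet_derivative f (at (g x)) (h x))"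
  by (subst has_derivative_linear_apply[OF smooth_has_derivative[OF assms(1)]])
     (intro smooth_sum smooth_scaleR smooth_inner smooth_const assms
        smooth_compose[OF smooth_deriv[OF assms(1)]])

lemma smooth_continuous_on: "smooth f \<Longrightarrow> continuous_on S f"
  by (meson continuous_at_imp_continuous_on has_derivative_continuous smooth_has_derivative)

lemmas smooth_intros = smooth_const smooth_ident smooth_add smooth_diff smooth_uminus smooth_scaleR
  smooth_inner smooth_mult smooth_Pair smooth_fst smooth_snd

lemma has_derivative_unique_at:
  "(f has_derivative f') (at x) \<Longrightarrow> frechet_derivative f (at x) = f'"
  using frechet_derivative_at by metis

lemma smooth_vector_derivative_compose:
  fixes f :: "'a::euclidean_space \<Rightarrow> 'b::real_normed_vector"
  assumes "smooth f" "(g has_vector_derivative v) (at t)"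
  shows "((\<lambda>t. f (g t)) has_vector_derivative frechet_derivative f (at (g t)) v) (at t)"
  using has_derivative_compose[OF assms(2)[unfolded has_vector_derivative_def] smooth_has_derivative[OF assms(1)]]
    linear_scale[OF smooth_frechet_linear[OF assms(1)]]
  by (simp add: has_vector_derivative_def)

section \<open>Integrals depending on parameters\<close>

lemma has_derivative_integral:
  fixes F :: "'a::euclidean_space \<times> real \<Rightarrow> 'b::euclidean_space"
  assumes F: "smooth F"
  shows "((\<lambda>x. integral {0..1} (\<lambda>r. F (x, r))) has_derivative
      (\<lambda>v. integral {0..1} (\<lambda>r. frechet_derivative F (at (x, r)) (v, 0)))) (at x)"
proof -
  define F' where "F' x r = Blinfun (\<lambda>v. frechet_derivative F (at (x, r)) (v, 0))" for x r
  have D: "((\<lambda>x. F (x, r)) has_derivative (\<lambda>v. frechet_derivative F (at (x, r)) (v, 0))) (at x)" for x r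
    by (rule has_derivative_compose[of "\<lambda>x. (x, r)", OF _ smooth_has_derivative[OF F]])
       (auto intro!: derivative_eq_intros)
  then have F': "blinfun_apply (F' x r) = (\<lambda>v. frechet_derivative F (at (x, r)) (v, 0))" for x r
    unfolding F'_def by (intro bounded_linear_Blinfun_apply has_derivative_bounded_linear)
  \<comment> \<open>The Leibniz rule asks for continuity in the operator norm; in finite dimension
    it suffices to check the value on each basis vector.\<close>
  have cont: "continuous_on (UNIV \<times> cbox 0 1) (\<lambda>(x, r). F' x r)"
    by (intro continuous_on_blinfun_componentwise)
       (simp add: split_beta F' smooth_continuous_on smooth_deriv F)
  have F'_int: "F' x integrable_on {0..1}" for x
  proof (rule integrable_continuous_interval)
    have "continuous_on {0..1} (Pair x)" "Pair x ` {0..1} \<subseteq> UNIV \<times> cbox 0 (1::real)"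
      by (auto intro!: continuous_intros)
    from continuous_on_compose2[OF cont this] show "continuous_on {0..1} (F' x)" by simp
  qed
  have "((\<lambda>x. integral (cbox 0 1) (\<lambda>r. F (x, r))) has_derivative
      blinfun_apply (integral (cbox 0 1) (F' x))) (at x within UNIV)"
  proof (rule leibniz_rule[OF _ _ cont])
    show "((\<lambda>x. F (x, r)) has_derivative blinfun_apply (F' x r)) (at x within UNIV)" for x r
      using D F' by simp
    show "(\<lambda>r. F (x, r)) integrable_on cbox 0 1" for x
      by (intro integrable_continuous smooth_continuous_on smooth_compose[OF F] smooth_intros)
  qed auto
  moreover have "blinfun_apply (integral (cbox 0 1) (F' x)) =
      (\<lambda>v. integral {0..1} (\<lambda>r. frechet_derivative F (at (x, r)) (v, 0)))"
    using F'_int[of x] by (auto simp: blinfun_apply_integral F')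
  ultimately show ?thesis by simp
qed

lemma smooth_integral:
  fixes F :: "'a::euclidean_space \<times> real \<Rightarrow> 'b::euclidean_space"
  assumes "smooth F"
  shows "smooth (\<lambda>x. integral {0..1} (\<lambda>r. F (x, r)))"
  unfolding smooth_iff_Ck
proof
  fix n
  show "Ck n (\<lambda>x. integral {0..1} (\<lambda>r. F (x, r)))"
    using assms
  proof (induction n arbitrary: F)
    case 0
    then show ?case by (intro Ck_0I) (rule has_derivative_integral)
  next
    case (Suc n)
    have "Ck n (\<lambda>x. integral {0..1} (\<lambda>r. (\<lambda>y. frechet_derivative F (at y) (v, 0)) (x, r)))" for v
      by (intro Suc.IH smooth_deriv Suc.prems)
    then show ?case by (intro Ck_SucI) (rule has_derivative_integral[OF Suc.prems], simp)
  qed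
qed

text \<open>Differentiate \<open>f (y + s *\<^sub>R u) - f y = s *\<^sub>R (\<integral>r\<in>{0..1}. D\<^sub>u f (y + (r * s) *\<^sub>R u))\<close> in \<open>y\<close>
  along \<open>v\<close>, and then in \<open>s\<close> at \<open>0\<close>.\<close>

lemma smooth_symmetric:
  fixes f :: "'a::euclidean_space \<Rightarrow> 'b::euclidean_space"
  assumes f: "smooth f"
  shows "frechet_derivative (\<lambda>y. frechet_derivative f (at y) u) (at x) v =
         frechet_derivative (\<lambda>y. frechet_derivative f (at y) v) (at x) u"
proof -
  let ?D = "\<lambda>u y. frechet_derivative f (at y) u"
  let ?DD = "\<lambda>y. frechet_derivative (?D u) (at y) v"
  note f' = smooth_deriv[OF f] smooth_deriv[OF smooth_deriv[OF f]]
  define K where "K s = integral {0..1} (\<lambda>r. ?DD (x + (r * s) *\<^sub>R u))" for s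
  have line: "((\<lambda>r. g (y + (r * s) *\<^sub>R u)) has_vector_derivative
      s *\<^sub>R frechet_derivative g (at (y + (r * s) *\<^sub>R u)) u) (at r)"
    if "smooth g" for g :: "'a \<Rightarrow> 'b" and y r s
  proof -
    have "((\<lambda>r. y + (r * s) *\<^sub>R u) has_vector_derivative s *\<^sub>R u) (at r)"
      by (auto intro!: derivative_eq_intros simp: has_vector_derivative_def)
    from smooth_vector_derivative_compose[OF that this] show ?thesis
      by (simp add: linear_scale[OF smooth_frechet_linear[OF that]])
  qed
  have FTC: "f (y + s *\<^sub>R u) - f y = integral {0..1} (\<lambda>r. s *\<^sub>R ?D u (y + (r * s) *\<^sub>R u))" for y s
  proof -
    have "((\<lambda>r. s *\<^sub>R ?D u (y + (r * s) *\<^sub>R u)) has_integral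
        f (y + (1 * s) *\<^sub>R u) - f (y + (0 * s) *\<^sub>R u)) {0..1}"
      using line[OF f] by (intro fundamental_theorem_of_calculus) (auto intro: has_vector_derivative_at_within)
    from integral_unique[OF this, symmetric] show ?thesis by simp
  qed
  have incr: "?D v (x + s *\<^sub>R u) - ?D v x = s *\<^sub>R K s" for s
  proof -
    define F where "F = (\<lambda>p. s *\<^sub>R ?D u (fst p + (snd p * s) *\<^sub>R u))"
    have F: "smooth F"
      unfolding F_def by (intro smooth_frechet smooth_intros f)
    have "((\<lambda>y. f (y + s *\<^sub>R u) - f y) has_derivative
        (\<lambda>v. integral {0..1} (\<lambda>r. frechet_derivative F (at (x, r)) (v, 0)))) (at x)"
      using has_derivative_integral[OF F, of x] by (simp add: FTC F_def)
    moreover have "((\<lambda>y. f (y + s *\<^sub>R u) - f y) has_derivative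
        (\<lambda>v. ?D v (x + s *\<^sub>R u) - ?D v x)) (at x)"
      by (intro has_derivative_diff smooth_has_derivative f
          has_derivative_compose[of "\<lambda>y. y + s *\<^sub>R u", OF _ smooth_has_derivative[OF f]])
         (auto intro!: derivative_eq_intros)
    ultimately have "(\<lambda>v. integral {0..1} (\<lambda>r. frechet_derivative F (at (x, r)) (v, 0))) =
        (\<lambda>v. ?D v (x + s *\<^sub>R u) - ?D v x)"
      by (rule has_derivative_unique)
    then have "?D v (x + s *\<^sub>R u) - ?D v x =
        integral {0..1} (\<lambda>r. frechet_derivative F (at (x, r)) (v, 0))"
      by (simp add: fun_eq_iff)
    moreover have "frechet_derivative F (at (x, r)) (v, 0) = s *\<^sub>R ?DD (x + (r * s) *\<^sub>R u)" for r
    proof -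
      have "(F has_derivative (\<lambda>p. s *\<^sub>R frechet_derivative (?D u) (at (x + (r * s) *\<^sub>R u))
          (fst p + (snd p * s) *\<^sub>R u))) (at (x, r))"
        unfolding F_def
        by (intro has_derivative_scaleR_right
            has_derivative_compose[of "\<lambda>p. fst p + (snd p * s) *\<^sub>R u" _ "(x, r)" UNIV "?D u", OF _ smooth_has_derivative[OF f'(1), THEN has_derivative_eq_rhs]])
           (auto intro!: derivative_eq_intros)
      then show ?thesis by (simp add: has_derivative_unique_at)
    qed
    ultimately show ?thesis by (simp add: K_def)
  qed
  have "smooth (\<lambda>p. ?DD (x + (snd p * fst p) *\<^sub>R u))"
    by (intro smooth_compose[OF f'(2)] smooth_intros)
  then have "smooth K"
    unfolding K_def using smooth_integral[of "\<lambda>p. ?DD (x + (snd p * fst p) *\<^sub>R u)"] by simp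
  then obtain K' where K': "(K has_derivative K') (at 0)" using smooth_has_derivative by blast
  \<comment> \<open>The factor s vanishes at 0, so the unknown derivative K' drops out and only the
    value K 0 survives.\<close>
  have "((\<lambda>s. s *\<^sub>R K s) has_derivative (\<lambda>h. 0 *\<^sub>R K' h + h *\<^sub>R K 0)) (at 0)"
    by (rule has_derivative_scaleR[OF has_derivative_ident K'])
  then have 1: "((\<lambda>s. s *\<^sub>R K s) has_vector_derivative K 0) (at 0)"
    by (simp add: has_vector_derivative_def)
  have "((\<lambda>s. x + s *\<^sub>R u) has_vector_derivative u) (at 0)"
    by (auto intro!: derivative_eq_intros simp: has_vector_derivative_def)
  from smooth_vector_derivative_compose[OF f'(1) this, of v]
  have "((\<lambda>s. ?D v (x + s *\<^sub>R u) - ?D v x) has_vector_derivative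
      frechet_derivative (?D v) (at x) u) (at 0)"
    by (auto intro!: derivative_eq_intros)
  then have "K 0 = frechet_derivative (?D v) (at x) u"
    using vector_derivative_unique_at[OF 1] by (simp add: incr)
  then show ?thesis by (simp add: K_def)
qed

text \<open>Poincare lemma along rays. Differentiating \<beta> (t x) x in x along v gives t times a
  derivative of \<beta>, plus \<beta> (t x) v. Closedness interchanges x and v in the first term,
  which makes the sum the t-derivative of t * \<beta> (t x) v, and its integral over [0, 1] is
  \<beta> x v.\<close>

lemma closed_form_potential:
  fixes \<beta> :: "'a::euclidean_space \<Rightarrow> 'a \<Rightarrow> real"
  assumes smooth: "smooth (\<lambda>p. \<beta> (fst p) (snd p))"
    and lin: "\<And>x. linear (\<beta> x)"
    and closed: "\<And>x u v. frechet_derivative (\<lambda>y. \<beta> y u) (at x) v = frechet_derivative (\<lambda>y. \<beta> y v) (at x) u"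
  shows "(integral_from_0 \<beta> has_derivative \<beta> x) (at x)"
proof -
  define F where "F = (\<lambda>p. \<beta> (snd p *\<^sub>R fst p) (fst p))"
  have F: "smooth F"
    unfolding F_def by (intro smooth_compose[OF smooth, of "\<lambda>p. (snd p *\<^sub>R fst p, fst p)", simplified] smooth_intros)
  have \<beta>': "smooth (\<lambda>y. \<beta> y u)" for u
    by (intro smooth_compose[OF smooth, of "\<lambda>y. (y, u)", simplified] smooth_intros)
  let ?B = "\<lambda>p. \<beta> (fst p) (snd p)"
  have B1: "frechet_derivative ?B (at (y, w)) (h, 0) = frechet_derivative (\<lambda>y. \<beta> y w) (at y) h" for y w h
  proof -
    have "((\<lambda>y. ?B (y, w)) has_derivative (\<lambda>h. frechet_derivative ?B (at (y, w)) (h, 0))) (at y)"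
      by (rule has_derivative_compose[of "\<lambda>y. (y, w)", OF _ smooth_has_derivative[OF smooth]])
         (auto intro!: derivative_eq_intros)
    then show ?thesis by (simp add: has_derivative_unique_at)
  qed
  have B2: "frechet_derivative ?B (at (y, w)) (0, k) = \<beta> y k" for y w k
  proof -
    have "((\<lambda>w. ?B (y, w)) has_derivative (\<lambda>k. frechet_derivative ?B (at (y, w)) (0, k))) (at w)"
      by (rule has_derivative_compose[of "\<lambda>w. (y, w)", OF _ smooth_has_derivative[OF smooth]])
         (auto intro!: derivative_eq_intros)
    moreover have "((\<lambda>w. ?B (y, w)) has_derivative \<beta> y) (at w)"
      using linear_imp_has_derivative[OF lin] by simp
    ultimately have "(\<lambda>k. frechet_derivative ?B (at (y, w)) (0, k)) = \<beta> y"
      by (rule has_derivative_unique)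
    then show ?thesis by (rule fun_cong)
  qed
  have F': "frechet_derivative F (at (x, t)) (v, 0) =
      t * frechet_derivative (\<lambda>y. \<beta> y v) (at (t *\<^sub>R x)) x + \<beta> (t *\<^sub>R x) v" for v t
  proof -
    have "((\<lambda>p. ?B (snd p *\<^sub>R fst p, fst p)) has_derivative
        (\<lambda>q. frechet_derivative ?B (at (t *\<^sub>R x, x)) (t *\<^sub>R fst q + snd q *\<^sub>R x, fst q))) (at (x, t))"
      by (rule has_derivative_compose[of "\<lambda>p. (snd p *\<^sub>R fst p, fst p)", OF _
            smooth_has_derivative[OF smooth, THEN has_derivative_eq_rhs]])
         (auto intro!: derivative_eq_intros)
    then have "frechet_derivative F (at (x, t)) (v, 0) = frechet_derivative ?B (at (t *\<^sub>R x, x)) (t *\<^sub>R v, v)"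
      by (simp add: has_derivative_unique_at F_def)
    also have "\<dots> = frechet_derivative ?B (at (t *\<^sub>R x, x)) ((t *\<^sub>R v, 0) + (0, v))"
      by simp
    also have "\<dots> = frechet_derivative (\<lambda>y. \<beta> y x) (at (t *\<^sub>R x)) (t *\<^sub>R v) + \<beta> (t *\<^sub>R x) v"
      by (subst linear_add[OF smooth_frechet_linear[OF smooth]]) (simp only: B1 B2)
    also have "\<dots> = t * frechet_derivative (\<lambda>y. \<beta> y x) (at (t *\<^sub>R x)) v + \<beta> (t *\<^sub>R x) v"
      by (simp add: linear_scale[OF smooth_frechet_linear[OF \<beta>']])
    finally show ?thesis by (simp add: closed)
  qed
  have "integral {0..1} (\<lambda>t. frechet_derivative F (at (x, t)) (v, 0)) = \<beta> x v" for v
  proof -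
    have "((\<lambda>t. t * \<beta> (t *\<^sub>R x) v) has_vector_derivative frechet_derivative F (at (x, t)) (v, 0)) (at t)" for t
    proof -
      have "((\<lambda>t. t *\<^sub>R x) has_vector_derivative x) (at t)"
        by (auto intro!: derivative_eq_intros simp: has_vector_derivative_def)
      from smooth_vector_derivative_compose[OF \<beta>' this]
      have "((\<lambda>t. \<beta> (t *\<^sub>R x) v) has_real_derivative frechet_derivative (\<lambda>y. \<beta> y v) (at (t *\<^sub>R x)) x) (at t)"
        by (simp add: has_real_derivative_iff_has_vector_derivative)
      from DERIV_mult[OF DERIV_ident this]
      show ?thesis by (simp add: F' has_real_derivative_iff_has_vector_derivative[symmetric] algebra_simps)
    qed
    then have "((\<lambda>t. frechet_derivative F (at (x, t)) (v, 0)) has_integral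
        1 * \<beta> (1 *\<^sub>R x) v - 0 * \<beta> (0 *\<^sub>R x) v) {0..1}"
      by (intro fundamental_theorem_of_calculus) (auto intro: has_vector_derivative_at_within)
    then show ?thesis by (simp add: integral_unique)
  qed
  then show ?thesis
    using has_derivative_integral[OF F, of x] by (simp add: F_def integral_from_0_def[abs_def])
qed

section \<open>Identity components of groups of diffeomorphisms\<close>

lemma inv_equality: "(\<And>x. g (f x) = x) \<Longrightarrow> (\<And>y. f (g y) = y) \<Longrightarrow> inv_into UNIV f = g"
  by (rule inv_unique_comp) auto

lemma diffeoI:
  assumes "smooth f" "smooth g" "\<And>x. g (f x) = x" "\<And>y. f (g y) = y"
  shows "diffeo f"
proof -
  have "bij f" by (rule o_bij[of g]) (use assms in auto)
  then show ?thesis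
    using assms inv_equality[of g f] by (simp add: diffeo_def)
qed

lemma diffeo_smooth: "diffeo f \<Longrightarrow> smooth f"
  by (simp add: diffeo_def)

lemma diffeo_id: "diffeo id"
  by (rule diffeoI[of _ id]) (auto simp: id_def smooth_ident)

lemma diffeo_comp: "diffeo f \<Longrightarrow> diffeo g \<Longrightarrow> diffeo (f \<circ> g)"
  for f :: "'a::euclidean_space \<Rightarrow> 'a"
  by (simp add: diffeo_def bij_comp o_inv_distrib) (simp add: o_def smooth_compose)

lemma diffeo_inv: "diffeo f \<Longrightarrow> diffeo (inv_into UNIV f)"
  by (auto simp: diffeo_def bij_imp_bij_inv inv_inv_eq)

lemma level_diffeoI:
  fixes H K :: "real \<Rightarrow> 'a::real_normed_vector \<Rightarrow> 'a"
  assumes "smooth (\<lambda>p. H (fst p) (snd p))" "smooth (\<lambda>p. K (fst p) (snd p))"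
    and "\<And>t x. K t (H t x) = x" "\<And>t y. H t (K t y) = y"
  shows "diffeo (\<lambda>(t, x). (t, H t x))"
  by (rule diffeoI[of _ "\<lambda>(t, x). (t, K t x)"])
     (use assms in \<open>auto simp: case_prod_unfold intro!: smooth_Pair smooth_bounded_linear[OF bounded_linear_fst]\<close>)

text \<open>A bijection that keeps the level t is bijective on each level, and its inverse keeps
  levels too. Smoothness of the inverse of the whole map is thus joint smoothness of the inverses of
  the levels.\<close>

lemma level_diffeoD:
  fixes H :: "real \<Rightarrow> 'a::real_normed_vector \<Rightarrow> 'a"
  assumes "diffeo (\<lambda>(t, x). (t, H t x))" (is "diffeo ?L")
  shows "bij (H t)" "smooth (\<lambda>p. H (fst p) (snd p))" "smooth (\<lambda>p. inv_into UNIV (H (fst p)) (snd p))"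
proof -
  have bij: "bij ?L" using assms by (simp add: diffeo_def)
  have H: "bij (H t)" for t
  proof (rule bijI)
    show "inj (H t)"
      by (rule injI) (use injD[OF bij_is_inj[OF bij], of "(t, _)" "(t, _)"] in auto)
    show "surj (H t)"
    proof (unfold surj_def, rule allI)
      fix y
      obtain p where "(t, y) = ?L p" using bij_is_surj[OF bij] by (metis surjD)
      then show "\<exists>x. y = H t x" by (cases p) auto
    qed
  qed
  show "bij (H t)" by (rule H)
  have "inv_into UNIV ?L = (\<lambda>(t, y). (t, inv_into UNIV (H t) y))"
    by (rule inv_equality) (auto simp: H bij_is_inj bij_is_surj surj_f_inv_f)
  then have "smooth ?L" "smooth (\<lambda>(t, y). (t, inv_into UNIV (H t) y))"
    using assms by (simp_all add: diffeo_def)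
  from this[THEN smooth_snd]
  show "smooth (\<lambda>p. H (fst p) (snd p))" "smooth (\<lambda>p. inv_into UNIV (H (fst p)) (snd p))"
    by (simp_all add: case_prod_unfold)
qed

lemma identity_componentI:
  fixes H K :: "real \<Rightarrow> 'a::real_normed_vector \<Rightarrow> 'a"
  assumes "smooth (\<lambda>p. H (fst p) (snd p))" "smooth (\<lambda>p. K (fst p) (snd p))"
    and "\<And>t x. K t (H t x) = x" "\<And>t y. H t (K t y) = y"
    and "\<And>t. H t \<in> \<G>" "H 0 = id" "H 1 = f"
  shows "f \<in> identity_component \<G>"
  using assms level_diffeoI[of H K] by (auto simp: identity_component_def)

lemma identity_componentE:
  fixes f :: "'a::real_normed_vector \<Rightarrow> 'a"
  assumes "f \<in> identity_component \<G>"
  obtains H :: "real \<Rightarrow> 'a \<Rightarrow> 'a" where "smooth (\<lambda>p. H (fst p) (snd p))" "smooth (\<lambda>p. inv_into UNIV (H (fst p)) (snd p))"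
    and "\<And>t. bij (H t)" "\<And>t. H t \<in> \<G>" "H 0 = id" "H 1 = f"
  using assms level_diffeoD unfolding identity_component_def by blast

lemma identity_component_subset: "identity_component \<G> \<subseteq> \<G>"
  by (auto simp: identity_component_def)

lemma identity_component_id: "id \<in> \<G> \<Longrightarrow> id \<in> identity_component \<G>"
  by (rule identity_componentI[of "\<lambda>t. id" "\<lambda>t. id"])
     (auto intro: smooth_bounded_linear bounded_linear_snd)

lemma identity_component_comp:
  fixes \<G> :: "('a::euclidean_space \<Rightarrow> 'a) set"
  assumes comp: "\<And>f g. f \<in> \<G> \<Longrightarrow> g \<in> \<G> \<Longrightarrow> f \<circ> g \<in> \<G>"
    and fg: "f \<in> identity_component \<G>" "g \<in> identity_component \<G>"
  shows "f \<circ> g \<in> identity_component \<G>"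
proof -
  from fg(1) obtain H :: "real \<Rightarrow> 'a \<Rightarrow> 'a" where H: "smooth (\<lambda>p. H (fst p) (snd p))" "smooth (\<lambda>p. inv_into UNIV (H (fst p)) (snd p))"
    "\<And>t. bij (H t)" "\<And>t. H t \<in> \<G>" "H 0 = id" "H 1 = f"
    by (rule identity_componentE) blast
  from fg(2) obtain K :: "real \<Rightarrow> 'a \<Rightarrow> 'a" where K: "smooth (\<lambda>p. K (fst p) (snd p))" "smooth (\<lambda>p. inv_into UNIV (K (fst p)) (snd p))"
    "\<And>t. bij (K t)" "\<And>t. K t \<in> \<G>" "K 0 = id" "K 1 = g"
    by (rule identity_componentE) blast
  show ?thesis
  proof (rule identity_componentI[of "\<lambda>t. H t \<circ> K t" "\<lambda>t. inv_into UNIV (K t) \<circ> inv_into UNIV (H t)"])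
    show "smooth (\<lambda>p. (H (fst p) \<circ> K (fst p)) (snd p))"
      using smooth_compose[OF H(1) smooth_Pair[OF smooth_bounded_linear[OF bounded_linear_fst] K(1)]]
      by simp
    show "smooth (\<lambda>p. (inv_into UNIV (K (fst p)) \<circ> inv_into UNIV (H (fst p))) (snd p))"
      using smooth_compose[OF K(2) smooth_Pair[OF smooth_bounded_linear[OF bounded_linear_fst] H(2)]]
      by simp
  qed (use H K comp in \<open>auto simp: bij_is_inj bij_is_surj surj_f_inv_f\<close>)
qed

lemma identity_component_inv:
  fixes \<G> :: "('a::real_normed_vector \<Rightarrow> 'a) set"
  assumes "\<And>f. f \<in> \<G> \<Longrightarrow> inv_into UNIV f \<in> \<G>" "f \<in> identity_component \<G>"
  shows "inv_into UNIV f \<in> identity_component \<G>"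
proof -
  from assms(2) obtain H :: "real \<Rightarrow> 'a \<Rightarrow> 'a" where H: "smooth (\<lambda>p. H (fst p) (snd p))" "smooth (\<lambda>p. inv_into UNIV (H (fst p)) (snd p))"
    "\<And>t. bij (H t)" "\<And>t. H t \<in> \<G>" "H 0 = id" "H 1 = f"
    by (rule identity_componentE) blast
  show ?thesis
    by (rule identity_componentI[of "\<lambda>t. inv_into UNIV (H t)" H])
       (use H assms(1) in \<open>auto simp: bij_is_inj bij_is_surj surj_f_inv_f\<close>)
qed

lemma group_of_bijections:
  assumes "\<And>f. f \<in> \<G> \<Longrightarrow> bij f" "id \<in> \<G>"
    and "\<And>f g. f \<in> \<G> \<Longrightarrow> g \<in> \<G> \<Longrightarrow> f \<circ> g \<in> \<G>" "\<And>f. f \<in> \<G> \<Longrightarrow> inv_into UNIV f \<in> \<G>"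
  shows "group \<lparr>carrier = \<G>, mult = (\<circ>), one = id\<rparr>"
proof (rule groupI)
  fix f assume "f \<in> carrier \<lparr>carrier = \<G>, mult = (\<circ>), one = id\<rparr>"
  then have "inv_into UNIV f \<in> \<G>" "inv_into UNIV f \<circ> f = id" using assms by (auto simp: bij_is_inj)
  then show "\<exists>g\<in>carrier \<lparr>carrier = \<G>, mult = (\<circ>), one = id\<rparr>. g \<otimes>\<^bsub>\<lparr>carrier = \<G>, mult = (\<circ>), one = id\<rparr>\<^esub> f
      = \<one>\<^bsub>\<lparr>carrier = \<G>, mult = (\<circ>), one = id\<rparr>\<^esub>"
    by auto
qed (use assms in \<open>auto simp: o_assoc\<close>)

lemma frechet_derivative_inv:
  fixes f :: "'a::euclidean_space \<Rightarrow> 'a"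
  assumes "diffeo f"
  shows "frechet_derivative f (at (inv_into UNIV f y)) (frechet_derivative (inv_into UNIV f) (at y) v) = v"
proof -
  have f: "bij f" "smooth f" "smooth (inv_into UNIV f)" using assms by (auto simp: diffeo_def)
  have "((\<lambda>y. f (inv_into UNIV f y)) has_derivative
      (\<lambda>v. frechet_derivative f (at (inv_into UNIV f y)) (frechet_derivative (inv_into UNIV f) (at y) v))) (at y)"
    by (rule has_derivative_compose[OF smooth_has_derivative[OF f(3)] smooth_has_derivative[OF f(2)]])
  moreover have "(\<lambda>y. f (inv_into UNIV f y)) = (\<lambda>y. y)" using f(1) by (simp add: bij_is_surj surj_f_inv_f)
  ultimately have "((\<lambda>y. y) has_derivative
      (\<lambda>v. frechet_derivative f (at (inv_into UNIV f y)) (frechet_derivative (inv_into UNIV f) (at y) v))) (at y)"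
    by simp
  from has_derivative_unique[OF this has_derivative_ident] show ?thesis by (rule fun_cong)
qed

lemma frechet_derivative_comp:
  "smooth f \<Longrightarrow> smooth g \<Longrightarrow>
   frechet_derivative (f \<circ> g) (at x) v = frechet_derivative f (at (g x)) (frechet_derivative g (at x) v)"
  using has_derivative_unique_at[OF has_derivative_compose[OF smooth_has_derivative[of g] smooth_has_derivative[of f]]]
  by (simp add: o_def)

lemma frechet_derivative_id_apply: "frechet_derivative id (at x) v = v"
  using has_derivative_unique_at[OF has_derivative_id] by (metis id_def)

section \<open>The symplectic form\<close>

lemma sum_UNIV_Plus:
  "(\<Sum>i\<in>(UNIV :: ('a::finite + 'b::finite) set). f i) = (\<Sum>a\<in>UNIV. f (Inl a)) + (\<Sum>b\<in>UNIV. f (Inr b))"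
  by (subst UNIV_Plus_UNIV[symmetric]) (simp add: sum.Plus del: UNIV_Plus_UNIV)

lemma \<Omega>mat_mult_nth:
  "(\<Omega>mat *v v) $ Inl a = v $ Inr a" "(\<Omega>mat *v v) $ Inr a = - v $ Inl a"
  by (auto simp: matrix_vector_mult_def \<Omega>mat_def sum_UNIV_Plus if_distrib[of "\<lambda>x. x * _"] cong: if_cong)

lemma \<Omega>_coordinates:
  "\<Omega> u v = (\<Sum>i\<in>UNIV. u $ Inl i * v $ Inr i) - (\<Sum>i\<in>UNIV. u $ Inr i * v $ Inl i)"
  by (simp add: \<Omega>_def inner_vec_def sum_UNIV_Plus \<Omega>mat_mult_nth sum_negf)

lemma \<alpha>_eq: "\<alpha> z v = \<Omega> z v / 2"
  by (simp add: \<alpha>_def \<Omega>_coordinates)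

lemma \<Omega>_skew: "\<Omega> u v = - \<Omega> v u"
  by (simp add: \<Omega>_coordinates mult.commute)

lemma \<Omega>_self [simp]: "\<Omega> u u = 0"
  using \<Omega>_skew[of u u] by simp

lemma \<Omega>mat_vec_square: "\<Omega>mat *v (\<Omega>mat *v v) = - v"
proof -
  have "(\<Omega>mat *v (\<Omega>mat *v v)) $ i = (- v) $ i" for i
    by (cases i) (simp_all add: \<Omega>mat_mult_nth)
  then show ?thesis by (simp add: vec_eq_iff)
qed

text \<open>Since \<Omega>mat squares to -1, it turns \<Omega> into the Euclidean inner product.
  This is how a linear functional given by its values on a basis becomes one of the form \<Omega>
  X.\<close>

lemma \<Omega>_\<Omega>mat_left: "\<Omega> (\<Omega>mat *v u) v = u \<bullet> v"
  by (simp add: \<Omega>_coordinates inner_vec_def sum_UNIV_Plus \<Omega>mat_mult_nth sum_negf)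

lemma bounded_bilinear_\<Omega>: "bounded_bilinear \<Omega>"
  unfolding \<Omega>_def
  by (rule bounded_bilinear.comp[OF bounded_bilinear_inner bounded_linear_ident]) simp

interpretation \<Omega>: bounded_bilinear \<Omega>
  by (rule bounded_bilinear_\<Omega>)

declare \<Omega>.zero_left [simp] \<Omega>.zero_right [simp]

lemmas smooth_\<Omega> = smooth_bilinear[OF bounded_bilinear_\<Omega>]

lemma \<Omega>_nondegenerate: "(\<And>v. \<Omega> u v = 0) \<Longrightarrow> u = 0"
  using \<Omega>_\<Omega>mat_left[of u u] \<Omega>_skew[of u "\<Omega>mat *v u"] by auto

lemma \<Omega>_eqI: "(\<And>v. \<Omega> u v = \<Omega> w v) \<Longrightarrow> u = w"
  using \<Omega>_nondegenerate[of "u - w"] by (simp add: \<Omega>.diff_left)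

lemma symplectic_diffeosD:
  assumes "\<eta> \<in> symplectic_diffeos"
  shows "diffeo \<eta>" "smooth \<eta>" "bij \<eta>"
    and "\<Omega> (frechet_derivative \<eta> (at z) u) (frechet_derivative \<eta> (at z) v) = \<Omega> u v"
  using assms by (auto simp: symplectic_diffeos_def diffeo_def)

lemma symplectic_diffeos_id: "id \<in> symplectic_diffeos"
  by (simp add: symplectic_diffeos_def diffeo_id frechet_derivative_id_apply)

lemma symplectic_diffeos_comp:
  "f \<in> symplectic_diffeos \<Longrightarrow> g \<in> symplectic_diffeos \<Longrightarrow> f \<circ> g \<in> symplectic_diffeos"
  by (simp add: symplectic_diffeos_def frechet_derivative_comp diffeo_comp diffeo_smooth)

lemma symplectic_diffeos_inv: "f \<in> symplectic_diffeos \<Longrightarrow> inv_into UNIV f \<in> symplectic_diffeos"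
proof -
  assume f: "f \<in> symplectic_diffeos"
  have "\<Omega> (frechet_derivative (inv_into UNIV f) (at z) u) (frechet_derivative (inv_into UNIV f) (at z) v) = \<Omega> u v"
    for z u v
    using symplectic_diffeosD(4)[OF f, of "inv_into UNIV f z" "frechet_derivative (inv_into UNIV f) (at z) u"
        "frechet_derivative (inv_into UNIV f) (at z) v"] symplectic_diffeosD(1)[OF f]
    by (simp add: frechet_derivative_inv)
  then show "inv_into UNIV f \<in> symplectic_diffeos"
    using symplectic_diffeosD(1)[OF f] by (simp add: symplectic_diffeos_def diffeo_inv)
qed

lemma Diff\<Omega>_symplectic: "\<eta> \<in> Diff\<Omega> \<Longrightarrow> \<eta> \<in> symplectic_diffeos"
  using identity_component_subset by (auto simp: Diff\<Omega>_def)

lemma Diff\<Omega>_id: "id \<in> Diff\<Omega>"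
  by (simp add: Diff\<Omega>_def identity_component_id symplectic_diffeos_id)

lemma Diff\<Omega>_comp: "f \<in> Diff\<Omega> \<Longrightarrow> g \<in> Diff\<Omega> \<Longrightarrow> f \<circ> g \<in> Diff\<Omega>"
  by (simp add: Diff\<Omega>_def identity_component_comp symplectic_diffeos_comp)

lemma Diff\<Omega>_inv: "f \<in> Diff\<Omega> \<Longrightarrow> inv_into UNIV f \<in> Diff\<Omega>"
  by (simp add: Diff\<Omega>_def identity_component_inv symplectic_diffeos_inv)

section \<open>Quantomorphisms\<close>

lemma \<alpha>_defect_eq:
  "\<alpha>_defect \<eta> z v = (\<Omega> (\<eta> z) (frechet_derivative \<eta> (at z) v) - \<Omega> z v) / 2"
  by (simp add: \<alpha>_defect_def pullback_def \<alpha>_eq diff_divide_distrib)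

lemma smooth_\<alpha>_defect:
  assumes "smooth \<eta>" shows "smooth (\<lambda>p. \<alpha>_defect \<eta> (fst p) (snd p))"
  unfolding \<alpha>_defect_eq divide_inverse
  by (intro smooth_intros smooth_\<Omega> smooth_compose[OF assms] smooth_frechet[OF assms])

lemma linear_\<alpha>_defect: "smooth \<eta> \<Longrightarrow> linear (\<alpha>_defect \<eta> z)"
  by (rule linearI)
     (simp_all add: \<alpha>_defect_eq linear_add[OF smooth_frechet_linear] linear_scale[OF smooth_frechet_linear]
        \<Omega>.add_right \<Omega>.scaleR_right algebra_simps add_divide_distrib diff_divide_distrib)

text \<open>The first-order terms cancel since \<open>\<eta>\<close> is symplectic, and the second derivative of \<open>\<eta>\<close> is
  symmetric.\<close>

lemma \<alpha>_defect_closed: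
  assumes "\<eta> \<in> symplectic_diffeos"
  shows "frechet_derivative (\<lambda>y. \<alpha>_defect \<eta> y u) (at x) v = frechet_derivative (\<lambda>y. \<alpha>_defect \<eta> y v) (at x) u"
proof -
  note \<eta> = symplectic_diffeosD[OF assms]
  have *: "frechet_derivative (\<lambda>y. \<alpha>_defect \<eta> y u) (at x) v =
      \<Omega> (\<eta> x) (frechet_derivative (\<lambda>y. frechet_derivative \<eta> (at y) u) (at x) v) / 2" for u v
  proof -
    have "((\<lambda>y. \<alpha>_defect \<eta> y u) has_derivative (\<lambda>v.
        (\<Omega> (\<eta> x) (frechet_derivative (\<lambda>y. frechet_derivative \<eta> (at y) u) (at x) v)
         + \<Omega> (frechet_derivative \<eta> (at x) v) (frechet_derivative \<eta> (at x) u) - \<Omega> v u) / 2)) (at x)"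
      unfolding \<alpha>_defect_eq divide_inverse
      by (intro has_derivative_mult_left has_derivative_diff \<Omega>.FDERIV smooth_has_derivative smooth_deriv \<eta>
          bounded_linear_imp_has_derivative \<Omega>.bounded_linear_left)
    then show ?thesis by (simp add: has_derivative_unique_at \<eta>)
  qed
  show ?thesis by (simp add: * smooth_symmetric[OF \<eta>(2), of u])
qed

lemma potential_has_derivative:
  assumes "\<eta> \<in> symplectic_diffeos"
  shows "(integral_from_0 (\<alpha>_defect \<eta>) has_derivative \<alpha>_defect \<eta> x) (at x)"
  by (intro closed_form_potential smooth_\<alpha>_defect linear_\<alpha>_defect \<alpha>_defect_closed
      symplectic_diffeosD assms)

lemma potential_0:
  assumes "\<eta> \<in> symplectic_diffeos"
  shows "integral_from_0 (\<alpha>_defect \<eta>) 0 = 0"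
  using linear_0[OF linear_\<alpha>_defect[OF symplectic_diffeosD(2)[OF assms]]]
  by (simp add: integral_from_0_def)

lemma has_derivative_eq_const:
  fixes f g :: "'a::real_normed_vector \<Rightarrow> 'b::real_normed_vector"
  assumes "\<And>x. (f has_derivative f' x) (at x)" "\<And>x. (g has_derivative f' x) (at x)"
  shows "f x - g x = f y - g y"
  by (rule has_derivative_zero_unique[of UNIV "\<lambda>x. f x - g x"])
     (auto intro: has_derivative_eq_rhs[OF has_derivative_diff[OF assms]])

text \<open>Two primitives of one form differ by a constant, and \<open>integral_from_0\<close> is
  the primitive that vanishes at 0.\<close>

lemma potential_unique:
  assumes "\<eta> \<in> symplectic_diffeos" "\<And>x. (f has_derivative \<alpha>_defect \<eta> x) (at x)"
  shows "f z = f 0 + integral_from_0 (\<alpha>_defect \<eta>) z"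
  using has_derivative_eq_const[OF assms(2) potential_has_derivative[OF assms(1)], of z 0]
    potential_0[OF assms(1)] by simp

text \<open>The defect of the composite is the pullback by \<eta>2 of the defect of \<eta>1, plus
  the defect of \<eta>2, so the potentials add up to a primitive. Normalising it at 0 costs the
  value of the first potential at \<eta>2 0, which is the cocycle B.\<close>

lemma potential_comp:
  assumes \<eta>: "\<eta>\<^sub>1 \<in> symplectic_diffeos" "\<eta>\<^sub>2 \<in> symplectic_diffeos"
  shows "integral_from_0 (\<alpha>_defect (\<eta>\<^sub>1 \<circ> \<eta>\<^sub>2)) z =
    integral_from_0 (\<alpha>_defect \<eta>\<^sub>1) (\<eta>\<^sub>2 z) - cocycle_B \<eta>\<^sub>1 \<eta>\<^sub>2 + integral_from_0 (\<alpha>_defect \<eta>\<^sub>2) z"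
proof -
  let ?f = "\<lambda>z. integral_from_0 (\<alpha>_defect \<eta>\<^sub>1) (\<eta>\<^sub>2 z) + integral_from_0 (\<alpha>_defect \<eta>\<^sub>2) z"
  have "(?f has_derivative (\<lambda>v. \<alpha>_defect \<eta>\<^sub>1 (\<eta>\<^sub>2 x) (frechet_derivative \<eta>\<^sub>2 (at x) v) + \<alpha>_defect \<eta>\<^sub>2 x v)) (at x)" for x
    by (intro has_derivative_add potential_has_derivative \<eta>
        has_derivative_compose[OF smooth_has_derivative potential_has_derivative] symplectic_diffeosD)
  moreover have "(\<lambda>v. \<alpha>_defect \<eta>\<^sub>1 (\<eta>\<^sub>2 x) (frechet_derivative \<eta>\<^sub>2 (at x) v) + \<alpha>_defect \<eta>\<^sub>2 x v) =
      \<alpha>_defect (\<eta>\<^sub>1 \<circ> \<eta>\<^sub>2) x" for x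
    by (simp add: \<alpha>_defect_eq frechet_derivative_comp symplectic_diffeosD[OF \<eta>(1)] symplectic_diffeosD[OF \<eta>(2)]
        fun_eq_iff diff_divide_distrib)
  ultimately have "(?f has_derivative \<alpha>_defect (\<eta>\<^sub>1 \<circ> \<eta>\<^sub>2) x) (at x)" for x by simp
  from potential_unique[OF symplectic_diffeos_comp[OF \<eta>] this, of z]
  show ?thesis by (simp add: cocycle_B_def potential_0[OF \<eta>(2)])
qed

text \<open>The derivative of \<open>H t\<close> in z is the joint derivative of H in the direction
  (0, v). With this the integrand is smooth in time, point and integration variable together, and
  differentiation under the integral applies.\<close>

lemma smooth_potential_isotopy:
  fixes H :: "real \<Rightarrow> 'k::finite phase \<Rightarrow> 'k phase"
  assumes H: "smooth (\<lambda>p. H (fst p) (snd p))"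
  shows "smooth (\<lambda>p. integral_from_0 (\<alpha>_defect (H (fst p))) (snd p))"
proof -
  let ?H = "\<lambda>p. H (fst p) (snd p)"
  have D: "frechet_derivative (H t) (at y) v = frechet_derivative ?H (at (t, y)) (0, v)" for t y v
  proof -
    have "((\<lambda>y. ?H (t, y)) has_derivative (\<lambda>v. frechet_derivative ?H (at (t, y)) (0, v))) (at y)"
      by (rule has_derivative_compose[of "\<lambda>y. (t, y)", OF _ smooth_has_derivative[OF H]])
         (auto intro!: derivative_eq_intros)
    then show ?thesis by (simp add: has_derivative_unique_at)
  qed
  \<comment> \<open>Here q = ((t, z), r): the parameters come first, and r runs along the segment
    from 0 to z.\<close>
  define F where "F = (\<lambda>q. (\<Omega> (?H (fst (fst q), snd q *\<^sub>R snd (fst q)))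
        (frechet_derivative ?H (at (fst (fst q), snd q *\<^sub>R snd (fst q))) (0, snd (fst q)))
      - \<Omega> (snd q *\<^sub>R snd (fst q)) (snd (fst q))) / 2)"
  have "smooth F"
    unfolding F_def divide_inverse
    by (intro smooth_intros smooth_\<Omega> smooth_compose[OF H] smooth_frechet[OF H])
  from smooth_integral[OF this] show ?thesis
    unfolding integral_from_0_def \<alpha>_defect_eq D F_def by (simp only: fst_conv snd_conv)
qed

section \<open>Contact diffeomorphisms of V x R and the lifts of symplectic maps\<close>

abbreviation contact_diffeos :: "('k::finite phase \<times> real \<Rightarrow> 'k phase \<times> real) set" where
  "contact_diffeos \<equiv> {\<phi>. diffeo \<phi> \<and> pullback \<phi> contact_form = contact_form}"

lemma contact_form_eq: "contact_form x w = \<Omega> (fst x) (fst w) / 2 - snd w"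
  by (simp add: contact_form_def split_beta \<alpha>_eq)

lemma contact_diffeos_iff:
  "\<phi> \<in> contact_diffeos \<longleftrightarrow> diffeo \<phi> \<and>
     (\<forall>x v. contact_form (\<phi> x) (frechet_derivative \<phi> (at x) v) = contact_form x v)"
  unfolding mem_Collect_eq fun_eq_iff pullback_def ..

lemma contact_diffeosD:
  assumes "\<phi> \<in> contact_diffeos"
  shows "diffeo \<phi>" "bij \<phi>" "smooth \<phi>"
    and "contact_form (\<phi> x) (frechet_derivative \<phi> (at x) v) = contact_form x v"
  using assms unfolding contact_diffeos_iff by (auto simp only: diffeo_def)

lemma contact_diffeos_id: "id \<in> contact_diffeos"
  by (simp add: diffeo_id pullback_def frechet_derivative_id_apply fun_eq_iff)

lemma contact_diffeos_comp: "f \<in> contact_diffeos \<Longrightarrow> g \<in> contact_diffeos \<Longrightarrow> f \<circ> g \<in> contact_diffeos"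
  unfolding contact_diffeos_iff
  by (simp add: diffeo_comp frechet_derivative_comp diffeo_smooth del: split_paired_All)

lemma contact_diffeos_inv:
  fixes f :: "'k::finite phase \<times> real \<Rightarrow> 'k phase \<times> real"
  assumes "f \<in> contact_diffeos" shows "inv_into UNIV f \<in> contact_diffeos"
  unfolding contact_diffeos_iff
proof (intro conjI allI)
  show "diffeo (inv_into UNIV f)" by (rule diffeo_inv[OF contact_diffeosD(1)[OF assms]])
  fix y v
  show "contact_form (inv_into UNIV f y) (frechet_derivative (inv_into UNIV f) (at y) v) = contact_form y v"
    using contact_diffeosD(4)[OF assms, of "inv_into UNIV f y" "frechet_derivative (inv_into UNIV f) (at y) v"]
      contact_diffeosD(1,2)[OF assms]
    by (simp add: frechet_derivative_inv bij_is_surj surj_f_inv_f)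
qed

lemma group_aut_group: "group (aut_group :: ('k::finite phase \<times> real \<Rightarrow> 'k phase \<times> real) monoid)"
  unfolding aut_group_def
proof (rule group_of_bijections)
  fix f g :: "'k phase \<times> real \<Rightarrow> 'k phase \<times> real"
  assume f: "f \<in> identity_component contact_diffeos"
  show "bij f" using f identity_component_subset contact_diffeosD(2) by blast
  show "inv_into UNIV f \<in> identity_component contact_diffeos"
    by (rule identity_component_inv[OF contact_diffeos_inv f])
  assume g: "g \<in> identity_component contact_diffeos"
  show "f \<circ> g \<in> identity_component contact_diffeos"
    by (rule identity_component_comp[OF contact_diffeos_comp f g])
qed (rule identity_component_id[OF contact_diffeos_id])

lemma quant_to_aut_apply:
  "quant_to_aut (\<eta>, a) p = (\<eta> (fst p), snd p + a + integral_from_0 (\<alpha>_defect \<eta>) (fst p))"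
  by (simp add: quant_to_aut_def split_beta)

lemma smooth_potential:
  assumes "\<eta> \<in> symplectic_diffeos"
  shows "smooth (integral_from_0 (\<alpha>_defect \<eta>))"
proof (rule smoothI[OF potential_has_derivative[OF assms]])
  show "smooth (\<lambda>x. \<alpha>_defect \<eta> x v)" for v
    by (intro smooth_compose[OF smooth_\<alpha>_defect, of \<eta> "\<lambda>x. (x, v)", simplified] smooth_intros
        symplectic_diffeosD assms)
qed

text \<open>The differential of the fibre component is ds plus the defect of \<alpha>. The defect is
  exactly what the pullback by \<eta> adds to \<alpha>, so the two cancel in \<alpha> - ds.\<close>

lemma quant_to_aut_contact:
  assumes "\<eta> \<in> symplectic_diffeos"
  shows "quant_to_aut (\<eta>, a) \<in> contact_diffeos"
proof -
  note \<eta> = symplectic_diffeosD[OF assms]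
  let ?S = "integral_from_0 (\<alpha>_defect \<eta>)"
  let ?\<mu> = "inv_into UNIV \<eta>"
  have \<mu>: "smooth ?\<mu>" using \<eta>(1) by (simp add: diffeo_def)
  have eq: "quant_to_aut (\<eta>, a) = (\<lambda>p. (\<eta> (fst p), snd p + a + ?S (fst p)))"
    by (simp add: fun_eq_iff quant_to_aut_apply)
  have "diffeo (quant_to_aut (\<eta>, a))"
  proof (rule diffeoI[of _ "\<lambda>p. (?\<mu> (fst p), snd p - a - ?S (?\<mu> (fst p)))"])
    show "smooth (quant_to_aut (\<eta>, a))"
      unfolding eq by (intro smooth_intros smooth_compose[OF \<eta>(2)] smooth_compose[OF smooth_potential[OF assms]])
    show "smooth (\<lambda>p. (?\<mu> (fst p), snd p - a - ?S (?\<mu> (fst p))))"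
      by (intro smooth_intros smooth_compose[OF \<mu>] smooth_compose[OF smooth_potential[OF assms]])
  qed (use \<eta>(3) in \<open>simp_all add: quant_to_aut_apply bij_is_inj bij_is_surj surj_f_inv_f\<close>)
  moreover have "contact_form (quant_to_aut (\<eta>, a) x) (frechet_derivative (quant_to_aut (\<eta>, a)) (at x) w) =
      contact_form x w" for x w
  proof -
    have "(quant_to_aut (\<eta>, a) has_derivative (\<lambda>w. (frechet_derivative \<eta> (at (fst x)) (fst w),
        snd w + 0 + \<alpha>_defect \<eta> (fst x) (fst w)))) (at x)"
      unfolding eq
      by (intro has_derivative_Pair has_derivative_add has_derivative_const has_derivative_snd has_derivative_ident
          has_derivative_compose[OF has_derivative_fst[OF has_derivative_ident] smooth_has_derivative[OF \<eta>(2)]]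
          has_derivative_compose[OF has_derivative_fst[OF has_derivative_ident] potential_has_derivative[OF assms]])
    then show ?thesis
      by (simp add: has_derivative_unique_at contact_form_eq quant_to_aut_apply \<alpha>_defect_eq diff_divide_distrib)
  qed
  ultimately show ?thesis unfolding contact_diffeos_iff by blast
qed

lemma quant_to_aut_id: "quant_to_aut (id, 0) = id"
  by (simp add: fun_eq_iff quant_to_aut_apply integral_from_0_def \<alpha>_defect_eq frechet_derivative_id_apply)

lemma quant_to_aut_in_aut:
  assumes "\<eta> \<in> Diff\<Omega>"
  shows "quant_to_aut (\<eta>, a) \<in> identity_component contact_diffeos"
proof -
  from assms obtain H :: "real \<Rightarrow> 'a phase \<Rightarrow> 'a phase" where
    H: "smooth (\<lambda>p. H (fst p) (snd p))" "smooth (\<lambda>p. inv_into UNIV (H (fst p)) (snd p))"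
    "\<And>t. bij (H t)" "\<And>t. H t \<in> symplectic_diffeos" "H 0 = id" "H 1 = \<eta>"
    unfolding Diff\<Omega>_def by (rule identity_componentE) blast
  let ?S = "\<lambda>t. integral_from_0 (\<alpha>_defect (H t))"
  let ?\<mu> = "\<lambda>t. inv_into UNIV (H t)"
  have S: "smooth (\<lambda>p. ?S (fst p) (snd p))" by (rule smooth_potential_isotopy[OF H(1)])
  \<comment> \<open>The central shift is switched on as t * a along with the isotopy of \<eta>, so
    that the path starts at the identity; the potentials of the levels vary smoothly with t.\<close>
  show ?thesis
  proof (rule identity_componentI[of "\<lambda>t. quant_to_aut (H t, t * a)"
        "\<lambda>t p. (?\<mu> t (fst p), snd p - t * a - ?S t (?\<mu> t (fst p)))"])
    have "smooth (\<lambda>p. (H (fst p) (fst (snd p)), snd (snd p) + fst p * a + ?S (fst p) (fst (snd p))))"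
      by (intro smooth_intros smooth_compose[OF H(1), of "\<lambda>p. (fst p, fst (snd p))", simplified]
          smooth_compose[OF S, of "\<lambda>p. (fst p, fst (snd p))", simplified])
    then show "smooth (\<lambda>p. quant_to_aut (H (fst p), fst p * a) (snd p))"
      by (simp add: quant_to_aut_apply)
    have \<mu>: "smooth (\<lambda>p. ?\<mu> (fst p) (fst (snd p)))"
      by (intro smooth_compose[OF H(2), of "\<lambda>p. (fst p, fst (snd p))", simplified] smooth_intros)
    show "smooth (\<lambda>p. (?\<mu> (fst p) (fst (snd p)), snd (snd p) - fst p * a - ?S (fst p) (?\<mu> (fst p) (fst (snd p)))))"
      by (intro smooth_intros \<mu> smooth_compose[OF S, of "\<lambda>p. (fst p, ?\<mu> (fst p) (fst (snd p)))", simplified])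
    show "quant_to_aut (H t, t * a) \<in> contact_diffeos" for t
      by (rule quant_to_aut_contact[OF H(4)])
  qed (use H in \<open>simp_all add: quant_to_aut_apply quant_to_aut_id bij_is_inj bij_is_surj surj_f_inv_f\<close>)
qed

text \<open>Differentiating the invariance of the contact form and antisymmetrising eliminates the second
  derivatives.\<close>

lemma contact_diffeo_fst_symplectic:
  assumes "\<phi> \<in> contact_diffeos"
  shows "\<Omega> (fst (frechet_derivative \<phi> (at x) u)) (fst (frechet_derivative \<phi> (at x) w)) = \<Omega> (fst u) (fst w)"
proof -
  note \<phi> = contact_diffeosD[OF assms]
  let ?D = "\<lambda>w y. frechet_derivative \<phi> (at y) w"
  let ?DD = "\<lambda>u w. frechet_derivative (?D w) (at x) u"
  \<comment> \<open>Twice the invariance identity is differentiated, which clears the 1/2 in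
    \<alpha>; the second derivatives of \<phi> appear next to the wanted term.\<close>
  have *: "\<Omega> (fst (\<phi> x)) (fst (?DD u w)) + \<Omega> (fst (?D u x)) (fst (?D w x)) - 2 * snd (?DD u w) = \<Omega> (fst u) (fst w)"
    for u w
  proof -
    have "((\<lambda>y. \<Omega> (fst (\<phi> y)) (fst (?D w y)) - 2 * snd (?D w y)) has_derivative
      (\<lambda>u. \<Omega> (fst (\<phi> x)) (fst (?DD u w)) + \<Omega> (fst (?D u x)) (fst (?D w x)) - 2 * snd (?DD u w))) (at x)"
      by (intro has_derivative_diff \<Omega>.FDERIV has_derivative_fst has_derivative_snd has_derivative_mult_right
          smooth_has_derivative smooth_deriv \<phi>)
    moreover have "\<Omega> (fst (\<phi> y)) (fst (?D w y)) - 2 * snd (?D w y) = \<Omega> (fst y) (fst w) - 2 * snd w" for y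
      using \<phi>(4)[of y w] by (simp add: contact_form_eq)
    ultimately have "((\<lambda>y. \<Omega> (fst y) (fst w) - 2 * snd w) has_derivative
      (\<lambda>u. \<Omega> (fst (\<phi> x)) (fst (?DD u w)) + \<Omega> (fst (?D u x)) (fst (?D w x)) - 2 * snd (?DD u w))) (at x)"
      by simp
    moreover have "((\<lambda>y. \<Omega> (fst y) (fst w) - 2 * snd w) has_derivative (\<lambda>u. \<Omega> (fst u) (fst w) - 0)) (at x)"
      by (intro has_derivative_diff has_derivative_const bounded_linear_imp_has_derivative
          bounded_linear_compose[OF \<Omega>.bounded_linear_left bounded_linear_fst])
    ultimately have "(\<lambda>u. \<Omega> (fst (\<phi> x)) (fst (?DD u w)) + \<Omega> (fst (?D u x)) (fst (?D w x)) - 2 * snd (?DD u w))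
      = (\<lambda>u. \<Omega> (fst u) (fst w) - 0)"
      by (rule has_derivative_unique)
    from fun_cong[OF this, of u] show ?thesis by simp
  qed
  show ?thesis
    using *[of u w] *[of w u] smooth_symmetric[OF \<phi>(3), of w x u]
      \<Omega>_skew[of "fst (?D u x)" "fst (?D w x)"] \<Omega>_skew[of "fst u" "fst w"] by simp
qed

text \<open>\<open>(0, 1)\<close> is the Reeb field of the contact form.\<close>

lemma contact_diffeo_Reeb:
  assumes "\<phi> \<in> contact_diffeos"
  shows "frechet_derivative \<phi> (at x) (0, 1) = (0, 1)"
proof -
  note \<phi> = contact_diffeosD[OF assms]
  let ?D = "frechet_derivative \<phi> (at x)"
  \<comment> \<open>T is the derivative on vectors without fibre component, followed by the
    projection to V. Preserving \<Omega> makes it injective, hence onto. The V-component of the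
    image of (0, 1) is \<Omega>-orthogonal to its range and therefore zero, and the contact form
    then fixes the fibre component.\<close>
  define T where "T v = fst (?D (v, 0))" for v
  have "linear (\<lambda>v. (v, 0))" by (rule linearI) auto
  from linear_compose[OF linear_compose[OF this smooth_frechet_linear[OF \<phi>(3)]] linear_fst]
  have T: "linear T" by (simp add: T_def[abs_def] o_def)
  have sym: "\<Omega> (T v) (T w) = \<Omega> v w" for v w
    by (simp add: T_def contact_diffeo_fst_symplectic[OF assms])
  have "T v = 0 \<Longrightarrow> v = 0" for v
    using sym[of v] by (intro \<Omega>_nondegenerate) simp
  then have "surj T"
    using T by (intro linear_injective_imp_surjective) (auto simp: linear_injective_0)
  moreover have "\<Omega> (fst (?D (0, 1))) (T v) = 0" for v
    by (simp add: T_def contact_diffeo_fst_symplectic[OF assms])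
  ultimately have "fst (?D (0, 1)) = 0"
    by (intro \<Omega>_nondegenerate) (metis surjD)
  moreover from this have "snd (?D (0, 1)) = 1"
    using \<phi>(4)[of x "(0, 1)"] by (simp add: contact_form_eq)
  ultimately show ?thesis by (simp add: prod_eq_iff)
qed

text \<open>Invariance of the Reeb field, integrated along a fibre:
  \<open>\<phi> (z, s) - (0, s)\<close> has zero derivative in s. So \<phi> descends to the quotient
  by the fibres.\<close>

lemma contact_diffeo_translation:
  assumes "\<phi> \<in> contact_diffeos"
  shows "\<phi> (z, s) = \<phi> (z, 0) + (0, s)"
proof -
  have "((\<lambda>s. \<phi> (z, s) - (0, s)) has_derivative (\<lambda>h. 0)) (at s)" for s
  proof -
    have "((\<lambda>s. \<phi> (z, s)) has_derivative (\<lambda>h. frechet_derivative \<phi> (at (z, s)) (0, h))) (at s)"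
      by (rule has_derivative_compose[of "\<lambda>s. (z, s)", OF _ smooth_has_derivative[OF contact_diffeosD(3)[OF assms]]])
         (auto intro!: derivative_eq_intros)
    moreover have "frechet_derivative \<phi> (at (z, s)) (0, h) = (0, h)" for h
      using linear_scale[OF smooth_frechet_linear[OF contact_diffeosD(3)[OF assms]], of "(z, s)" h "(0, 1)"]
      by (simp add: contact_diffeo_Reeb[OF assms])
    ultimately show ?thesis by (auto intro!: derivative_eq_intros)
  qed
  then have "\<phi> (z, s) - (0, s) = \<phi> (z, 0) - (0, 0)"
    by (intro has_derivative_zero_unique[of UNIV]) auto
  then show ?thesis by (simp add: algebra_simps zero_prod_def[symmetric])
qed

text \<open>The map induced on V, viewed as the space of Reeb orbits. For a contact diffeomorphism
  the representative with s = 0 is as good as any other by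
  \<open>contact_diffeo_translation\<close>.\<close>

definition base_map :: "('k::finite phase \<times> real \<Rightarrow> 'k phase \<times> real) \<Rightarrow> 'k phase \<Rightarrow> 'k phase" where
  "base_map \<phi> z = fst (\<phi> (z, 0))"

lemma base_map_comp:
  assumes "\<phi> \<in> contact_diffeos"
  shows "base_map \<phi> (base_map \<psi> z) = base_map (\<phi> \<circ> \<psi>) z"
  using arg_cong[OF contact_diffeo_translation[OF assms, of "fst (\<psi> (z, 0))" "snd (\<psi> (z, 0))"], of fst]
  by (simp add: base_map_def)

lemma base_map_inverse:
  assumes "\<phi> \<in> contact_diffeos"
  shows "base_map (inv_into UNIV \<phi>) (base_map \<phi> z) = z" "base_map \<phi> (base_map (inv_into UNIV \<phi>) z) = z"
  unfolding base_map_comp[OF assms] base_map_comp[OF contact_diffeos_inv[OF assms]]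
  using contact_diffeosD(2)[OF assms]
  by (simp_all add: base_map_def bij_is_inj bij_is_surj surj_f_inv_f)

lemma base_map_has_derivative:
  assumes "\<phi> \<in> contact_diffeos"
  shows "(base_map \<phi> has_derivative (\<lambda>v. fst (frechet_derivative \<phi> (at (z, 0)) (v, 0)))) (at z)"
  unfolding base_map_def[abs_def]
  by (intro has_derivative_fst
      has_derivative_compose[of "\<lambda>z. (z, 0)", OF _ smooth_has_derivative[OF contact_diffeosD(3)[OF assms]]])
    (auto intro!: derivative_eq_intros)

lemma smooth_base_map:
  assumes "\<phi> \<in> contact_diffeos"
  shows "smooth (base_map \<phi>)"
  unfolding base_map_def[abs_def]
  by (intro smooth_intros smooth_compose[OF contact_diffeosD(3)[OF assms]])

lemma base_map_symplectic:
  assumes "\<phi> \<in> contact_diffeos"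
  shows "base_map \<phi> \<in> symplectic_diffeos"
proof -
  have "diffeo (base_map \<phi>)"
    by (rule diffeoI[of _ "base_map (inv_into UNIV \<phi>)"])
       (use assms in \<open>simp_all only: smooth_base_map contact_diffeos_inv base_map_inverse\<close>)
  then show ?thesis
    by (simp add: symplectic_diffeos_def has_derivative_unique_at[OF base_map_has_derivative[OF assms]]
        contact_diffeo_fst_symplectic[OF assms])
qed

text \<open>On the slice s = 0, invariance of the contact form says that the fibre component of
  \<phi> is a primitive of the defect of \<open>base_map \<phi>\<close>. It is the potential up to
  its value at 0, and the other slices follow by fibre translation.\<close>

lemma contact_diffeo_eq_quant_to_aut:
  assumes "\<phi> \<in> contact_diffeos"
  shows "\<phi> = quant_to_aut (base_map \<phi>, snd (\<phi> (0, 0)))"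
proof
  fix p
  note \<phi> = contact_diffeosD[OF assms]
  have "((\<lambda>z. snd (\<phi> (z, 0))) has_derivative \<alpha>_defect (base_map \<phi>) z) (at z)" for z
  proof -
    have "((\<lambda>z. snd (\<phi> (z, 0))) has_derivative (\<lambda>v. snd (frechet_derivative \<phi> (at (z, 0)) (v, 0)))) (at z)"
      by (intro has_derivative_snd
          has_derivative_compose[of "\<lambda>z. (z, 0)", OF _ smooth_has_derivative[OF \<phi>(3)]])
        (auto intro!: derivative_eq_intros)
    moreover have "snd (frechet_derivative \<phi> (at (z, 0)) (v, 0)) = \<alpha>_defect (base_map \<phi>) z v" for v
      using \<phi>(4)[of "(z, 0)" "(v, 0)"]
      by (simp add: contact_form_eq \<alpha>_defect_eq has_derivative_unique_at[OF base_map_has_derivative[OF assms]]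
          base_map_def diff_divide_distrib)
    ultimately show ?thesis by simp
  qed
  from potential_unique[OF base_map_symplectic[OF assms] this, of "fst p"]
  show "\<phi> p = quant_to_aut (base_map \<phi>, snd (\<phi> (0, 0))) p"
    using contact_diffeo_translation[OF assms, of "fst p" "snd p"]
    by (simp add: quant_to_aut_apply prod_eq_iff base_map_def)
qed

lemma base_map_Diff\<Omega>:
  fixes \<phi> :: "'k::finite phase \<times> real \<Rightarrow> 'k phase \<times> real"
  assumes "\<phi> \<in> identity_component contact_diffeos"
  shows "base_map \<phi> \<in> Diff\<Omega>"
proof -
  from assms obtain H :: "real \<Rightarrow> 'k phase \<times> real \<Rightarrow> 'k phase \<times> real" where
    H: "smooth (\<lambda>p. H (fst p) (snd p))" "smooth (\<lambda>p. inv_into UNIV (H (fst p)) (snd p))"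
    "\<And>t. bij (H t)" "\<And>t. H t \<in> contact_diffeos" "H 0 = id" "H 1 = \<phi>"
    by (rule identity_componentE) blast
  show ?thesis
    unfolding Diff\<Omega>_def
  proof (rule identity_componentI[of "\<lambda>t. base_map (H t)" "\<lambda>t. base_map (inv_into UNIV (H t))"])
    show "smooth (\<lambda>p. base_map (H (fst p)) (snd p))"
      unfolding base_map_def
      by (intro smooth_intros smooth_compose[OF H(1), of "\<lambda>p. (fst p, snd p, 0)", simplified])
    show "smooth (\<lambda>p. base_map (inv_into UNIV (H (fst p))) (snd p))"
      unfolding base_map_def
      by (intro smooth_intros smooth_compose[OF H(2), of "\<lambda>p. (fst p, snd p, 0)", simplified])
    show "base_map (H 0) = id" by (simp add: fun_eq_iff base_map_def H(5))
  qed (use H(4,6) in \<open>simp_all only: base_map_inverse base_map_symplectic\<close>)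
qed

section \<open>The isomorphism of the central extension with the contact group\<close>

lemma quant_to_aut_mult:
  assumes "\<eta>\<^sub>1 \<in> Diff\<Omega>" "\<eta>\<^sub>2 \<in> Diff\<Omega>"
  shows "quant_to_aut (\<eta>\<^sub>1 \<circ> \<eta>\<^sub>2, a\<^sub>1 + a\<^sub>2 + cocycle_B \<eta>\<^sub>1 \<eta>\<^sub>2) = quant_to_aut (\<eta>\<^sub>1, a\<^sub>1) \<circ> quant_to_aut (\<eta>\<^sub>2, a\<^sub>2)"
  using assms by (simp add: fun_eq_iff quant_to_aut_apply potential_comp Diff\<Omega>_symplectic)

lemma quant_to_aut_bij_betw:
  "bij_betw (quant_to_aut :: ('k::finite phase \<Rightarrow> 'k phase) \<times> real \<Rightarrow> _)
     (Diff\<Omega> \<times> UNIV) (identity_component contact_diffeos)"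
proof (rule bij_betw_byWitness[where f' = "\<lambda>\<phi>. (base_map \<phi>, snd (\<phi> (0, 0)))"])
  let ?D = "Diff\<Omega> :: ('k phase \<Rightarrow> 'k phase) set" and ?A = "identity_component contact_diffeos :: ('k phase \<times> real \<Rightarrow> 'k phase \<times> real) set"
  show "\<forall>x\<in>?D \<times> UNIV. (base_map (quant_to_aut x), snd (quant_to_aut x (0, 0))) = x"
  proof
    fix x :: "('k phase \<Rightarrow> 'k phase) \<times> real"
    assume "x \<in> Diff\<Omega> \<times> UNIV"
    then obtain \<eta> a where x: "x = (\<eta>, a)" "\<eta> \<in> symplectic_diffeos" using Diff\<Omega>_symplectic by blast
    have "base_map (quant_to_aut x) = \<eta>" by (rule ext) (simp add: x base_map_def quant_to_aut_apply)
    moreover have "snd (quant_to_aut x (0, 0)) = a" by (simp add: x quant_to_aut_apply potential_0)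
    ultimately show "(base_map (quant_to_aut x), snd (quant_to_aut x (0, 0))) = x" by (simp add: x)
  qed
  show "\<forall>\<phi>\<in>?A. quant_to_aut (base_map \<phi>, snd (\<phi> (0, 0))) = \<phi>"
    by (rule ballI, rule contact_diffeo_eq_quant_to_aut[symmetric], erule subsetD[OF identity_component_subset])
  show "quant_to_aut ` (?D \<times> UNIV) \<subseteq> ?A"
    using quant_to_aut_in_aut by blast
  show "(\<lambda>\<phi>. (base_map \<phi>, snd (\<phi> (0, 0)))) ` ?A \<subseteq> ?D \<times> UNIV"
    using base_map_Diff\<Omega> by blast
qed

text \<open>With the group laws of the extension read off from the composition of contact
  diffeomorphisms, neither the cocycle identity for B nor a formula for inverses has to be worked
  out.\<close>

lemma group_transfer:
  assumes "group H" and "bij_betw h (carrier G) (carrier H)"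
    and mult: "\<And>x y. x \<in> carrier G \<Longrightarrow> y \<in> carrier G \<Longrightarrow> h (x \<otimes>\<^bsub>G\<^esub> y) = h x \<otimes>\<^bsub>H\<^esub> h y"
    and closed: "\<And>x y. x \<in> carrier G \<Longrightarrow> y \<in> carrier G \<Longrightarrow> x \<otimes>\<^bsub>G\<^esub> y \<in> carrier G"
    and one: "\<one>\<^bsub>G\<^esub> \<in> carrier G" "h \<one>\<^bsub>G\<^esub> = \<one>\<^bsub>H\<^esub>"
  shows "group G"
proof -
  interpret H: group H by fact
  have inj: "h x = h y \<Longrightarrow> x = y" if "x \<in> carrier G" "y \<in> carrier G" for x y
    using assms(2) that by (auto simp: bij_betw_def inj_on_def)
  have h: "h x \<in> carrier H" if "x \<in> carrier G" for x
    using assms(2) that by (auto simp: bij_betw_def)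
  show ?thesis
  proof (rule groupI)
    fix x y z assume "x \<in> carrier G" "y \<in> carrier G" "z \<in> carrier G"
    then show "x \<otimes>\<^bsub>G\<^esub> y \<otimes>\<^bsub>G\<^esub> z = x \<otimes>\<^bsub>G\<^esub> (y \<otimes>\<^bsub>G\<^esub> z)"
      by (intro inj) (simp_all add: mult closed h H.m_assoc)
  next
    fix x assume x: "x \<in> carrier G"
    then show "\<one>\<^bsub>G\<^esub> \<otimes>\<^bsub>G\<^esub> x = x" by (intro inj) (simp_all add: mult closed one h)
    have "inv\<^bsub>H\<^esub> (h x) \<in> h ` carrier G"
      using assms(2) h[OF x] by (simp add: bij_betw_def)
    then obtain y where y: "y \<in> carrier G" "h y = inv\<^bsub>H\<^esub> (h x)" by auto
    have "y \<otimes>\<^bsub>G\<^esub> x = \<one>\<^bsub>G\<^esub>" using x y by (intro inj) (simp_all add: mult closed one h)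
    with y(1) show "\<exists>y\<in>carrier G. y \<otimes>\<^bsub>G\<^esub> x = \<one>\<^bsub>G\<^esub>" by auto
  qed (use closed one in auto)
qed

lemma group_quant_group: "group (quant_group :: (('k::finite phase \<Rightarrow> 'k phase) \<times> real) monoid)"
  by (rule group_transfer[OF group_aut_group, of quant_to_aut])
     (auto simp: quant_group_def aut_group_def quant_to_aut_bij_betw quant_to_aut_mult Diff\<Omega>_comp Diff\<Omega>_id
        quant_to_aut_id)

lemma quant_to_aut_iso:
  "(quant_to_aut :: ('k::finite phase \<Rightarrow> 'k phase) \<times> real \<Rightarrow> 'k phase \<times> real \<Rightarrow> 'k phase \<times> real)
     \<in> iso quant_group aut_group"
  using quant_to_aut_bij_betw[where 'k = 'k]
  by (auto simp: iso_def hom_def quant_group_def aut_group_def quant_to_aut_mult bij_betw_apply)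

section \<open>Linear symplectic maps\<close>

definition preserves_\<Omega> :: "('k::finite phase \<Rightarrow> 'k phase) \<Rightarrow> bool" where
  "preserves_\<Omega> L \<longleftrightarrow> linear L \<and> (\<forall>u v. \<Omega> (L u) (L v) = \<Omega> u v)"

lemma preserves_\<Omega>_symplectic:
  assumes "preserves_\<Omega> L" shows "L \<in> symplectic_diffeos"
proof -
  have L: "linear L" "\<And>u v. \<Omega> (L u) (L v) = \<Omega> u v" using assms by (auto simp: preserves_\<Omega>_def)
  have "u = 0" if "L u = 0" for u
    using L(2)[of u] that by (intro \<Omega>_nondegenerate) simp
  then have "inj L" using L(1) by (simp add: linear_injective_0)
  then obtain K where K: "linear K" "\<forall>x. K (L x) = x" "\<forall>x. L (K x) = x"
    using linear_injective_isomorphism[OF L(1)] by auto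
  have "diffeo L" by (rule diffeoI[of _ K]) (use K L in \<open>auto intro: smooth_linear\<close>)
  then show ?thesis
    using L by (simp add: symplectic_diffeos_def has_derivative_unique_at[OF linear_imp_has_derivative])
qed

definition transvection :: "'k::finite phase \<Rightarrow> real \<Rightarrow> 'k phase \<Rightarrow> 'k phase" where
  "transvection u c x = x + (c * \<Omega> u x) *\<^sub>R u"

lemma preserves_\<Omega>_transvection: "preserves_\<Omega> (transvection u c)"
  unfolding preserves_\<Omega>_def
proof (intro conjI allI)
  show "linear (transvection u c)"
    by (rule linearI) (simp_all add: transvection_def \<Omega>.add_right \<Omega>.scaleR_right algebra_simps scaleR_add_left)
  fix x y
  show "\<Omega> (transvection u c x) (transvection u c y) = \<Omega> x y"
    using \<Omega>_skew[of x u]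
    by (simp add: transvection_def \<Omega>.add_right \<Omega>.add_left \<Omega>.scaleR_right \<Omega>.scaleR_left)
qed

text \<open>The coefficient c is scaled by t. Coefficients add under composition because \<Omega> u
  u = 0, so the inverse isotopy is obtained by a change of sign.\<close>

lemma transvection_Diff\<Omega>: "transvection u c \<in> Diff\<Omega>"
  unfolding Diff\<Omega>_def
proof (rule identity_componentI[of "\<lambda>t. transvection u (t * c)" "\<lambda>t. transvection u (- t * c)"])
  show "smooth (\<lambda>p. transvection u (fst p * c) (snd p))" "smooth (\<lambda>p. transvection u (- fst p * c) (snd p))"
    unfolding transvection_def by (intro smooth_intros smooth_\<Omega>)+
  show "transvection u (t * c) \<in> symplectic_diffeos" for t
    by (rule preserves_\<Omega>_symplectic[OF preserves_\<Omega>_transvection])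
qed (auto simp: transvection_def fun_eq_iff \<Omega>.add_right \<Omega>.diff_right \<Omega>.scaleR_right)

text \<open>Stands for the group generated by the transvections along W, but records only what is
  used about it. Fixing the \<Omega>-complement of W pointwise is what protects the coordinate pairs
  already treated.\<close>

definition generated :: "'k::finite phase set \<Rightarrow> ('k phase \<Rightarrow> 'k phase) set" where
  "generated W = {D \<in> Diff\<Omega>. preserves_\<Omega> D \<and> (\<forall>x\<in>W. D x \<in> W) \<and> (\<forall>z. (\<forall>u\<in>W. \<Omega> u z = 0) \<longrightarrow> D z = z)}"

lemma generated_comp: "D \<in> generated W \<Longrightarrow> E \<in> generated W \<Longrightarrow> D \<circ> E \<in> generated W"
  by (auto simp: generated_def Diff\<Omega>_comp preserves_\<Omega>_def linear_compose)

lemma transvection_generated: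
  "subspace W \<Longrightarrow> u \<in> W \<Longrightarrow> transvection u c \<in> generated W"
  by (auto simp: generated_def transvection_Diff\<Omega> preserves_\<Omega>_transvection transvection_def
      intro: subspace_add subspace_scale)

lemma generated_moves:
  assumes "subspace W" "x \<in> W" "y \<in> W" "\<Omega> x y \<noteq> 0"
  obtains D where "D \<in> generated W" "D x = y" "\<And>z. \<Omega> (y - x) z = 0 \<Longrightarrow> D z = z"
proof
  \<comment> \<open>The coefficient c must satisfy c * \<Omega> (y - x) x = 1, and \<Omega> (y - x)
    x = \<Omega> y x is nonzero.\<close>
  let ?D = "transvection (y - x) (1 / \<Omega> (y - x) x)"
  show "?D \<in> generated W"
    by (intro transvection_generated subspace_diff assms)
  show "?D x = y"
    using assms(4) \<Omega>_skew[of y x] by (simp add: transvection_def \<Omega>.diff_left)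
  show "?D z = z" if "\<Omega> (y - x) z = 0" for z
    using that by (simp add: transvection_def)
qed

text \<open>If \<Omega> x y = 0, the transvection along y - x leaves x where it is, so the move
  passes through a vector w that pairs nontrivially with both; one of a, b, a + b is such a
  w.\<close>

lemma generated_transitive:
  assumes W: "subspace W" "x \<in> W" "y \<in> W" and ab: "a \<in> W" "b \<in> W" "\<Omega> x a \<noteq> 0" "\<Omega> y b \<noteq> 0"
  obtains D where "D \<in> generated W" "D x = y"
proof (cases "\<Omega> x y = 0")
  case True
  have "\<exists>w\<in>W. \<Omega> x w \<noteq> 0 \<and> \<Omega> y w \<noteq> 0"
  proof (cases "\<Omega> x b = 0")
    case b: True
    show ?thesis
    proof (cases "\<Omega> y a = 0")
      case True
      with b have "\<Omega> x (a + b) \<noteq> 0 \<and> \<Omega> y (a + b) \<noteq> 0" using ab by (simp add: \<Omega>.add_right)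
      then show ?thesis using subspace_add[OF W(1) ab(1,2)] by blast
    qed (use ab in blast)
  qed (use ab in blast)
  then obtain w where w: "w \<in> W" "\<Omega> x w \<noteq> 0" "\<Omega> w y \<noteq> 0" by (metis \<Omega>_skew neg_equal_0_iff_equal)
  obtain D where D: "D \<in> generated W" "D x = w" using generated_moves[OF W(1,2) w(1,2)] by metis
  obtain E where E: "E \<in> generated W" "E w = y" using generated_moves[OF W(1) w(1) W(3) w(3)] by metis
  show ?thesis by (rule that[OF generated_comp[OF E(1) D(1)]]) (simp add: D E)
next
  case False
  with that generated_moves[OF W] show ?thesis by metis
qed

text \<open>A transvection along f' - f fixes e, because f and f' have the same pairing with e. If
  \<Omega> f f' = 0 it cannot move f to f'; then the path goes through e + f, which pairs
  nontrivially with f and f' and has again the pairing 1 with e.\<close>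

lemma generated_transitive_pairs:
  assumes W: "subspace W" "e \<in> W" "f \<in> W" "f' \<in> W" and "\<Omega> e f = 1" "\<Omega> e f' = 1"
  obtains D where "D \<in> generated W" "D e = e" "D f = f'"
proof (cases "\<Omega> f f' = 0")
  case True
  have g: "e + f \<in> W" by (rule subspace_add[OF W(1-3)])
  have "\<Omega> f (e + f) \<noteq> 0" using \<Omega>_skew[of f e] assms by (simp add: \<Omega>.add_right)
  from generated_moves[OF W(1,3) g this] obtain D where
    D: "D \<in> generated W" "D f = e + f" "\<And>z. \<Omega> (e + f - f) z = 0 \<Longrightarrow> D z = z" by metis
  have "\<Omega> (e + f) f' \<noteq> 0" using True assms by (simp add: \<Omega>.add_left)
  from generated_moves[OF W(1) g W(4) this] obtain E where
    E: "E \<in> generated W" "E (e + f) = f'" "\<And>z. \<Omega> (f' - (e + f)) z = 0 \<Longrightarrow> E z = z" by metis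
  have "D e = e" by (rule D(3)) simp
  moreover have "E e = e"
    using assms \<Omega>_skew[of f e] \<Omega>_skew[of f' e] by (intro E(3)) (simp add: \<Omega>.diff_left \<Omega>.add_left)
  ultimately show ?thesis
    by (intro that[OF generated_comp[OF E(1) D(1)]]) (simp_all add: D E)
next
  case False
  from generated_moves[OF W(1,3,4) this] obtain D where
    D: "D \<in> generated W" "D f = f'" "\<And>z. \<Omega> (f' - f) z = 0 \<Longrightarrow> D z = z" by metis
  moreover have "D e = e"
    using assms \<Omega>_skew[of f e] \<Omega>_skew[of f' e] by (intro D(3)) (simp add: \<Omega>.diff_left)
  ultimately show ?thesis by (intro that)
qed

lemma \<Omega>_axis:
  "\<Omega> (axis (Inl i) 1) (axis (Inl j) 1) = 0" "\<Omega> (axis (Inr i) 1) (axis (Inr j) 1) = 0"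
  "\<Omega> (axis (Inl i) 1) (axis (Inr j) 1) = (if i = j then 1 else 0)"
  "\<Omega> (axis (Inr i) 1) (axis (Inl j) 1) = (if i = j then - 1 else 0)"
  by (simp_all add: \<Omega>_coordinates axis_def if_distrib[of "\<lambda>x. x * _"] cong: if_cong)

text \<open>The coordinate pairs are moved back one at a time, along transvections that fix the pairs
  already treated.\<close>

lemma preserves_\<Omega>_Diff\<Omega>:
  fixes L :: "'k::finite phase \<Rightarrow> 'k phase"
  assumes "preserves_\<Omega> L"
  shows "L \<in> Diff\<Omega>"
proof -
  define e f :: "'k \<Rightarrow> 'k phase" where "e i = axis (Inl i) 1" and "f i = axis (Inr i) 1" for i
  have "L \<in> Diff\<Omega>" if "finite S" "preserves_\<Omega> L" "\<And>j. j \<notin> S \<Longrightarrow> L (e j) = e j \<and> L (f j) = f j" for S L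
    using that
  proof (induction S arbitrary: L rule: finite_induct)
    case empty
    have "L b = id b" if "b \<in> Basis" for b
    proof -
      from that obtain i where "b = axis i 1" by (auto simp: Basis_vec_def)
      with empty(2) show ?thesis by (cases i) (auto simp: e_def f_def)
    qed
    then have "L = id" using empty(1) by (intro linear_eq_stdbasis) (auto simp: preserves_\<Omega>_def linear_id)
    then show ?case by (simp only: Diff\<Omega>_id)
  next
    case (insert i S)
    have L: "\<Omega> (L u) (L v) = \<Omega> u v" for u v using insert.prems(1) by (simp add: preserves_\<Omega>_def)
    \<comment> \<open>The \<Omega>-complement of the pairs outside \<open>insert i S\<close>, which
      L already fixes. Transvections along W leave those pairs alone and can still move pair
      i.\<close>
    define W where "W = {x. \<forall>j. j \<notin> insert i S \<longrightarrow> \<Omega> x (e j) = 0 \<and> \<Omega> x (f j) = 0}"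
    have W: "subspace W" by (auto simp: W_def subspace_def \<Omega>.add_left \<Omega>.scaleR_left)
    have ef: "e i \<in> W" "f i \<in> W" by (auto simp: W_def e_def f_def \<Omega>_axis)
    have "L x \<in> W" if "x \<in> W" for x
    proof -
      have "\<Omega> (L x) (e j) = 0 \<and> \<Omega> (L x) (f j) = 0" if "j \<notin> insert i S" for j
        using insert.prems(2)[OF that] L[of x "e j"] L[of x "f j"] \<open>x \<in> W\<close> that by (simp add: W_def)
      then show ?thesis by (simp add: W_def)
    qed
    with ef have Lef: "L (e i) \<in> W" "L (f i) \<in> W" by auto
    have 1: "\<Omega> (e i) (f i) = 1" by (simp add: e_def f_def \<Omega>_axis)
    obtain D where D: "D \<in> generated W" "D (L (e i)) = e i"
      by (rule generated_transitive[OF W Lef(1) ef(1) Lef(2) ef(2)]) (use 1 L in auto)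
    have "D (L (f i)) \<in> W" "\<Omega> (D (L (e i))) (D (L (f i))) = 1"
      using D(1) Lef(2) 1 L by (auto simp: generated_def preserves_\<Omega>_def)
    then obtain E where E: "E \<in> generated W" "E (e i) = e i" "E (D (L (f i))) = f i"
      using generated_transitive_pairs[OF W ef(1) _ ef(2) _ 1] D(2) by metis
    define F where "F = E \<circ> D"
    have F: "F \<in> generated W" "F (L (e i)) = e i" "F (L (f i)) = f i"
      using generated_comp[OF E(1) D(1)] D E by (auto simp: F_def)
    have "F \<circ> L \<in> Diff\<Omega>"
    proof (rule insert.IH)
      show "preserves_\<Omega> (F \<circ> L)"
        using F(1) insert.prems(1) by (auto simp: generated_def preserves_\<Omega>_def linear_compose)
      fix j assume "j \<notin> S"
      show "(F \<circ> L) (e j) = e j \<and> (F \<circ> L) (f j) = f j"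
      proof (cases "j = i")
        case False
        with \<open>j \<notin> S\<close> have "F (e j) = e j" "F (f j) = f j" "L (e j) = e j" "L (f j) = f j"
          using F(1) insert.prems(2) by (auto simp: generated_def W_def)
        then show ?thesis by simp
      qed (simp add: F)
    qed
    moreover have "F \<in> Diff\<Omega>" using F(1) by (simp add: generated_def)
    moreover have "inv_into UNIV F \<circ> (F \<circ> L) = L"
      using symplectic_diffeosD(3)[OF Diff\<Omega>_symplectic[OF \<open>F \<in> Diff\<Omega>\<close>]] by (simp add: o_assoc bij_is_inj)
    ultimately show ?case using Diff\<Omega>_comp[OF Diff\<Omega>_inv] by metis
  qed
  from this[of UNIV L] assms show ?thesis by simp
qed

lemma translation_Diff\<Omega>: "(\<lambda>z. z + v) \<in> Diff\<Omega>"
  unfolding Diff\<Omega>_def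
proof (rule identity_componentI[of "\<lambda>t z. z + t *\<^sub>R v" "\<lambda>t z. z - t *\<^sub>R v"])
  show "(\<lambda>z. z + t *\<^sub>R v) \<in> symplectic_diffeos" for t
  proof -
    have "frechet_derivative (\<lambda>z. z + t *\<^sub>R v) (at z) = (\<lambda>w. w)" for z
      by (rule has_derivative_unique_at) (auto intro!: derivative_eq_intros)
    moreover have "diffeo (\<lambda>z. z + t *\<^sub>R v)"
      by (rule diffeoI[of _ "\<lambda>z. z - t *\<^sub>R v"]) (auto intro!: smooth_add smooth_diff smooth_ident smooth_const)
    ultimately show ?thesis by (simp add: symplectic_diffeos_def)
  qed
qed (auto simp: fun_eq_iff intro!: smooth_intros)

section \<open>The Jacobi group\<close>

lemma bounded_bilinear_matrix_matrix_mult: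
  "bounded_bilinear ((**) :: real ^ 'n ^ 'm \<Rightarrow> real ^ 'p ^ 'n \<Rightarrow> real ^ 'p ^ 'm)"
  unfolding bilinear_conv_bounded_bilinear[symmetric] bilinear_def
  by (auto intro!: linearI simp: matrix_matrix_mult_def vec_eq_iff sum.distrib sum_distrib_left algebra_simps)

lemma bounded_bilinear_matrix_vector_mult:
  "bounded_bilinear ((*v) :: real ^ 'n ^ 'm \<Rightarrow> real ^ 'n \<Rightarrow> real ^ 'm)"
  unfolding bilinear_conv_bounded_bilinear[symmetric] bilinear_def
  by (auto intro!: linearI simp: matrix_vector_mult_def vec_eq_iff sum.distrib sum_distrib_left algebra_simps)

interpretation mm: bounded_bilinear "(**) :: real ^ 'n ^ 'm \<Rightarrow> real ^ 'p ^ 'n \<Rightarrow> real ^ 'p ^ 'm"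
  by (rule bounded_bilinear_matrix_matrix_mult)

interpretation mv: bounded_bilinear "(*v) :: real ^ 'n ^ 'm \<Rightarrow> real ^ 'n \<Rightarrow> real ^ 'm"
  by (rule bounded_bilinear_matrix_vector_mult)

lemma inner_matrix_vector_mult: "(A *v x) \<bullet> y = x \<bullet> (transpose A *v y)"
  for A :: "real ^ 'n ^ 'm"
  by (metis dot_lmul_matrix inner_commute transpose_matrix_vector)

lemma matrix_eq_inner: "A = B \<longleftrightarrow> (\<forall>x y. x \<bullet> (A *v y) = x \<bullet> (B *v y))" for A B :: "real ^ 'n ^ 'm"
  by (simp add: matrix_eq vector_eq_ldot) (metis vector_eq_ldot)

lemma symplectic_matrix_iff:
  "transpose g ** \<Omega>mat ** g = \<Omega>mat \<longleftrightarrow> (\<forall>u v. \<Omega> (g *v u) (g *v v) = \<Omega> u v)"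
  unfolding matrix_eq_inner \<Omega>_def inner_matrix_vector_mult by (simp add: matrix_vector_mul_assoc matrix_mul_assoc)

lemma jac_iff: "(\<xi>, v, a) \<in> jac \<longleftrightarrow> (\<forall>u w. \<Omega> (\<xi> *v u) w = - \<Omega> u (\<xi> *v w))"
  unfolding jac_def matrix_eq_inner \<Omega>_def inner_matrix_vector_mult
  by (simp add: matrix_vector_mul_assoc matrix_vector_mult_add_rdistrib inner_add_right eq_neg_iff_add_eq_0)

lemma \<Omega>mat_square: "\<Omega>mat ** \<Omega>mat = - mat 1"
  by (simp add: matrix_eq matrix_vector_mul_assoc[symmetric] mv.minus_left \<Omega>mat_vec_square)

text \<open>The solution of g^T \<Omega> g = \<Omega> for the inverse of g, by \<Omega>^{-1} =
  -\<Omega>. Being linear in g, the expression is differentiated at once, and on \<open>jac\<close>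
  it yields -\<xi>, the differential of inversion at the identity.\<close>

definition symplectic_inverse :: "'k::finite phase_mat \<Rightarrow> 'k phase_mat" where
  "symplectic_inverse g = - (\<Omega>mat ** transpose g ** \<Omega>mat)"

lemma symplectic_inverse_mult:
  assumes "transpose g ** \<Omega>mat ** g = \<Omega>mat"
  shows "symplectic_inverse g ** g = mat 1" "g ** symplectic_inverse g = mat 1"
proof -
  have "symplectic_inverse g ** g = - (\<Omega>mat ** (transpose g ** \<Omega>mat ** g))"
    by (simp add: symplectic_inverse_def matrix_eq matrix_vector_mul_assoc[symmetric] mv.minus_left)
  also have "\<dots> = mat 1" unfolding assms by (simp add: \<Omega>mat_square)
  finally show "symplectic_inverse g ** g = mat 1" .
  then show "g ** symplectic_inverse g = mat 1" using matrix_left_right_inverse by blast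
qed

lemma symplectic_inverse_vec:
  assumes "transpose g ** \<Omega>mat ** g = \<Omega>mat"
  shows "symplectic_inverse g *v (g *v u) = u" "g *v (symplectic_inverse g *v u) = u"
  using symplectic_inverse_mult[OF assms] by (simp_all add: matrix_vector_mul_assoc)

lemma jac_group_simps:
  "(g, v, a) \<in> carrier jac_group \<longleftrightarrow> transpose g ** \<Omega>mat ** g = \<Omega>mat"
  "(g\<^sub>1, v\<^sub>1, a\<^sub>1) \<otimes>\<^bsub>jac_group\<^esub> (g\<^sub>2, v\<^sub>2, a\<^sub>2) =
     (g\<^sub>1 ** g\<^sub>2, v\<^sub>1 + g\<^sub>1 *v v\<^sub>2, a\<^sub>1 + a\<^sub>2 + \<Omega> v\<^sub>1 (g\<^sub>1 *v v\<^sub>2) / 2)"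
  "\<one>\<^bsub>jac_group\<^esub> = (mat 1, 0, 0)"
  by (simp_all add: jac_group_def)

lemma symplectic_inverse_closed:
  assumes "transpose g ** \<Omega>mat ** g = \<Omega>mat"
  shows "transpose (symplectic_inverse g) ** \<Omega>mat ** symplectic_inverse g = \<Omega>mat"
  using assms[unfolded symplectic_matrix_iff, rule_format, of "symplectic_inverse g *v _" "symplectic_inverse g *v _"]
  by (simp add: symplectic_matrix_iff symplectic_inverse_vec[OF assms])

lemma group_jac_group: "group (jac_group :: 'k::finite triple monoid)"
proof (rule groupI)
  fix x y z :: "'k triple"
  assume "x \<in> carrier jac_group" "y \<in> carrier jac_group" "z \<in> carrier jac_group"
  then show "x \<otimes>\<^bsub>jac_group\<^esub> y \<otimes>\<^bsub>jac_group\<^esub> z = x \<otimes>\<^bsub>jac_group\<^esub> (y \<otimes>\<^bsub>jac_group\<^esub> z)"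
    by (cases x, cases y, cases z)
       (simp add: jac_group_simps symplectic_matrix_iff matrix_mul_assoc matrix_vector_mul_assoc[symmetric]
          matrix_vector_right_distrib \<Omega>.add_left \<Omega>.add_right add_divide_distrib)
next
  fix x y :: "'k triple"
  assume "x \<in> carrier jac_group" "y \<in> carrier jac_group"
  then show "x \<otimes>\<^bsub>jac_group\<^esub> y \<in> carrier jac_group"
    by (cases x, cases y) (simp add: jac_group_simps symplectic_matrix_iff matrix_vector_mul_assoc[symmetric])
next
  fix x :: "'k triple"
  assume x: "x \<in> carrier jac_group"
  obtain g v a where [simp]: "x = (g, v, a)" by (cases x)
  have g: "transpose g ** \<Omega>mat ** g = \<Omega>mat" using x by (simp add: jac_group_simps)
  let ?y = "(symplectic_inverse g, - (symplectic_inverse g *v v), - a)"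
  have "?y \<in> carrier jac_group" "?y \<otimes>\<^bsub>jac_group\<^esub> x = \<one>\<^bsub>jac_group\<^esub>"
    by (simp_all add: jac_group_simps symplectic_inverse_closed[OF g] symplectic_inverse_mult[OF g] \<Omega>.minus_left)
  then show "\<exists>y\<in>carrier jac_group. y \<otimes>\<^bsub>jac_group\<^esub> x = \<one>\<^bsub>jac_group\<^esub>" by blast
qed (auto simp: jac_group_simps symplectic_matrix_iff)

lemma jac_group_inv:
  assumes "transpose g ** \<Omega>mat ** g = \<Omega>mat"
  shows "inv\<^bsub>jac_group\<^esub> (g, v, a) = (symplectic_inverse g, - (symplectic_inverse g *v v), - a)"
  by (rule group.inv_equality[OF group_jac_group])
     (simp_all add: jac_group_simps assms symplectic_inverse_closed symplectic_inverse_mult \<Omega>.minus_left)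

lemma group_inclusion_eq: "group_inclusion (g, v, a) = ((\<lambda>z. g *v z + v), a)"
  by (simp add: group_inclusion_def o_def)

text \<open>A linear symplectic map preserves \<alpha>, so the defect comes from the translation
  alone. It is the constant form \<Omega> v (g w) / 2, whose integral from 0 to a point is its value
  on that point; the result is the cocycle of the Jacobi group.\<close>

lemma cocycle_B_affine: "cocycle_B (\<lambda>z. g *v z + v) \<eta> = \<Omega> v (g *v \<eta> 0) / 2"
  if "transpose g ** \<Omega>mat ** g = \<Omega>mat"
proof -
  have "frechet_derivative (\<lambda>z. g *v z + v) (at z) = (\<lambda>w. g *v w)" for z
    by (rule has_derivative_unique_at, rule has_derivative_eq_rhs[OF has_derivative_add[OF
          bounded_linear_imp_has_derivative[OF matrix_vector_mul_bounded_linear] has_derivative_const]]) simp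
  then have *: "\<alpha>_defect (\<lambda>z. g *v z + v) z w = \<Omega> v (g *v w) / 2" for z w
    using that by (simp add: \<alpha>_defect_eq symplectic_matrix_iff \<Omega>.add_left)
  show ?thesis by (simp add: cocycle_B_def integral_from_0_def *)
qed

lemma affine_Diff\<Omega>:
  assumes "transpose g ** \<Omega>mat ** g = \<Omega>mat"
  shows "(\<lambda>z. g *v z + v) \<in> Diff\<Omega>"
proof -
  have "(\<lambda>z. g *v z) \<in> Diff\<Omega>"
    using assms by (intro preserves_\<Omega>_Diff\<Omega>) (simp add: preserves_\<Omega>_def symplectic_matrix_iff)
  from Diff\<Omega>_comp[OF translation_Diff\<Omega> this] show ?thesis by (simp add: o_def)
qed

lemma group_inclusion_hom:
  "(group_inclusion :: 'k::finite triple \<Rightarrow> ('k phase \<Rightarrow> 'k phase) \<times> real) \<in> hom jac_group quant_group"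
proof (rule homI)
  fix x :: "'k triple" assume "x \<in> carrier jac_group"
  then show "group_inclusion x \<in> carrier quant_group"
    by (cases x) (simp add: quant_group_def group_inclusion_eq jac_group_simps affine_Diff\<Omega>)
next
  fix x y :: "'k triple" assume "x \<in> carrier jac_group" "y \<in> carrier jac_group"
  then show "group_inclusion (x \<otimes>\<^bsub>jac_group\<^esub> y) = group_inclusion x \<otimes>\<^bsub>quant_group\<^esub> group_inclusion y"
    by (cases x, cases y)
       (simp add: quant_group_def group_inclusion_eq jac_group_simps cocycle_B_affine fun_eq_iff
          matrix_vector_mul_assoc[symmetric] matrix_vector_right_distrib)
qed

lemma affine_inject:
  fixes g h :: "real ^ 'n ^ 'm"
  assumes "\<And>z. g *v z + v = h *v z + w"
  shows "g = h \<and> v = w"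
proof -
  have "v = w" using assms[of 0] by simp
  with assms show ?thesis by (simp add: matrix_eq)
qed

lemma inj_group_inclusion: "inj group_inclusion"
proof (rule injI)
  fix x y :: "'k::finite triple"
  assume eq: "group_inclusion x = group_inclusion y"
  obtain g v a h w b where xy: "x = (g, v, a)" "y = (h, w, b)" by (metis prod_cases3)
  have "(\<lambda>z. g *v z + v) = (\<lambda>z. h *v z + w)" "a = b"
    using eq unfolding xy group_inclusion_eq by blast+
  with affine_inject[OF fun_cong[OF this(1)]] show "x = y" by (simp add: xy)
qed

section \<open>Curves in the Jacobi group\<close>

lemma curve_at_one_jacE:
  assumes "curve_at_one jac_group c (\<xi>, w, b)"
  obtains \<gamma> \<nu> \<sigma> where "c = (\<lambda>t. (\<gamma> t, \<nu> t, \<sigma> t))" "smooth \<gamma>" "smooth \<nu>" "smooth \<sigma>"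
    "\<forall>t. transpose (\<gamma> t) ** \<Omega>mat ** \<gamma> t = \<Omega>mat" "\<gamma> 0 = mat 1" "\<nu> 0 = 0" "\<sigma> 0 = 0"
    "(\<gamma> has_vector_derivative \<xi>) (at 0)" "(\<nu> has_vector_derivative w) (at 0)"
    "(\<sigma> has_vector_derivative b) (at 0)"
proof
  let ?\<gamma> = "\<lambda>t. fst (c t)" and ?\<nu> = "\<lambda>t. fst (snd (c t))" and ?\<sigma> = "\<lambda>t. snd (snd (c t))"
  show "c = (\<lambda>t. (?\<gamma> t, ?\<nu> t, ?\<sigma> t))" by simp
  have c: "smooth c" "c 0 = (mat 1, 0, 0)" "(c has_vector_derivative (\<xi>, w, b)) (at 0)" "c t \<in> carrier jac_group" for t
    using assms by (auto simp: curve_at_one_def jac_group_simps)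
  show "smooth ?\<gamma>" "smooth ?\<nu>" "smooth ?\<sigma>" by (intro smooth_intros c)+
  show "\<forall>t. transpose (?\<gamma> t) ** \<Omega>mat ** ?\<gamma> t = \<Omega>mat"
    using c(4) by (metis jac_group_simps(1) prod.collapse)
  show "?\<gamma> 0 = mat 1" "?\<nu> 0 = 0" "?\<sigma> 0 = 0" by (simp_all add: c)
  show "(?\<gamma> has_vector_derivative \<xi>) (at 0)" "(?\<nu> has_vector_derivative w) (at 0)"
    "(?\<sigma> has_vector_derivative b) (at 0)"
    using bounded_linear.has_vector_derivative[OF bounded_linear_fst c(3)]
      bounded_linear.has_vector_derivative[OF bounded_linear_fst bounded_linear.has_vector_derivative[OF bounded_linear_snd c(3)]]
      bounded_linear.has_vector_derivative[OF bounded_linear_snd bounded_linear.has_vector_derivative[OF bounded_linear_snd c(3)]]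
    by simp_all
qed

lemma curve_at_one_jacI:
  assumes "smooth \<gamma>" "smooth \<nu>" "smooth \<sigma>" "\<forall>t. transpose (\<gamma> t) ** \<Omega>mat ** \<gamma> t = \<Omega>mat"
    and "\<gamma> 0 = mat 1" "\<nu> 0 = 0" "\<sigma> 0 = 0"
    and "(\<gamma> has_vector_derivative \<xi>) (at 0)" "(\<nu> has_vector_derivative w) (at 0)"
      "(\<sigma> has_vector_derivative b) (at 0)"
  shows "curve_at_one jac_group (\<lambda>t. (\<gamma> t, \<nu> t, \<sigma> t)) (\<xi>, w, b)"
  using assms by (auto simp: curve_at_one_def jac_group_simps intro!: smooth_Pair has_vector_derivative_Pair)

text \<open>The witness is the product of the two curves. Its central cocycle term is bilinear in
  two factors that vanish at 0, so it does not contribute at first order.\<close>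

lemma curve_add:
  assumes "curve_at_one jac_group c A" "curve_at_one jac_group d B"
  shows "\<exists>e. curve_at_one jac_group e (A + B)"
proof -
  obtain \<xi>\<^sub>1 w\<^sub>1 b\<^sub>1 \<xi>\<^sub>2 w\<^sub>2 b\<^sub>2 where AB: "A = (\<xi>\<^sub>1, w\<^sub>1, b\<^sub>1)" "B = (\<xi>\<^sub>2, w\<^sub>2, b\<^sub>2)"
    by (metis prod_cases3)
  from assms(1)[unfolded AB] obtain \<gamma>\<^sub>1 \<nu>\<^sub>1 \<sigma>\<^sub>1 where 1: "smooth \<gamma>\<^sub>1" "smooth \<nu>\<^sub>1" "smooth \<sigma>\<^sub>1"
    "\<forall>t. transpose (\<gamma>\<^sub>1 t) ** \<Omega>mat ** \<gamma>\<^sub>1 t = \<Omega>mat" "\<gamma>\<^sub>1 0 = mat 1" "\<nu>\<^sub>1 0 = 0" "\<sigma>\<^sub>1 0 = 0"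
    "(\<gamma>\<^sub>1 has_vector_derivative \<xi>\<^sub>1) (at 0)" "(\<nu>\<^sub>1 has_vector_derivative w\<^sub>1) (at 0)" "(\<sigma>\<^sub>1 has_vector_derivative b\<^sub>1) (at 0)"
    by (rule curve_at_one_jacE)
  from assms(2)[unfolded AB] obtain \<gamma>\<^sub>2 \<nu>\<^sub>2 \<sigma>\<^sub>2 where 2: "smooth \<gamma>\<^sub>2" "smooth \<nu>\<^sub>2" "smooth \<sigma>\<^sub>2"
    "\<forall>t. transpose (\<gamma>\<^sub>2 t) ** \<Omega>mat ** \<gamma>\<^sub>2 t = \<Omega>mat" "\<gamma>\<^sub>2 0 = mat 1" "\<nu>\<^sub>2 0 = 0" "\<sigma>\<^sub>2 0 = 0"
    "(\<gamma>\<^sub>2 has_vector_derivative \<xi>\<^sub>2) (at 0)" "(\<nu>\<^sub>2 has_vector_derivative w\<^sub>2) (at 0)" "(\<sigma>\<^sub>2 has_vector_derivative b\<^sub>2) (at 0)"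
    by (rule curve_at_one_jacE)
  have "((\<lambda>t. \<gamma>\<^sub>1 t ** \<gamma>\<^sub>2 t) has_vector_derivative \<xi>\<^sub>1 + \<xi>\<^sub>2) (at 0)"
    using mm.has_vector_derivative[OF 1(8) 2(8)] by (simp add: 1 2 add.commute)
  moreover have "((\<lambda>t. \<nu>\<^sub>1 t + \<gamma>\<^sub>1 t *v \<nu>\<^sub>2 t) has_vector_derivative w\<^sub>1 + w\<^sub>2) (at 0)"
    using has_vector_derivative_add[OF 1(9) mv.has_vector_derivative[OF 1(8) 2(9)]] by (simp add: 1 2)
  moreover have "((\<lambda>t. \<sigma>\<^sub>1 t + \<sigma>\<^sub>2 t + \<Omega> (\<nu>\<^sub>1 t) (\<gamma>\<^sub>1 t *v \<nu>\<^sub>2 t) * (1 / 2)) has_vector_derivative b\<^sub>1 + b\<^sub>2) (at 0)"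
    using has_vector_derivative_add[OF has_vector_derivative_add[OF 1(10) 2(10)]
        has_vector_derivative_mult_left[OF \<Omega>.has_vector_derivative[OF 1(9) mv.has_vector_derivative[OF 1(8) 2(9)]], of "1 / 2"]]
    by (simp add: 1 2)
  moreover have "\<forall>t. transpose (\<gamma>\<^sub>1 t ** \<gamma>\<^sub>2 t) ** \<Omega>mat ** (\<gamma>\<^sub>1 t ** \<gamma>\<^sub>2 t) = \<Omega>mat"
    using 1(4) 2(4) by (simp add: symplectic_matrix_iff matrix_vector_mul_assoc[symmetric])
  ultimately have "curve_at_one jac_group (\<lambda>t. (\<gamma>\<^sub>1 t ** \<gamma>\<^sub>2 t, \<nu>\<^sub>1 t + \<gamma>\<^sub>1 t *v \<nu>\<^sub>2 t,
      \<sigma>\<^sub>1 t + \<sigma>\<^sub>2 t + \<Omega> (\<nu>\<^sub>1 t) (\<gamma>\<^sub>1 t *v \<nu>\<^sub>2 t) * (1 / 2))) (\<xi>\<^sub>1 + \<xi>\<^sub>2, w\<^sub>1 + w\<^sub>2, b\<^sub>1 + b\<^sub>2)"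
    by (intro curve_at_one_jacI smooth_intros smooth_\<Omega> smooth_bilinear[OF bounded_bilinear_matrix_matrix_mult]
        smooth_bilinear[OF bounded_bilinear_matrix_vector_mult] 1 2) (simp_all add: 1 2)
  then show ?thesis by (auto simp: AB)
qed

lemma curve_zero: "\<exists>c. curve_at_one jac_group c 0"
  using curve_at_one_jacI[of "\<lambda>t. mat 1" "\<lambda>t. 0" "\<lambda>t. 0" 0 0 0]
  by (auto simp: smooth_const symplectic_matrix_iff zero_prod_def)

lemma curve_sum:
  "finite I \<Longrightarrow> (\<And>i. i \<in> I \<Longrightarrow> \<exists>c. curve_at_one jac_group c (A i)) \<Longrightarrow> \<exists>c. curve_at_one jac_group c (\<Sum>i\<in>I. A i)"
proof (induction I rule: finite_induct)
  case empty
  show ?case using curve_zero by simp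
next
  case (insert i I)
  obtain c d where "curve_at_one jac_group c (A i)" "curve_at_one jac_group d (\<Sum>i\<in>I. A i)"
    using insert by blast
  from curve_add[OF this] show ?case using insert.hyps by simp
qed

text \<open>The velocity at c = 0 of \<open>transvection u c\<close>, as a matrix.\<close>

definition rank_one :: "'k::finite phase \<Rightarrow> 'k phase_mat" where
  "rank_one u = matrix (\<lambda>x. \<Omega> u x *\<^sub>R u)"

lemma rank_one_mult: "rank_one u *v x = \<Omega> u x *\<^sub>R u"
proof -
  have "linear (\<lambda>x. \<Omega> u x *\<^sub>R u)"
    by (rule linearI) (simp_all add: \<Omega>.add_right \<Omega>.scaleR_right scaleR_add_left)
  then show ?thesis by (simp add: rank_one_def matrix_works)
qed

lemma curve_rank_one: "\<exists>d. curve_at_one jac_group d (c *\<^sub>R rank_one u, 0, 0)"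
proof -
  have 1: "((\<lambda>t. mat 1 + (t * c) *\<^sub>R rank_one u) has_vector_derivative c *\<^sub>R rank_one u) (at 0)"
    by (auto intro!: derivative_eq_intros simp: has_vector_derivative_def)
  have 2: "(mat 1 + (t * c) *\<^sub>R rank_one u) *v x = transvection u (t * c) x" for t x
    by (simp add: mv.add_left mv.scaleR_left rank_one_mult transvection_def)
  have "curve_at_one jac_group (\<lambda>t. (mat 1 + (t * c) *\<^sub>R rank_one u, 0, 0)) (c *\<^sub>R rank_one u, 0, 0)"
    by (intro curve_at_one_jacI smooth_intros 1 has_vector_derivative_const)
       (simp_all add: symplectic_matrix_iff 2 preserves_\<Omega>_transvection[unfolded preserves_\<Omega>_def])
  then show ?thesis by blast
qed

lemma curve_translation: "\<exists>d. curve_at_one jac_group d (0, w, b)"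
proof -
  have "((\<lambda>t. t *\<^sub>R w) has_vector_derivative w) (at 0)" "((\<lambda>t. t * b) has_vector_derivative b) (at 0)"
    by (auto intro!: derivative_eq_intros simp: has_vector_derivative_def)
  then have "curve_at_one jac_group (\<lambda>t. (mat 1, t *\<^sub>R w, t * b)) (0, w, b)"
    by (intro curve_at_one_jacI smooth_intros has_vector_derivative_const)
       (simp_all add: symplectic_matrix_iff)
  then show ?thesis by blast
qed

text \<open>Polarisation: a Hamiltonian matrix \<open>\<xi>\<close> satisfies
  \<open>\<xi> x = (\<Sum>b. \<Omega> (J b) x \<cdot> \<xi> b) = (\<Sum>b. \<Omega> (\<xi> b) x \<cdot> J b)\<close> with \<open>J = \<Omega>mat\<close>.\<close>

lemma hamiltonian_eq_sum_rank_one: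
  assumes "(\<xi>, w, a) \<in> jac"
  shows "\<xi> = (\<Sum>b\<in>Basis. (1 / 2) *\<^sub>R rank_one (\<Omega>mat *v b + \<xi> *v b) +
    ((- 1 / 2) *\<^sub>R rank_one (\<Omega>mat *v b) + (- 1 / 2) *\<^sub>R rank_one (\<xi> *v b)))" (is "_ = ?R")
proof -
  have "?R *v x = \<xi> *v x" for x
  proof -
    have 1: "\<xi> *v x = (\<Sum>b\<in>Basis. \<Omega> (\<Omega>mat *v b) x *\<^sub>R (\<xi> *v b))"
      by (subst euclidean_representation[of x, symmetric])
         (simp only: mv.sum_right mv.scaleR_right \<Omega>_\<Omega>mat_left inner_commute)
    have *: "\<Omega> (\<Sum>b\<in>Basis. \<Omega> (\<xi> *v b) x *\<^sub>R (\<Omega>mat *v b)) y = \<Omega> (\<xi> *v x) y" for y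
    proof -
      have "\<Omega> (\<Sum>b\<in>Basis. \<Omega> (\<xi> *v b) x *\<^sub>R (\<Omega>mat *v b)) y = (\<Sum>b\<in>Basis. (y \<bullet> b) * \<Omega> (\<xi> *v b) x)"
        by (simp add: \<Omega>.sum_left \<Omega>.scaleR_left \<Omega>_\<Omega>mat_left inner_commute mult.commute)
      also have "\<dots> = \<Omega> (\<xi> *v (\<Sum>b\<in>Basis. (y \<bullet> b) *\<^sub>R b)) x"
        by (simp only: mv.sum_right mv.scaleR_right \<Omega>.sum_left \<Omega>.scaleR_left real_scaleR_def)
      also have "\<dots> = \<Omega> (\<xi> *v y) x" by (simp only: euclidean_representation)
      also have "\<dots> = \<Omega> (\<xi> *v x) y"
        using assms \<Omega>_skew[of "\<xi> *v x" y] by (simp add: jac_iff)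
      finally show ?thesis .
    qed
    have 2: "\<xi> *v x = (\<Sum>b\<in>Basis. \<Omega> (\<xi> *v b) x *\<^sub>R (\<Omega>mat *v b))"
      by (rule \<Omega>_eqI) (simp only: *)
    \<comment> \<open>Polarisation: \<open>rank_one (u + v) - rank_one u - rank_one v\<close> sends
      x to \<Omega> u x v + \<Omega> v x u. With u = J b and v = \<xi> b, half of this summed over b
      is half of each of the two expansions of \<xi> x.\<close>
    have "?R *v x = (\<Sum>b\<in>Basis. (1 / 2) *\<^sub>R (\<Omega> (\<Omega>mat *v b) x *\<^sub>R (\<xi> *v b)) +
        (1 / 2) *\<^sub>R (\<Omega> (\<xi> *v b) x *\<^sub>R (\<Omega>mat *v b)))"
      unfolding mv.sum_left
    proof (rule sum.cong[OF refl])
      fix b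
      show "((1 / 2) *\<^sub>R rank_one (\<Omega>mat *v b + \<xi> *v b) + ((- 1 / 2) *\<^sub>R rank_one (\<Omega>mat *v b) +
          (- 1 / 2) *\<^sub>R rank_one (\<xi> *v b))) *v x =
        (1 / 2) *\<^sub>R (\<Omega> (\<Omega>mat *v b) x *\<^sub>R (\<xi> *v b)) + (1 / 2) *\<^sub>R (\<Omega> (\<xi> *v b) x *\<^sub>R (\<Omega>mat *v b))"
        by (simp add: mv.add_left mv.diff_left mv.minus_left mv.scaleR_left rank_one_mult \<Omega>.add_left
            scaleR_add_left scaleR_add_right)
    qed
    also have "\<dots> = (1 / 2) *\<^sub>R (\<xi> *v x) + (1 / 2) *\<^sub>R (\<xi> *v x)"
      by (simp only: sum.distrib scaleR_right.sum[symmetric] 1[symmetric] 2[symmetric])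
    also have "\<dots> = \<xi> *v x" by (simp add: scaleR_add_left[symmetric])
    finally show ?thesis .
  qed
  then show ?thesis by (simp add: matrix_eq)
qed

text \<open>Sums of velocities are realised by products of curves, so the decomposition into
  rank-one matrices leaves only transvections and one translation to be provided with
  curves.\<close>

lemma curve_exists:
  assumes "A \<in> jac"
  shows "\<exists>c. curve_at_one jac_group c A"
proof -
  obtain \<xi> w a where A: "A = (\<xi>, w, a)" by (cases A)
  have add: "\<exists>c. curve_at_one jac_group c (\<xi> + \<zeta>, 0, 0)"
    if "\<exists>c. curve_at_one jac_group c (\<xi>, 0, 0)" "\<exists>c. curve_at_one jac_group c (\<zeta>, 0, 0)" for \<xi> \<zeta> :: "'a phase_mat"
    using that curve_add by force
  have sum: "(\<Sum>i\<in>I. (X i, 0, 0)) = (\<Sum>i\<in>I. X i, 0, 0)" for I :: "'a phase set" and X :: "_ \<Rightarrow> 'a phase_mat"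
    by (induction I rule: infinite_finite_induct) (auto simp: zero_prod_def)
  have "\<exists>c. curve_at_one jac_group c (\<Sum>b\<in>Basis. (1 / 2) *\<^sub>R rank_one (\<Omega>mat *v b + \<xi> *v b) +
    ((- 1 / 2) *\<^sub>R rank_one (\<Omega>mat *v b) + (- 1 / 2) *\<^sub>R rank_one (\<xi> *v b)), 0, 0)"
    unfolding sum[symmetric] by (intro curve_sum add curve_rank_one) simp
  then have "\<exists>c. curve_at_one jac_group c (\<xi>, 0, 0)"
    using hamiltonian_eq_sum_rank_one[OF assms[unfolded A]] by simp
  then show ?thesis using curve_add curve_translation[of w a] unfolding A by fastforce
qed

section \<open>The Lie algebra of the Jacobi group\<close>

text \<open>A curve with velocity A must exist: otherwise every D would satisfy the implication
  vacuously and the description would not determine a value.\<close>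

lemma the_derivative_along_curves:
  assumes "A \<in> jac" "\<And>c. curve_at_one jac_group c A \<Longrightarrow> (F c has_vector_derivative D) (at 0)"
  shows "(THE D. \<forall>c. curve_at_one jac_group c A \<longrightarrow> (F c has_vector_derivative D) (at 0)) = D"
  using curve_exists[OF assms(1)] assms(2) by (intro the_equality) (auto intro: vector_derivative_unique_at)

lemma group_Ad_jac:
  assumes g: "transpose g ** \<Omega>mat ** g = \<Omega>mat" and "(\<xi>, w, b) \<in> jac"
  shows "group_Ad jac_group (g, v, a) (\<xi>, w, b) =
    (g ** \<xi> ** symplectic_inverse g,
     g *v w - g *v (\<xi> *v (symplectic_inverse g *v v)),
     b + \<Omega> v (g *v w) - \<Omega> v (g *v (\<xi> *v (symplectic_inverse g *v v))) / 2)"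
  unfolding group_Ad_def
proof (rule the_derivative_along_curves[OF assms(2)])
  fix c assume "curve_at_one jac_group c (\<xi>, w, b)"
  then obtain \<gamma> \<nu> \<sigma> where c: "c = (\<lambda>t. (\<gamma> t, \<nu> t, \<sigma> t))"
    "\<forall>t. transpose (\<gamma> t) ** \<Omega>mat ** \<gamma> t = \<Omega>mat" "\<gamma> 0 = mat 1" "\<nu> 0 = 0" "\<sigma> 0 = 0"
    "(\<gamma> has_vector_derivative \<xi>) (at 0)" "(\<nu> has_vector_derivative w) (at 0)" "(\<sigma> has_vector_derivative b) (at 0)"
    by (rule curve_at_one_jacE)
  let ?h = "symplectic_inverse g"
  note inv = symplectic_inverse_vec[OF g]
  have 1: "((\<lambda>s. g ** \<gamma> s ** ?h) has_vector_derivative g ** \<xi> ** ?h) (at 0)"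
    using bounded_linear.has_vector_derivative[OF mm.bounded_linear_left
        bounded_linear.has_vector_derivative[OF mm.bounded_linear_right c(6)]] .
  have m: "((\<lambda>s. g *v (\<gamma> s *v (?h *v v))) has_vector_derivative g *v (\<xi> *v (?h *v v))) (at 0)"
    using bounded_linear.has_vector_derivative[OF mv.bounded_linear_right
        bounded_linear.has_vector_derivative[OF mv.bounded_linear_left c(6)]] .
  have n: "((\<lambda>s. v + g *v \<nu> s) has_vector_derivative 0 + g *v w) (at 0)"
    by (intro has_vector_derivative_add has_vector_derivative_const
        bounded_linear.has_vector_derivative[OF mv.bounded_linear_right c(7)])
  have 2: "((\<lambda>s. v + g *v \<nu> s - g *v (\<gamma> s *v (?h *v v))) has_vector_derivative
      g *v w - g *v (\<xi> *v (?h *v v))) (at 0)"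
    using has_vector_derivative_diff[OF n m] by simp
  have 3: "((\<lambda>s. \<sigma> s + \<Omega> v (g *v \<nu> s) / 2 - \<Omega> (v + g *v \<nu> s) (g *v (\<gamma> s *v (?h *v v))) / 2) has_vector_derivative
      b + \<Omega> v (g *v w) / 2 - (\<Omega> v (g *v (\<xi> *v (?h *v v))) + \<Omega> (g *v w) v) / 2) (at 0)"
    using has_vector_derivative_diff[OF has_vector_derivative_add[OF c(8)
          has_vector_derivative_divide[OF bounded_linear.has_vector_derivative[OF \<Omega>.bounded_linear_right
            bounded_linear.has_vector_derivative[OF mv.bounded_linear_right c(7)]], of v g 2]]
        has_vector_derivative_divide[OF \<Omega>.has_vector_derivative[OF n m], of 2]]
    by (simp add: c inv)
  have eq: "(\<lambda>s. (g, v, a) \<otimes>\<^bsub>jac_group\<^esub> c s \<otimes>\<^bsub>jac_group\<^esub> (inv\<^bsub>jac_group\<^esub> (g, v, a))) =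
      (\<lambda>s. (g ** \<gamma> s ** ?h, v + g *v \<nu> s - g *v (\<gamma> s *v (?h *v v)),
        \<sigma> s + \<Omega> v (g *v \<nu> s) / 2 - \<Omega> (v + g *v \<nu> s) (g *v (\<gamma> s *v (?h *v v))) / 2))"
    by (simp add: c(1) jac_group_simps jac_group_inv[OF g] mv.minus_right \<Omega>.minus_right fun_eq_iff
        matrix_vector_mul_assoc[symmetric])
  \<comment> \<open>Multiplication from the left and from the right each contribute half of \<Omega>
    v (g w), the second one through skewness; this is why that term carries no factor 1/2.\<close>
  have D: "b + \<Omega> v (g *v w) / 2 - (\<Omega> v (g *v (\<xi> *v (?h *v v))) + \<Omega> (g *v w) v) / 2 =
      b + \<Omega> v (g *v w) - \<Omega> v (g *v (\<xi> *v (?h *v v))) / 2"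
    using \<Omega>_skew[of "g *v w" v] by (simp add: field_simps)
  show "((\<lambda>s. (g, v, a) \<otimes>\<^bsub>jac_group\<^esub> c s \<otimes>\<^bsub>jac_group\<^esub> (inv\<^bsub>jac_group\<^esub> (g, v, a))) has_vector_derivative
      (g ** \<xi> ** ?h, g *v w - g *v (\<xi> *v (?h *v v)), b + \<Omega> v (g *v w) - \<Omega> v (g *v (\<xi> *v (?h *v v))) / 2)) (at 0)"
    unfolding eq D[symmetric] by (rule has_vector_derivative_Pair[OF 1 has_vector_derivative_Pair[OF 2 3]])
qed

lemma bounded_linear_symplectic_inverse: "bounded_linear symplectic_inverse"
  unfolding linear_conv_bounded_linear[symmetric]
proof (rule linearI)
  fix A B :: "'k::finite phase_mat" and r :: real
  have "transpose (A + B) = transpose A + transpose B" "transpose (r *\<^sub>R A) = r *\<^sub>R transpose A"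
    by (simp_all add: transpose_def vec_eq_iff)
  then show "symplectic_inverse (A + B) = symplectic_inverse A + symplectic_inverse B"
    "symplectic_inverse (r *\<^sub>R A) = r *\<^sub>R symplectic_inverse A"
    by (simp_all add: symplectic_inverse_def mm.add_left mm.add_right mm.scaleR_left mm.scaleR_right)
qed

lemma symplectic_inverse_mat_1: "symplectic_inverse (mat 1) = mat 1"
  by (simp add: symplectic_inverse_def \<Omega>mat_square)

lemma symplectic_inverse_jac:
  assumes "(\<xi>, w, a) \<in> jac" shows "symplectic_inverse \<xi> = - \<xi>"
proof -
  have "transpose \<xi> ** \<Omega>mat = - (\<Omega>mat ** \<xi>)"
    using assms by (simp add: jac_def eq_neg_iff_add_eq_0)
  then have "symplectic_inverse \<xi> = \<Omega>mat ** \<Omega>mat ** \<xi>"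
    by (simp add: symplectic_inverse_def matrix_mul_assoc[symmetric] mm.minus_right)
  then show ?thesis by (simp add: \<Omega>mat_square mm.minus_left)
qed

lemma jac_bracket_eq:
  assumes A: "(\<eta>, u, a) \<in> jac" and B: "(\<xi>, w, b) \<in> jac"
  shows "jac_bracket (\<eta>, u, a) (\<xi>, w, b) = (\<eta> ** \<xi> - \<xi> ** \<eta>, \<eta> *v w - \<xi> *v u, \<Omega> u w)"
  unfolding jac_bracket_def group_bracket_def
proof (rule the_derivative_along_curves[OF A])
  fix c assume "curve_at_one jac_group c (\<eta>, u, a)"
  then obtain \<gamma> \<nu> \<sigma> where c: "c = (\<lambda>t. (\<gamma> t, \<nu> t, \<sigma> t))"
    "\<forall>t. transpose (\<gamma> t) ** \<Omega>mat ** \<gamma> t = \<Omega>mat" "\<gamma> 0 = mat 1" "\<nu> 0 = 0" "\<sigma> 0 = 0"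
    "(\<gamma> has_vector_derivative \<eta>) (at 0)" "(\<nu> has_vector_derivative u) (at 0)" "(\<sigma> has_vector_derivative a) (at 0)"
    by (rule curve_at_one_jacE)
  let ?h = "\<lambda>t. symplectic_inverse (\<gamma> t)"
  have h: "(?h has_vector_derivative - \<eta>) (at 0)"
    using bounded_linear.has_vector_derivative[OF bounded_linear_symplectic_inverse c(6)]
    by (simp add: symplectic_inverse_jac[OF A])
  have 1: "((\<lambda>t. \<gamma> t ** \<xi> ** ?h t) has_vector_derivative \<eta> ** \<xi> - \<xi> ** \<eta>) (at 0)"
    using mm.has_vector_derivative[OF bounded_linear.has_vector_derivative[OF mm.bounded_linear_left c(6), of \<xi>] h]
    by (simp add: c symplectic_inverse_mat_1 mm.minus_right)
  have m: "((\<lambda>t. \<gamma> t *v (\<xi> *v (?h t *v \<nu> t))) has_vector_derivative \<xi> *v u) (at 0)"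
    using mv.has_vector_derivative[OF c(6) bounded_linear.has_vector_derivative[OF mv.bounded_linear_right
          mv.has_vector_derivative[OF h c(7)], of \<xi>]]
    by (simp add: c symplectic_inverse_mat_1)
  have n: "((\<lambda>t. \<gamma> t *v w) has_vector_derivative \<eta> *v w) (at 0)"
    by (rule bounded_linear.has_vector_derivative[OF mv.bounded_linear_left c(6)])
  \<comment> \<open>The last term of Ad contains \<nu> twice and has zero derivative at 0, so the
    central component keeps only \<Omega> u w.\<close>
  have 3: "((\<lambda>t. b + \<Omega> (\<nu> t) (\<gamma> t *v w) - \<Omega> (\<nu> t) (\<gamma> t *v (\<xi> *v (?h t *v \<nu> t))) / 2) has_vector_derivative \<Omega> u w) (at 0)"
    using has_vector_derivative_diff[OF has_vector_derivative_add[OF has_vector_derivative_const[of b]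
          \<Omega>.has_vector_derivative[OF c(7) n]]
        has_vector_derivative_divide[OF \<Omega>.has_vector_derivative[OF c(7) m], of 2]]
    by (simp add: c)
  have "(\<lambda>t. group_Ad jac_group (c t) (\<xi>, w, b)) =
     (\<lambda>t. (\<gamma> t ** \<xi> ** ?h t, \<gamma> t *v w - \<gamma> t *v (\<xi> *v (?h t *v \<nu> t)),
        b + \<Omega> (\<nu> t) (\<gamma> t *v w) - \<Omega> (\<nu> t) (\<gamma> t *v (\<xi> *v (?h t *v \<nu> t))) / 2))"
    by (simp add: c(1) group_Ad_jac[OF c(2)[rule_format] B])
  then show "((\<lambda>t. group_Ad jac_group (c t) (\<xi>, w, b)) has_vector_derivative
      (\<eta> ** \<xi> - \<xi> ** \<eta>, \<eta> *v w - \<xi> *v u, \<Omega> u w)) (at 0)"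
    using has_vector_derivative_Pair[OF 1 has_vector_derivative_Pair[OF has_vector_derivative_diff[OF n m] 3]] by simp
qed

lemma jac_bracket_closed:
  assumes "A \<in> jac" "B \<in> jac" shows "jac_bracket A B \<in> jac"
proof -
  obtain \<eta> u a \<xi> w b where AB: "A = (\<eta>, u, a)" "B = (\<xi>, w, b)" by (metis prod_cases3)
  have "\<Omega> ((\<eta> ** \<xi> - \<xi> ** \<eta>) *v x) y = - \<Omega> x ((\<eta> ** \<xi> - \<xi> ** \<eta>) *v y)" for x y
    using assms by (simp add: AB jac_iff mv.diff_left matrix_vector_mul_assoc[symmetric] \<Omega>.diff_left \<Omega>.diff_right)
  then show ?thesis using assms by (simp add: AB jac_bracket_eq jac_iff)
qed

section \<open>Quadratic Hamiltonians\<close>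

text \<open>The Hamiltonian with the affine field z |-> \<xi> z + v and the value a at 0. For \<xi>
  in \<open>jac\<close> the form \<Omega> (\<xi> z) w is symmetric in z and w, and the 1/2
  compensates the two equal terms of the derivative.\<close>

definition quadratic :: "'k::finite triple \<Rightarrow> 'k phase \<Rightarrow> real" where
  "quadratic = (\<lambda>(\<xi>, v, a) z. a + \<Omega> (\<xi> *v z) z / 2 + \<Omega> v z)"

lemma smooth_quadratic: "smooth (quadratic A)"
proof -
  obtain \<xi> v a where A: "A = (\<xi>, v, a)" by (cases A)
  have "smooth (\<lambda>z. a + \<Omega> (\<xi> *v z) z * (1 / 2) + \<Omega> v z)"
    by (intro smooth_intros smooth_\<Omega> smooth_linear matrix_vector_mul_linear)
  then show ?thesis by (simp add: A quadratic_def)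
qed

lemma quadratic_derivative:
  assumes "(\<xi>, v, a) \<in> jac"
  shows "frechet_derivative (quadratic (\<xi>, v, a)) (at z) w = \<Omega> (\<xi> *v z + v) w"
proof -
  have "((\<lambda>z. a + \<Omega> (\<xi> *v z) z * (1 / 2) + \<Omega> v z) has_derivative
      (\<lambda>w. 0 + (\<Omega> (\<xi> *v z) w + \<Omega> (\<xi> *v w) z) * (1 / 2) + \<Omega> v w)) (at z)"
    by (intro has_derivative_add has_derivative_const has_derivative_mult_left \<Omega>.FDERIV has_derivative_ident
        bounded_linear_imp_has_derivative matrix_vector_mul_bounded_linear \<Omega>.bounded_linear_right)
  moreover have "\<Omega> (\<xi> *v w) z = \<Omega> (\<xi> *v z) w"
    using assms \<Omega>_skew[of "\<xi> *v z" w] by (simp add: jac_iff)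
  ultimately show ?thesis
    by (simp add: quadratic_def has_derivative_unique_at \<Omega>.add_left)
qed

lemma ham_vf_eqI:
  assumes "\<And>v. \<Omega> X v = frechet_derivative f (at z) v"
  shows "ham_vf f z = X"
  unfolding ham_vf_def by (rule the_equality) (use assms in \<open>auto intro: \<Omega>_eqI\<close>)

text \<open>\<open>ham_vf\<close> is a definite description, so a witness is needed: \<Omega>mat
  applied to the gradient.\<close>

lemma \<Omega>_ham_vf:
  assumes "smooth f"
  shows "\<Omega> (ham_vf f z) v = frechet_derivative f (at z) v"
proof -
  let ?r = "\<Sum>b\<in>Basis. frechet_derivative f (at z) b *\<^sub>R b"
  have *: "\<Omega> (\<Omega>mat *v ?r) v = frechet_derivative f (at z) v" for v
    by (subst has_derivative_linear_apply[OF smooth_has_derivative[OF assms], of _ v])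
       (simp add: \<Omega>_\<Omega>mat_left inner_sum_right inner_commute[of _ v] mult.commute)
  from ham_vf_eqI[OF this] * show ?thesis by simp
qed

lemma ham_vf_quadratic:
  "(\<xi>, v, a) \<in> jac \<Longrightarrow> ham_vf (quadratic (\<xi>, v, a)) z = \<xi> *v z + v"
  by (rule ham_vf_eqI) (simp add: quadratic_derivative)

lemma tangent_inclusion_eq:
  assumes "(\<xi>, v, a) \<in> jac"
  shows "tangent_inclusion (\<xi>, v, a) = ((\<lambda>z. \<xi> *v z + v), a)"
  unfolding tangent_inclusion_def
proof (rule the_equality)
  have *: "((\<lambda>t. fst (group_inclusion (c t)) z) has_vector_derivative \<xi> *v z + v) (at 0) \<and>
      ((\<lambda>t. snd (group_inclusion (c t))) has_real_derivative a) (at 0)"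
    if "curve_at_one jac_group c (\<xi>, v, a)" for c z
  proof -
    from that obtain \<gamma> \<nu> \<sigma> where c: "c = (\<lambda>t. (\<gamma> t, \<nu> t, \<sigma> t))"
      "(\<gamma> has_vector_derivative \<xi>) (at 0)" "(\<nu> has_vector_derivative v) (at 0)" "(\<sigma> has_vector_derivative a) (at 0)"
      by (rule curve_at_one_jacE)
    have "((\<lambda>t. \<gamma> t *v z + \<nu> t) has_vector_derivative \<xi> *v z + v) (at 0)"
      by (intro has_vector_derivative_add bounded_linear.has_vector_derivative[OF mv.bounded_linear_left] c)
    then show ?thesis using c(4) by (simp add: c(1) group_inclusion_eq has_real_derivative_iff_has_vector_derivative)
  qed
  then show "\<forall>c. curve_at_one jac_group c (\<xi>, v, a) \<longrightarrow>
      (\<forall>z. ((\<lambda>t. fst (group_inclusion (c t)) z) has_vector_derivative fst (\<lambda>z. \<xi> *v z + v, a) z) (at 0)) \<and>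
      ((\<lambda>t. snd (group_inclusion (c t))) has_real_derivative snd (\<lambda>z. \<xi> *v z + v, a)) (at 0)"
    by simp
  fix W
  assume W: "\<forall>c. curve_at_one jac_group c (\<xi>, v, a) \<longrightarrow>
      (\<forall>z. ((\<lambda>t. fst (group_inclusion (c t)) z) has_vector_derivative fst W z) (at 0)) \<and>
      ((\<lambda>t. snd (group_inclusion (c t))) has_real_derivative snd W) (at 0)"
  obtain c where c: "curve_at_one jac_group c (\<xi>, v, a)" using curve_exists[OF assms] by blast
  have "fst W z = \<xi> *v z + v" for z
    using W c *[OF c, of z] by (metis vector_derivative_unique_at)
  moreover have "snd W = a" using W c *[OF c] by (metis DERIV_unique)
  ultimately show "W = (\<lambda>z. \<xi> *v z + v, a)" by (simp add: prod_eq_iff fun_eq_iff)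
qed

text \<open>The tangent map produces the field of \<open>quadratic A\<close>. A Hamiltonian is
  determined by its field up to a constant, and u + f - f 0 replaces that constant by the central
  component.\<close>

lemma lie_inclusion_eq:
  assumes "A \<in> jac" shows "lie_inclusion A = quadratic A"
proof -
  obtain \<xi> v a where A: "A = (\<xi>, v, a)" by (cases A)
  have jac: "(\<xi>, v, b) \<in> jac" for b using assms by (simp add: A jac_iff)
  show ?thesis
    unfolding A lie_inclusion_def tangent_inclusion_eq[OF jac] quant_lie_to_fun_def prod.case
  proof (rule the_equality)
    \<comment> \<open>The subtraction of f 0 removes the constant of f, so the witness is taken with
      constant 0.\<close>
    have "(\<lambda>z. \<xi> *v z + v) = ham_vf (quadratic (\<xi>, v, 0))"
      by (simp add: fun_eq_iff ham_vf_quadratic[OF jac])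
    moreover have "quadratic (\<xi>, v, a) = (\<lambda>z. a + quadratic (\<xi>, v, 0) z - quadratic (\<xi>, v, 0) 0)"
      by (simp add: quadratic_def fun_eq_iff)
    ultimately show "\<exists>f\<in>smooth_functions. (\<lambda>z. \<xi> *v z + v) = ham_vf f \<and> quadratic (\<xi>, v, a) = (\<lambda>z. a + f z - f 0)"
      by (intro bexI[of _ "quadratic (\<xi>, v, 0)"]) (simp_all add: smooth_functions_def smooth_quadratic)
  next
    fix h
    assume "\<exists>f\<in>smooth_functions. (\<lambda>z. \<xi> *v z + v) = ham_vf f \<and> h = (\<lambda>z. a + f z - f 0)"
    then obtain f where f: "smooth f" "ham_vf f = (\<lambda>z. \<xi> *v z + v)" "h = (\<lambda>z. a + f z - f 0)"
      by (auto simp: smooth_functions_def)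
    have "frechet_derivative f (at z) = frechet_derivative (quadratic (\<xi>, v, a)) (at z)" for z
      using \<Omega>_ham_vf[OF f(1), of z] by (simp add: fun_eq_iff f(2) quadratic_derivative[OF jac])
    then have "(f has_derivative frechet_derivative (quadratic (\<xi>, v, a)) (at z)) (at z)" for z
      using smooth_has_derivative[OF f(1), of z] by simp
    from has_derivative_eq_const[OF this smooth_has_derivative[OF smooth_quadratic], of _ 0]
    have *: "f z - quadratic (\<xi>, v, a) z = f 0 - quadratic (\<xi>, v, a) 0" for z .
    have "h z = quadratic (\<xi>, v, a) z" for z
      using *[of z] by (simp add: f(3) quadratic_def)
    then show "h = quadratic (\<xi>, v, a)" by (rule ext)
  qed
qed

lemma jac_subspace: "A \<in> jac \<Longrightarrow> B \<in> jac \<Longrightarrow> a *\<^sub>R A + b *\<^sub>R B \<in> jac"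
  by (cases A; cases B)
     (simp add: jac_iff mv.add_left mv.scaleR_left \<Omega>.add_left \<Omega>.add_right \<Omega>.scaleR_left \<Omega>.scaleR_right)

lemma quadratic_linear: "quadratic (a *\<^sub>R A + b *\<^sub>R B) = (\<lambda>z. a * quadratic A z + b * quadratic B z)"
  by (cases A; cases B)
     (simp add: quadratic_def fun_eq_iff mv.add_left mv.scaleR_left \<Omega>.add_left \<Omega>.scaleR_left algebra_simps add_divide_distrib)

lemma inj_on_quadratic: "inj_on quadratic jac"
proof (rule inj_onI)
  fix A B :: "'k::finite triple"
  assume AB: "A \<in> jac" "B \<in> jac" and eq: "quadratic A = quadratic B"
  obtain \<xi> v a \<zeta> w b where A: "A = (\<xi>, v, a)" and B: "B = (\<zeta>, w, b)" by (metis prod_cases3)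
  have "\<xi> *v z + v = \<zeta> *v z + w" for z
    using ham_vf_quadratic[OF AB(1)[unfolded A]] ham_vf_quadratic[OF AB(2)[unfolded B]] eq by (simp add: A B)
  then have "\<xi> = \<zeta> \<and> v = w" by (rule affine_inject)
  moreover have "a = b" using fun_cong[OF eq, of 0] by (simp add: A B quadratic_def)
  ultimately show "A = B" by (simp add: A B)
qed

text \<open>The expansion of \<Omega> (\<eta> z + u) (\<xi> z + w) by degree in z matches the three
  components of the bracket: the quadratic part is the commutator because \<eta> and \<xi> are skew
  for \<Omega>, the linear part is the action on V, and the constant is the central term.\<close>

lemma quadratic_bracket:
  assumes "A \<in> jac" "B \<in> jac"
  shows "quadratic (jac_bracket A B) = poisson_bracket (quadratic A) (quadratic B)"
proof
  fix z
  obtain \<eta> u a \<xi> w b where AB: "A = (\<eta>, u, a)" "B = (\<xi>, w, b)" by (metis prod_cases3)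
  have jac: "\<Omega> (\<eta> *v x) y = - \<Omega> x (\<eta> *v y)" "\<Omega> (\<xi> *v x) y = - \<Omega> x (\<xi> *v y)" for x y
    using assms by (auto simp: AB jac_iff)
  have "\<Omega> (\<eta> *v (\<xi> *v z)) z = \<Omega> (\<eta> *v z) (\<xi> *v z)" "\<Omega> (\<xi> *v (\<eta> *v z)) z = - \<Omega> (\<eta> *v z) (\<xi> *v z)"
    "\<Omega> (\<eta> *v w) z = \<Omega> (\<eta> *v z) w" "\<Omega> (\<xi> *v u) z = - \<Omega> u (\<xi> *v z)"
    using jac(1)[of "\<xi> *v z" z] jac(2)[of "\<eta> *v z" z] jac(1)[of w z] jac(2)[of u z]
      \<Omega>_skew[of "\<xi> *v z" "\<eta> *v z"] \<Omega>_skew[of w "\<eta> *v z"] by simp_all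
  moreover have "quadratic (jac_bracket A B) z = \<Omega> u w + (\<Omega> (\<eta> *v (\<xi> *v z)) z - \<Omega> (\<xi> *v (\<eta> *v z)) z) / 2
      + (\<Omega> (\<eta> *v w) z - \<Omega> (\<xi> *v u) z)"
    using assms by (simp add: AB jac_bracket_eq quadratic_def mv.diff_left matrix_vector_mul_assoc[symmetric] \<Omega>.diff_left)
  moreover have "poisson_bracket (quadratic A) (quadratic B) z = \<Omega> (\<eta> *v z + u) (\<xi> *v z + w)"
    using assms by (simp add: AB poisson_bracket_def ham_vf_quadratic)
  ultimately show "quadratic (jac_bracket A B) z = poisson_bracket (quadratic A) (quadratic B) z"
    by (simp add: \<Omega>.add_left \<Omega>.add_right)
qed

section \<open>The dual of the Jacobi Lie algebra\<close>

lemma matrix_inv_unique: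
  fixes A B :: "real ^ 'n ^ 'n"
  assumes "A ** B = mat 1" shows "matrix_inv A = B"
proof -
  have "A ** matrix_inv A = mat 1 \<and> matrix_inv A ** A = mat 1"
    unfolding matrix_inv_def
    by (rule someI[of _ B]) (simp add: assms matrix_left_right_inverse[THEN iffD1, OF assms])
  then have "matrix_inv A ** (A ** B) = B" by (simp add: matrix_mul_assoc)
  then show ?thesis by (simp add: assms)
qed

lemma matrix_inv_\<Omega>mat: "matrix_inv \<Omega>mat = - \<Omega>mat"
  by (rule matrix_inv_unique) (simp add: mm.minus_right \<Omega>mat_square)

lemma triple_to_jac_eq: "triple_to_jac (S\<^sub>2, S\<^sub>1, S\<^sub>0) = (\<Omega>mat ** S\<^sub>2, \<Omega>mat *v S\<^sub>1, S\<^sub>0)"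
  by (simp add: triple_to_jac_def matrix_inv_\<Omega>mat mm.minus_left mv.minus_left)

lemma symmetric_matrix_inner: "transpose S = S \<Longrightarrow> (S *v x) \<bullet> y = x \<bullet> (S *v y)" for S :: "real ^ 'n ^ 'n"
  by (simp add: inner_matrix_vector_mult)

lemma triple_to_jac_in_jac:
  assumes "S \<in> sym_triples" shows "triple_to_jac S \<in> jac"
proof -
  obtain S\<^sub>2 S\<^sub>1 S\<^sub>0 where S: "S = (S\<^sub>2, S\<^sub>1, S\<^sub>0)" by (cases S)
  have "\<Omega> (\<Omega>mat *v (S\<^sub>2 *v u)) w = - \<Omega> u (\<Omega>mat *v (S\<^sub>2 *v w))" for u w
    using assms \<Omega>_skew[of u "\<Omega>mat *v (S\<^sub>2 *v w)"] symmetric_matrix_inner[of S\<^sub>2 u w]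
    by (simp add: S sym_triples_def \<Omega>_\<Omega>mat_left inner_commute)
  then show ?thesis by (simp add: S triple_to_jac_eq jac_iff matrix_vector_mul_assoc[symmetric])
qed

lemma triple_to_jac_linear:
  "triple_to_jac (a *\<^sub>R A + b *\<^sub>R B) = a *\<^sub>R triple_to_jac A + b *\<^sub>R triple_to_jac B"
  by (cases A; cases B)
     (simp add: triple_to_jac_eq mm.add_right mm.scaleR_right mv.add_right mv.scaleR_right)

lemma sym_triples_subspace: "A \<in> sym_triples \<Longrightarrow> B \<in> sym_triples \<Longrightarrow> a *\<^sub>R A + b *\<^sub>R B \<in> sym_triples"
  by (cases A; cases B) (simp add: sym_triples_def transpose_def vec_eq_iff)

lemma inner_transpose: "A \<bullet> transpose B = transpose A \<bullet> B" for A B :: "real ^ 'n ^ 'n"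
  by (simp add: inner_vec_def transpose_def) (rule sum.swap)

lemma triple_pairing_inner:
  assumes "S \<in> sym_triples" shows "triple_pairing X S = X \<bullet> S"
proof -
  obtain S\<^sub>2 S\<^sub>1 S\<^sub>0 X\<^sub>2 X\<^sub>1 X\<^sub>0 where [simp]: "S = (S\<^sub>2, S\<^sub>1, S\<^sub>0)" "X = (X\<^sub>2, X\<^sub>1, X\<^sub>0)" by (metis prod_cases3)
  have "trace (X\<^sub>2 ** S\<^sub>2) = X\<^sub>2 \<bullet> transpose S\<^sub>2"
    by (simp add: trace_def matrix_matrix_mult_def inner_vec_def transpose_def)
  then show ?thesis using assms by (simp add: triple_pairing_def sym_triples_def inner_commute)
qed

text \<open>The orthogonal projection onto the symmetric triples. It extends functionals from this
  subspace to the ambient space, which has a standard basis.\<close>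

definition symmetrize :: "'k::finite triple \<Rightarrow> 'k triple" where
  "symmetrize = (\<lambda>(S\<^sub>2, S\<^sub>1, S\<^sub>0). ((1 / 2) *\<^sub>R (S\<^sub>2 + transpose S\<^sub>2), S\<^sub>1, S\<^sub>0))"

lemma symmetrize_sym: "symmetrize S \<in> sym_triples"
  by (cases S) (simp add: symmetrize_def sym_triples_def transpose_def vec_eq_iff)

lemma symmetrize_id: "S \<in> sym_triples \<Longrightarrow> symmetrize S = S"
  by (cases S) (simp add: symmetrize_def sym_triples_def scaleR_2[symmetric])

lemma linear_symmetrize: "linear symmetrize"
  by (rule linearI) (auto simp: symmetrize_def transpose_def vec_eq_iff algebra_simps)

lemma inner_symmetrize: "X \<in> sym_triples \<Longrightarrow> X \<bullet> symmetrize S = X \<bullet> S"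
  by (cases X; cases S) (simp add: symmetrize_def sym_triples_def inner_add_right inner_transpose)

text \<open>Riesz representation on a subspace: extend L through \<open>symmetrize\<close>, form the
  representing vector in the ambient basis, and project it back, which does not change its inner
  products with symmetric triples.\<close>

lemma linear_functional_on_sym_triples:
  fixes L :: "'k::finite triple \<Rightarrow> real"
  assumes "\<And>A B a b. A \<in> sym_triples \<Longrightarrow> B \<in> sym_triples \<Longrightarrow> L (a *\<^sub>R A + b *\<^sub>R B) = a * L A + b * L B"
  obtains S where "S \<in> sym_triples" "\<And>X. X \<in> sym_triples \<Longrightarrow> L X = X \<bullet> S"
proof
  let ?G = "\<Sum>b\<in>Basis. L (symmetrize b) *\<^sub>R b"
  have "linear (\<lambda>X. L (symmetrize X))"
  proof (rule linearI)
    fix A B :: "'k triple" and r :: real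
    show "L (symmetrize (A + B)) = L (symmetrize A) + L (symmetrize B)"
      using assms[OF symmetrize_sym symmetrize_sym, of 1 A 1 B] by (simp add: linear_add[OF linear_symmetrize])
    show "L (symmetrize (r *\<^sub>R A)) = r *\<^sub>R L (symmetrize A)"
      using assms[OF symmetrize_sym symmetrize_sym, of r A 0 A] by (simp add: linear_scale[OF linear_symmetrize])
  qed
  from linear_imp_has_derivative[OF this]
  have *: "L (symmetrize X) = X \<bullet> ?G" for X
    by (subst has_derivative_linear_apply, assumption) (simp add: inner_sum_right mult.commute)
  show "symmetrize ?G \<in> sym_triples" by (rule symmetrize_sym)
  show "L X = X \<bullet> symmetrize ?G" if "X \<in> sym_triples" for X
    using *[of X] that by (simp add: inner_symmetrize symmetrize_id)
qed

text \<open>Symmetric representatives are unique since the difference of two of them may be tested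
  against itself.\<close>

lemma jac_dual_to_triple_eqI:
  assumes "X \<in> sym_triples" "\<And>S. S \<in> sym_triples \<Longrightarrow> X \<bullet> S = \<phi> (triple_to_jac S)"
  shows "jac_dual_to_triple \<phi> = X"
  unfolding jac_dual_to_triple_def
proof (rule the_equality)
  show "X \<in> sym_triples \<and> (\<forall>S\<in>sym_triples. triple_pairing X S = \<phi> (triple_to_jac S))"
    using assms by (simp add: triple_pairing_inner)
  fix Y assume Y: "Y \<in> sym_triples \<and> (\<forall>S\<in>sym_triples. triple_pairing Y S = \<phi> (triple_to_jac S))"
  have "Y - X \<in> sym_triples" using sym_triples_subspace[of Y X 1 "- 1"] Y assms(1) by simp
  then have "(Y - X) \<bullet> (Y - X) = 0" using Y assms(2)[of "Y - X"] by (simp add: inner_diff_left triple_pairing_inner)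
  then show "Y = X" by simp
qed

lemma jac_dual_to_triple_works:
  assumes "\<phi> \<in> jac_dual"
  shows "jac_dual_to_triple \<phi> \<in> sym_triples"
    and "S \<in> sym_triples \<Longrightarrow> jac_dual_to_triple \<phi> \<bullet> S = \<phi> (triple_to_jac S)"
proof -
  have "\<phi> (triple_to_jac (a *\<^sub>R A + b *\<^sub>R B)) = a * \<phi> (triple_to_jac A) + b * \<phi> (triple_to_jac B)"
    if "A \<in> sym_triples" "B \<in> sym_triples" for A B a b
    using assms that by (simp add: triple_to_jac_linear jac_dual_def triple_to_jac_in_jac)
  then obtain X where X: "X \<in> sym_triples" "\<And>S. S \<in> sym_triples \<Longrightarrow> \<phi> (triple_to_jac S) = S \<bullet> X"
    using linear_functional_on_sym_triples[of "\<lambda>S. \<phi> (triple_to_jac S)"] by metis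
  then have *: "jac_dual_to_triple \<phi> = X" by (intro jac_dual_to_triple_eqI) (simp_all add: inner_commute)
  show "jac_dual_to_triple \<phi> \<in> sym_triples"
    "S \<in> sym_triples \<Longrightarrow> jac_dual_to_triple \<phi> \<bullet> S = \<phi> (triple_to_jac S)"
    using X by (simp_all add: * inner_commute)
qed

section \<open>Functional derivatives on the dual of \<open>jac\<close>\<close>

lemma jac_dual_subspace:
  assumes "\<mu> \<in> jac_dual" "\<nu> \<in> jac_dual" shows "(\<lambda>y. \<mu> y + \<epsilon> * \<nu> y) \<in> jac_dual"
  using assms by (simp add: jac_dual_def algebra_simps del: split_paired_All)

lemma jac_dual_to_triple_line:
  assumes "\<mu> \<in> jac_dual" "\<nu> \<in> jac_dual"
  shows "jac_dual_to_triple (\<lambda>y. \<mu> y + \<epsilon> * \<nu> y) = jac_dual_to_triple \<mu> + \<epsilon> *\<^sub>R jac_dual_to_triple \<nu>"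
  using sym_triples_subspace[OF assms[THEN jac_dual_to_triple_works(1)], of 1 \<epsilon>] assms
  by (intro jac_dual_to_triple_eqI) (simp_all add: inner_add_left jac_dual_to_triple_works)

text \<open>In triple coordinates the derivative of F is that of F' along symmetric triples. A
  symmetric S represents it, and pairing with S becomes evaluation at
  \<open>triple_to_jac S\<close>.\<close>

lemma jac_dual_functional_derivative:
  assumes F: "F \<in> smooth_on_jac_dual" and \<mu>: "\<mu> \<in> jac_dual"
  obtains x where "has_functional_derivative jac_dual jac F \<mu> x"
proof -
  obtain F' where F': "smooth F'" "\<And>\<phi>. \<phi> \<in> jac_dual \<Longrightarrow> F \<phi> = F' (jac_dual_to_triple \<phi>)"
    using F by (auto simp: smooth_on_jac_dual_def)
  let ?D = "frechet_derivative F' (at (jac_dual_to_triple \<mu>))"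
  obtain S where S: "S \<in> sym_triples" "\<And>X. X \<in> sym_triples \<Longrightarrow> ?D X = X \<bullet> S"
  proof (rule linear_functional_on_sym_triples[of ?D])
    show "?D (a *\<^sub>R A + b *\<^sub>R B) = a * ?D A + b * ?D B" for A B a b
      by (simp add: linear_add[OF smooth_frechet_linear[OF F'(1)]] linear_scale[OF smooth_frechet_linear[OF F'(1)]])
  qed blast
  have *: "((\<lambda>\<epsilon>. F (\<lambda>y. \<mu> y + \<epsilon> * \<nu> y)) has_real_derivative \<nu> (triple_to_jac S)) (at 0)" if \<nu>: "\<nu> \<in> jac_dual" for \<nu>
  proof -
    have "((\<lambda>\<epsilon>. jac_dual_to_triple \<mu> + \<epsilon> *\<^sub>R jac_dual_to_triple \<nu>) has_vector_derivative jac_dual_to_triple \<nu>) (at 0)"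
      by (auto intro!: derivative_eq_intros simp: has_vector_derivative_def)
    from smooth_vector_derivative_compose[OF F'(1) this]
    have "((\<lambda>\<epsilon>. F' (jac_dual_to_triple \<mu> + \<epsilon> *\<^sub>R jac_dual_to_triple \<nu>)) has_real_derivative ?D (jac_dual_to_triple \<nu>)) (at 0)"
      by (simp add: has_real_derivative_iff_has_vector_derivative)
    then show ?thesis
      by (simp add: F'(2) jac_dual_subspace jac_dual_to_triple_line \<mu> \<nu> S jac_dual_to_triple_works)
  qed
  show ?thesis
    by (rule that[of "triple_to_jac S"]) (simp add: has_functional_derivative_def triple_to_jac_in_jac S(1) *)
qed

lemma has_functional_derivative_unique:
  assumes "has_functional_derivative D L F \<mu> x" "has_functional_derivative D L F \<mu> y"
    and sep: "\<And>x y. x \<in> L \<Longrightarrow> y \<in> L \<Longrightarrow> (\<And>\<nu>. \<nu> \<in> D \<Longrightarrow> \<nu> x = \<nu> y) \<Longrightarrow> x = y"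
  shows "x = y"
  using assms(1,2) DERIV_unique unfolding has_functional_derivative_def by (intro sep) blast+

lemma jac_dual_separates:
  assumes xy: "x \<in> jac" "y \<in> jac" and eq: "\<And>\<nu>. \<nu> \<in> jac_dual \<Longrightarrow> \<nu> x = \<nu> y"
  shows "x = y"
proof -
  \<comment> \<open>The inner product with x - y, set to 0 off \<open>jac\<close> as membership in
    \<open>jac_dual\<close> demands.\<close>
  define \<nu> where "\<nu> A = (if A \<in> jac then A \<bullet> (x - y) else 0)" for A
  have "\<nu> \<in> jac_dual"
    by (auto simp: jac_dual_def \<nu>_def jac_subspace inner_add_left simp del: split_paired_All split_paired_Ex)
  then have "(x - y) \<bullet> (x - y) = 0" using eq[of \<nu>] xy by (simp add: \<nu>_def inner_diff_left)
  then show ?thesis by simp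
qed

section \<open>The Poisson map\<close>

definition linear_on_smooth :: "(('k::finite phase \<Rightarrow> real) \<Rightarrow> real) \<Rightarrow> bool" where
  "linear_on_smooth T \<longleftrightarrow> (\<forall>f g a b. smooth f \<longrightarrow> smooth g \<longrightarrow> T (\<lambda>z. a * f z + b * g z) = a * T f + b * T g)"

lemma distributions_linear: "T \<in> distributions \<Longrightarrow> linear_on_smooth T"
  by (auto simp: distributions_def linear_on_smooth_def smooth_functions_def)

lemma linear_on_smooth_sum:
  assumes T: "linear_on_smooth T" and f: "\<And>i. i \<in> I \<Longrightarrow> smooth (f i)"
  shows "T (\<lambda>z. \<Sum>i\<in>I. c i * f i z) = (\<Sum>i\<in>I. c i * T (f i))"
proof -
  have T': "T (\<lambda>z. a * f z + b * g z) = a * T f + b * T g" if "smooth f" "smooth g" for f g a b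
    using T that by (simp add: linear_on_smooth_def)
  have 0: "T (\<lambda>z. 0) = 0" using T'[OF smooth_const smooth_const, of 0 0 0 0] by simp
  show ?thesis using f
  proof (induction I rule: infinite_finite_induct)
    case (insert i I)
    have "T (\<lambda>z. c i * f i z + 1 * (\<Sum>i\<in>I. c i * f i z)) = c i * T (f i) + 1 * T (\<lambda>z. \<Sum>i\<in>I. c i * f i z)"
      using insert.prems by (intro T' smooth_sum smooth_mult smooth_const) auto
    then show ?case using insert by simp
  qed (simp_all add: 0)
qed

lemma dual_map_jac_dual:
  assumes "T \<in> distributions" shows "dual_map jac lie_inclusion T \<in> jac_dual"
  using distributions_linear[OF assms]
  by (auto simp: jac_dual_def dual_map_def jac_subspace lie_inclusion_eq quadratic_linear linear_on_smooth_def
      smooth_quadratic simp del: split_paired_All split_paired_Ex)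

text \<open>A point evaluation has order 0 and support {z}, with constant 1. Such functionals make
  functional derivatives on the side of distributions unique.\<close>

lemma evaluation_distribution: "(\<lambda>f. if f \<in> smooth_functions then f z else 0) \<in> distributions"
proof -
  have lin: "(\<lambda>z. a * f z + b * g z) \<in> smooth_functions"
    if "f \<in> smooth_functions" "g \<in> smooth_functions" for f g :: "'a phase \<Rightarrow> real" and a b
    using that by (auto simp: smooth_functions_def intro!: smooth_intros)
  have bound: "\<bar>f z\<bar> \<le> 1 * max 0 M"
    if "\<forall>z\<in>{z}. \<forall>vs. set vs \<subseteq> Basis \<and> length vs \<le> 0 \<longrightarrow> \<bar>iter_deriv vs f z\<bar> \<le> M" for f :: "'a phase \<Rightarrow> real" and M
    using that by (auto simp: max_def)
  show ?thesis
    unfolding distributions_def mem_Collect_eq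
  proof (intro conjI exI[of _ "{z}"] exI[of _ "0 :: nat"] exI[of _ "1 :: real"])
    show "compact {z}" by simp
  qed (use lin bound in auto)
qed

lemma distributions_separate:
  assumes "f \<in> smooth_functions" "g \<in> smooth_functions" "\<And>T. T \<in> distributions \<Longrightarrow> T f = T g"
  shows "f = g"
proof
  show "f z = g z" for z
    using assms(3)[OF evaluation_distribution[of z]] assms(1,2) by simp
qed

text \<open>The dual map is linear, so the derivative of the composite along \<nu> is that of F
  along the image of \<nu>; and this image pairs with x as \<nu> pairs with the included x.\<close>

lemma dual_map_functional_derivative:
  assumes "has_functional_derivative jac_dual jac F (dual_map jac lie_inclusion T) x"
  shows "has_functional_derivative distributions smooth_functions (F \<circ> dual_map jac lie_inclusion) T (lie_inclusion x)"
proof -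
  let ?J = "dual_map jac lie_inclusion"
  have x: "x \<in> jac" using assms by (simp add: has_functional_derivative_def)
  have "((\<lambda>\<epsilon>. (F \<circ> ?J) (\<lambda>y. T y + \<epsilon> * \<nu> y)) has_real_derivative \<nu> (lie_inclusion x)) (at 0)"
    if "\<nu> \<in> distributions" for \<nu>
  proof -
    have "(\<lambda>\<epsilon>. (F \<circ> ?J) (\<lambda>y. T y + \<epsilon> * \<nu> y)) = (\<lambda>\<epsilon>. F (\<lambda>y. ?J T y + \<epsilon> * ?J \<nu> y))"
      by (rule ext) (simp add: dual_map_def if_distrib cong: if_cong)
    moreover have "?J \<nu> x = \<nu> (lie_inclusion x)" using x by (simp add: dual_map_def)
    ultimately show ?thesis
      using assms dual_map_jac_dual[OF that] by (auto simp only: has_functional_derivative_def)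
  qed
  moreover have "lie_inclusion x \<in> smooth_functions"
    using x by (simp add: lie_inclusion_eq smooth_quadratic smooth_functions_def)
  ultimately show ?thesis unfolding has_functional_derivative_def by blast
qed

lemma lie_inclusion_bracket:
  "A \<in> jac \<Longrightarrow> B \<in> jac \<Longrightarrow>
   lie_inclusion (jac_bracket A B) = poisson_bracket (lie_inclusion A) (lie_inclusion B)"
  by (simp add: lie_inclusion_eq jac_bracket_closed quadratic_bracket)

lemma functional_derivative_eq:
  assumes "\<exists>!x. has_functional_derivative D L F \<mu> x" "has_functional_derivative D L F \<mu> x"
  shows "functional_derivative D L F \<mu> = x"
  unfolding functional_derivative_def using assms by (rule the1_equality)

lemma poisson_map_dual_map:
  "poisson_map
     (distributions :: (('k::finite phase \<Rightarrow> real) \<Rightarrow> real) set) smooth_functions poisson_bracket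
     (jac_dual :: ('k triple \<Rightarrow> real) set) jac jac_bracket smooth_on_jac_dual
     (dual_map jac lie_inclusion)"
proof -
  let ?D = "distributions :: (('k phase \<Rightarrow> real) \<Rightarrow> real) set"
  let ?J = "dual_map jac lie_inclusion :: (('k phase \<Rightarrow> real) \<Rightarrow> real) \<Rightarrow> 'k triple \<Rightarrow> real"
  have 1: "\<exists>!x. has_functional_derivative jac_dual jac F \<mu> x"
    if "F \<in> smooth_on_jac_dual" "\<mu> \<in> jac_dual" for F and \<mu> :: "'k triple \<Rightarrow> real"
  proof (rule ex_ex1I)
    show "\<exists>x. has_functional_derivative jac_dual jac F \<mu> x"
      using jac_dual_functional_derivative[OF that] by blast
    show "x = y" if "has_functional_derivative jac_dual jac F \<mu> x" "has_functional_derivative jac_dual jac F \<mu> y" for x y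
      using that by (rule has_functional_derivative_unique) (rule jac_dual_separates)
  qed
  have 2: "\<exists>!x. has_functional_derivative ?D smooth_functions (F \<circ> ?J) T x"
    if "F \<in> smooth_on_jac_dual" "T \<in> ?D" for F T
  proof (rule ex_ex1I)
    show "\<exists>x. has_functional_derivative ?D smooth_functions (F \<circ> ?J) T x"
      using 1[OF that(1) dual_map_jac_dual[OF that(2)]] dual_map_functional_derivative by blast
    show "x = y" if "has_functional_derivative ?D smooth_functions (F \<circ> ?J) T x"
      "has_functional_derivative ?D smooth_functions (F \<circ> ?J) T y" for x y
      using that by (rule has_functional_derivative_unique) (rule distributions_separate)
  qed
  have 3: "lie_poisson ?D smooth_functions poisson_bracket (F \<circ> ?J) (G \<circ> ?J) T =
      lie_poisson jac_dual jac jac_bracket F G (?J T)"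
    if F: "F \<in> smooth_on_jac_dual" and G: "G \<in> smooth_on_jac_dual" and T: "T \<in> ?D" for F G T
  proof -
    note J = dual_map_jac_dual[OF T]
    obtain x y where x: "has_functional_derivative jac_dual jac F (?J T) x"
      and y: "has_functional_derivative jac_dual jac G (?J T) y"
      using 1[OF F J] 1[OF G J] by blast
    have "x \<in> jac" "y \<in> jac" using x y by (auto simp: has_functional_derivative_def)
    moreover have "functional_derivative jac_dual jac F (?J T) = x" "functional_derivative jac_dual jac G (?J T) = y"
      by (rule functional_derivative_eq[OF 1[OF F J] x], rule functional_derivative_eq[OF 1[OF G J] y])
    moreover have "functional_derivative ?D smooth_functions (F \<circ> ?J) T = lie_inclusion x"
      "functional_derivative ?D smooth_functions (G \<circ> ?J) T = lie_inclusion y"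
      by (rule functional_derivative_eq[OF 2[OF F T] dual_map_functional_derivative[OF x]],
          rule functional_derivative_eq[OF 2[OF G T] dual_map_functional_derivative[OF y]])
    ultimately show ?thesis
      by (simp add: lie_poisson_def lie_inclusion_bracket dual_map_def jac_bracket_closed)
  qed
  show ?thesis
    unfolding poisson_map_def using 1 2 3 dual_map_jac_dual by blast
qed

section \<open>Moments\<close>

text \<open>The matrix \<Omega>mat in \<open>triple_to_jac\<close> cancels against \<Omega>. What is
  left is a polynomial with coefficients S_0, S_1 and S_2 / 2, and the moments collect the values of
  T on its monomials.\<close>

lemma quadratic_triple_to_jac:
  "quadratic (triple_to_jac (S\<^sub>2, S\<^sub>1, S\<^sub>0)) z =
     S\<^sub>0 + (\<Sum>i\<in>UNIV. S\<^sub>1 $ i * z $ i) + (\<Sum>i\<in>UNIV. \<Sum>j\<in>UNIV. S\<^sub>2 $ i $ j / 2 * (z $ i * z $ j))"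
proof -
  have "(S\<^sub>2 *v z) \<bullet> z = (\<Sum>i\<in>UNIV. \<Sum>j\<in>UNIV. S\<^sub>2 $ i $ j * (z $ i * z $ j))"
    by (simp add: inner_vec_def matrix_vector_mult_def sum_distrib_left sum_distrib_right mult_ac)
  moreover have "S\<^sub>1 \<bullet> z = (\<Sum>i\<in>UNIV. S\<^sub>1 $ i * z $ i)" by (simp add: inner_vec_def)
  ultimately show ?thesis
    by (simp add: triple_to_jac_eq quadratic_def matrix_vector_mul_assoc[symmetric] \<Omega>_\<Omega>mat_left
        sum_divide_distrib[symmetric])
qed

lemma moments_sym: "moments T \<in> sym_triples"
  by (simp add: moments_def sym_triples_def transpose_def vec_eq_iff mult.commute)

lemma moments_inner:
  "moments T \<bullet> (S\<^sub>2, S\<^sub>1, S\<^sub>0) = S\<^sub>0 * T (\<lambda>z. 1) + (\<Sum>i\<in>UNIV. S\<^sub>1 $ i * T (\<lambda>z. z $ i)) +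
     (\<Sum>i\<in>UNIV. \<Sum>j\<in>UNIV. S\<^sub>2 $ i $ j / 2 * T (\<lambda>z. z $ i * z $ j))"
  by (simp add: moments_def inner_vec_def sum_distrib_left mult_ac)

text \<open>The hypothesis involves values on quadratic Hamiltonians only, so the criterion covers
  distributions as well as densities that do not define one.\<close>

lemma moments_eqI:
  fixes T :: "('k::finite phase \<Rightarrow> real) \<Rightarrow> real"
  assumes "\<And>S\<^sub>2 S\<^sub>1 S\<^sub>0. T (quadratic (triple_to_jac (S\<^sub>2, S\<^sub>1, S\<^sub>0))) =
     S\<^sub>0 * T (\<lambda>z. 1) + (\<Sum>i\<in>UNIV. S\<^sub>1 $ i * T (\<lambda>z. z $ i)) +
     (\<Sum>i\<in>UNIV. \<Sum>j\<in>UNIV. S\<^sub>2 $ i $ j / 2 * T (\<lambda>z. z $ i * z $ j))"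
  shows "jac_dual_to_triple (dual_map jac lie_inclusion T) = moments T"
proof (rule jac_dual_to_triple_eqI[OF moments_sym])
  fix S :: "'k triple" assume "S \<in> sym_triples"
  then show "moments T \<bullet> S = dual_map jac lie_inclusion T (triple_to_jac S)"
    by (cases S) (simp add: dual_map_def triple_to_jac_in_jac lie_inclusion_eq assms moments_inner)
qed

lemma smooth_component: "smooth (\<lambda>z :: 'k::finite phase. z $ i)"
  by (rule smooth_bounded_linear[OF bounded_linear_vec_nth])

lemma linear_on_smooth_moments:
  assumes T: "linear_on_smooth T"
  shows "jac_dual_to_triple (dual_map jac lie_inclusion T) = moments T"
proof (rule moments_eqI)
  fix S\<^sub>2 :: "'a phase_mat" and S\<^sub>1 :: "'a phase" and S\<^sub>0 :: real
  have add: "T (\<lambda>z. f z + g z) = T f + T g" if "smooth f" "smooth g" for f g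
    using T[unfolded linear_on_smooth_def, rule_format, OF that, of 1 1] by simp
  \<comment> \<open>The double sum becomes a single sum over pairs, the form that
    \<open>linear_on_smooth_sum\<close> accepts.\<close>
  have "T (\<lambda>z. \<Sum>p\<in>UNIV \<times> UNIV. (case p of (i, j) \<Rightarrow> S\<^sub>2 $ i $ j / 2) * (case p of (i, j) \<Rightarrow> z $ i * z $ j)) =
    (\<Sum>p\<in>UNIV \<times> UNIV. (case p of (i, j) \<Rightarrow> S\<^sub>2 $ i $ j / 2) * T (\<lambda>z. case p of (i, j) \<Rightarrow> z $ i * z $ j))"
    by (rule linear_on_smooth_sum[OF T]) (auto intro!: smooth_mult smooth_component)
  then have "T (\<lambda>z. \<Sum>i\<in>UNIV. \<Sum>j\<in>UNIV. S\<^sub>2 $ i $ j / 2 * (z $ i * z $ j)) =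
    (\<Sum>i\<in>UNIV. \<Sum>j\<in>UNIV. S\<^sub>2 $ i $ j / 2 * T (\<lambda>z. z $ i * z $ j))"
    by (simp only: sum.cartesian_product case_prod_unfold)
  moreover have "T (\<lambda>z. S\<^sub>0 * 1 + 1 * (\<Sum>i\<in>UNIV. S\<^sub>1 $ i * z $ i)) =
      S\<^sub>0 * T (\<lambda>z. 1) + 1 * T (\<lambda>z. \<Sum>i\<in>UNIV. S\<^sub>1 $ i * z $ i)"
    by (rule T[unfolded linear_on_smooth_def, rule_format])
       (intro smooth_const smooth_sum smooth_mult smooth_component)+
  moreover have "T (\<lambda>z. \<Sum>i\<in>UNIV. S\<^sub>1 $ i * z $ i) = (\<Sum>i\<in>UNIV. S\<^sub>1 $ i * T (\<lambda>z. z $ i))"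
    by (rule linear_on_smooth_sum[OF T smooth_component])
  moreover have "T (\<lambda>z. S\<^sub>0 + (\<Sum>i\<in>UNIV. S\<^sub>1 $ i * z $ i) + (\<Sum>i\<in>UNIV. \<Sum>j\<in>UNIV. S\<^sub>2 $ i $ j / 2 * (z $ i * z $ j))) =
      T (\<lambda>z. S\<^sub>0 + (\<Sum>i\<in>UNIV. S\<^sub>1 $ i * z $ i)) + T (\<lambda>z. \<Sum>i\<in>UNIV. \<Sum>j\<in>UNIV. S\<^sub>2 $ i $ j / 2 * (z $ i * z $ j))"
    by (rule add) (intro smooth_add smooth_const smooth_sum smooth_mult smooth_component)+
  ultimately show "T (quadratic (triple_to_jac (S\<^sub>2, S\<^sub>1, S\<^sub>0))) =
     S\<^sub>0 * T (\<lambda>z. 1) + (\<Sum>i\<in>UNIV. S\<^sub>1 $ i * T (\<lambda>z. z $ i)) +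
     (\<Sum>i\<in>UNIV. \<Sum>j\<in>UNIV. S\<^sub>2 $ i $ j / 2 * T (\<lambda>z. z $ i * z $ j))"
    by (simp add: quadratic_triple_to_jac[abs_def])
qed

section \<open>Densities\<close>

lemma weighted_integrable:
  fixes f g :: "'k::finite phase \<Rightarrow> real"
  assumes "integrable lborel (\<lambda>z. (1 + (norm z)\<^sup>2) * f z)" "continuous_on UNIV g" "\<And>z. \<bar>g z\<bar> \<le> 1 + (norm z)\<^sup>2"
  shows "integrable lborel (\<lambda>z. f z * g z)"
proof (rule Bochner_Integration.integrable_bound[OF assms(1)])
  have pos: "1 + (norm z)\<^sup>2 > 0" for z :: "'k phase" by (simp add: add_pos_nonneg)
  \<comment> \<open>Integrability is given for the weighted density; dividing by the positive weight
    recovers the measurability of f itself.\<close>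
  have "f = (\<lambda>z. ((1 + (norm z)\<^sup>2) * f z) / (1 + (norm z)\<^sup>2))"
    using pos by (auto simp: fun_eq_iff less_imp_neq[symmetric])
  moreover have "(\<lambda>z. ((1 + (norm z)\<^sup>2) * f z) / (1 + (norm z)\<^sup>2)) \<in> borel_measurable lborel"
    using borel_measurable_integrable[OF assms(1)] by (intro borel_measurable_divide) auto
  ultimately have "f \<in> borel_measurable lborel" by simp
  then show "(\<lambda>z. f z * g z) \<in> borel_measurable lborel"
    using borel_measurable_continuous_onI[OF assms(2)] by (intro borel_measurable_times) auto
  show "AE z in lborel. norm (f z * g z) \<le> norm ((1 + (norm z)\<^sup>2) * f z)"
    using mult_left_mono[OF assms(3), of "\<bar>f _\<bar>"] pos by (auto simp: abs_mult mult.commute less_imp_le)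
qed

lemma component_bounds:
  fixes z :: "'k::finite phase"
  shows "\<bar>z $ i\<bar> \<le> 1 + (norm z)\<^sup>2" "\<bar>z $ i * z $ j\<bar> \<le> 1 + (norm z)\<^sup>2"
proof -
  have n: "\<bar>z $ i\<bar> \<le> norm z" for i by (rule component_le_norm_cart)
  \<comment> \<open>This gives norm z \<le> (norm z)^2 + 1/4, which is more than enough.\<close>
  have "0 \<le> (norm z - 1 / 2)\<^sup>2" by simp
  then have "norm z \<le> 1 + (norm z)\<^sup>2" by (simp add: power2_eq_square algebra_simps)
  with n[of i] show "\<bar>z $ i\<bar> \<le> 1 + (norm z)\<^sup>2" by linarith
  have "\<bar>z $ i\<bar> * \<bar>z $ j\<bar> \<le> norm z * norm z" by (intro mult_mono n) auto
  then show "\<bar>z $ i * z $ j\<bar> \<le> 1 + (norm z)\<^sup>2" by (simp add: abs_mult power2_eq_square)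
qed

lemma weighted_moments_integrable:
  fixes f :: "'k::finite phase \<Rightarrow> real"
  assumes "integrable lborel (\<lambda>z. (1 + (norm z)\<^sup>2) * f z)"
  shows "integrable lborel f" "integrable lborel (\<lambda>z. f z * z $ i)" "integrable lborel (\<lambda>z. f z * (z $ i * z $ j))"
  using weighted_integrable[OF assms smooth_continuous_on[OF smooth_const], of 1]
    weighted_integrable[OF assms smooth_continuous_on[OF smooth_component] component_bounds(1)]
    weighted_integrable[OF assms smooth_continuous_on[OF smooth_mult[OF smooth_component smooth_component]] component_bounds(2)]
  by simp_all

lemma vec_eq_sum_axis: "x = (\<Sum>i\<in>UNIV. x $ i *\<^sub>R axis i 1)" for x :: "real ^ 'n"
  using basis_expansion[of x] by (simp add: scalar_mult_eq_scaleR)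

lemma mat_eq_sum_axis: "(\<chi> i j. a i j) = (\<Sum>i\<in>UNIV. \<Sum>j\<in>UNIV. a i j *\<^sub>R axis i (axis j (1 :: real)))"
  for a :: "'n::finite \<Rightarrow> 'm::finite \<Rightarrow> real"
proof -
  have "(\<Sum>i\<in>UNIV. \<Sum>j\<in>UNIV. a i j *\<^sub>R axis i (axis j (1 :: real))) $ k $ l = (\<Sum>i\<in>UNIV. if k = i then a i l else 0)" for k l
    unfolding sum_component
  proof (rule sum.cong[OF refl])
    fix i
    show "(\<Sum>j\<in>UNIV. (a i j *\<^sub>R axis i (axis j (1 :: real))) $ k $ l) = (if k = i then a i l else 0)"
      by (cases "k = i") (simp_all add: axis_def if_distrib[of "\<lambda>x. _ * x"] cong: if_cong)
  qed
  then show ?thesis by (simp add: vec_eq_iff)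
qed

text \<open>Vector-valued and matrix-valued integrals are expanded along the axes, which reduces
  them to scalar moments; the weight makes these integrable.\<close>

lemma moments_density:
  fixes f :: "'k::finite phase \<Rightarrow> real"
  assumes "integrable lborel (\<lambda>z. (1 + (norm z)\<^sup>2) * f z)"
  shows "moments (density_functional f) = density_moments f"
proof -
  note int = weighted_moments_integrable[OF assms]
  have "(\<integral>z. f z *\<^sub>R (\<chi> i j. z $ i * z $ j) \<partial>lborel) =
      (\<integral>z. (\<Sum>i\<in>UNIV. \<Sum>j\<in>UNIV. (f z * (z $ i * z $ j)) *\<^sub>R axis i (axis j 1)) \<partial>lborel)"
    by (subst mat_eq_sum_axis) (simp add: scaleR_sum_right)
  also have "\<dots> = (\<Sum>i\<in>UNIV. \<Sum>j\<in>UNIV. (\<integral>z. f z * (z $ i * z $ j) \<partial>lborel) *\<^sub>R axis i (axis j 1))"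
    using int(3) by (simp add: integral_sum)
  also have "\<dots> = (\<chi> i j. \<integral>z. f z * (z $ i * z $ j) \<partial>lborel)"
    by (rule mat_eq_sum_axis[symmetric])
  finally have 2: "(\<integral>z. f z *\<^sub>R (\<chi> i j. z $ i * z $ j) \<partial>lborel) = (\<chi> i j. \<integral>z. f z * (z $ i * z $ j) \<partial>lborel)" .
  have "(\<integral>z. f z *\<^sub>R z \<partial>lborel) = (\<integral>z. (\<Sum>i\<in>UNIV. (f z * z $ i) *\<^sub>R axis i 1) \<partial>lborel)"
    by (subst (2) vec_eq_sum_axis) (simp add: scaleR_sum_right)
  also have "\<dots> = (\<Sum>i\<in>UNIV. (\<integral>z. f z * z $ i \<partial>lborel) *\<^sub>R axis i 1)"
    using int(2) by (simp add: integral_sum)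
  also have "\<dots> = (\<chi> i. \<integral>z. f z * z $ i \<partial>lborel)"
    by (subst vec_eq_sum_axis) simp
  finally have 1: "(\<integral>z. f z *\<^sub>R z \<partial>lborel) = (\<chi> i. \<integral>z. f z * z $ i \<partial>lborel)" .
  show ?thesis
    by (simp add: moments_def density_moments_def density_functional_def smooth_functions_def 1 2
        smooth_const smooth_component smooth_mult)
qed

text \<open>Without compact support, \<open>density_functional f\<close> need not be linear on all
  smooth functions, as the integral of a non-integrable function defaults to 0. On polynomials of
  degree at most two all integrals converge and may be split.\<close>

lemma density_to_triple:
  fixes f :: "'k::finite phase \<Rightarrow> real"
  assumes "integrable lborel (\<lambda>z. (1 + (norm z)\<^sup>2) * f z)"
  shows "jac_dual_to_triple (dual_map jac lie_inclusion (density_functional f)) = density_moments f"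
  unfolding moments_density[OF assms, symmetric]
proof (rule moments_eqI)
  fix S\<^sub>2 :: "'k phase_mat" and S\<^sub>1 :: "'k phase" and S\<^sub>0 :: real
  note int = weighted_moments_integrable[OF assms]
  have T: "density_functional f g = (\<integral>z. f z * g z \<partial>lborel)" if "smooth g" for g
    using that by (simp add: density_functional_def smooth_functions_def)
  have "(\<integral>z. f z * quadratic (triple_to_jac (S\<^sub>2, S\<^sub>1, S\<^sub>0)) z \<partial>lborel) =
    (\<integral>z. S\<^sub>0 * f z + (\<Sum>i\<in>UNIV. S\<^sub>1 $ i * (f z * z $ i)) +
      (\<Sum>i\<in>UNIV. \<Sum>j\<in>UNIV. S\<^sub>2 $ i $ j / 2 * (f z * (z $ i * z $ j))) \<partial>lborel)"
    by (simp add: quadratic_triple_to_jac sum_distrib_left distrib_left mult_ac)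
  also have "\<dots> = S\<^sub>0 * (\<integral>z. f z \<partial>lborel) + (\<Sum>i\<in>UNIV. S\<^sub>1 $ i * (\<integral>z. f z * z $ i \<partial>lborel)) +
      (\<Sum>i\<in>UNIV. \<Sum>j\<in>UNIV. S\<^sub>2 $ i $ j / 2 * (\<integral>z. f z * (z $ i * z $ j) \<partial>lborel))"
    using int by (simp add: integral_sum integral_add integrable_sum integrable_add)
  finally show "density_functional f (quadratic (triple_to_jac (S\<^sub>2, S\<^sub>1, S\<^sub>0))) =
     S\<^sub>0 * density_functional f (\<lambda>z. 1) + (\<Sum>i\<in>UNIV. S\<^sub>1 $ i * density_functional f (\<lambda>z. z $ i)) +
     (\<Sum>i\<in>UNIV. \<Sum>j\<in>UNIV. S\<^sub>2 $ i $ j / 2 * density_functional f (\<lambda>z. z $ i * z $ j))"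
    by (simp add: T smooth_quadratic smooth_const smooth_component smooth_mult)
qed

lemma compact_density_integrable:
  fixes f g :: "'k::finite phase \<Rightarrow> real"
  assumes "compact_density f" "continuous_on UNIV g"
  shows "integrable lborel (\<lambda>z. f z * g z)"
proof -
  obtain K where f: "integrable lborel f" and K: "compact K" "\<And>z. z \<notin> K \<Longrightarrow> f z = 0"
    using assms(1) by (auto simp: compact_density_def)
  have "bounded (g ` K)"
    using K(1) assms(2) by (intro compact_imp_bounded compact_continuous_image) (auto intro: continuous_on_subset)
  then obtain B where B: "\<And>z. z \<in> K \<Longrightarrow> \<bar>g z\<bar> \<le> B" by (auto simp: bounded_iff)
  have le: "\<bar>f z * g z\<bar> \<le> \<bar>B * f z\<bar>" for z
  proof (cases "z \<in> K")
    case True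
    with B[OF True] have "\<bar>g z\<bar> \<le> \<bar>B\<bar>" by linarith
    from mult_left_mono[OF this, of "\<bar>f z\<bar>"] show ?thesis by (simp add: abs_mult mult.commute)
  qed (simp add: K(2))
  have "integrable lborel (\<lambda>z. B * f z)" using f by simp
  then show ?thesis
  proof (rule Bochner_Integration.integrable_bound)
    show "(\<lambda>z. f z * g z) \<in> borel_measurable lborel"
      using borel_measurable_integrable[OF f] borel_measurable_continuous_onI[OF assms(2)]
      by (intro borel_measurable_times) auto
    show "AE z in lborel. norm (f z * g z) \<le> norm (B * f z)"
      using le by simp
  qed
qed

text \<open>The bound uses the supremum over K without derivatives, with the L1 norm of f as
  constant. A bound M can be negative only when K is empty; then f vanishes, and
  \<open>max 0 M\<close> covers this case.\<close>

lemma compact_density_distribution: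
  fixes f :: "'k::finite phase \<Rightarrow> real"
  assumes "compact_density f"
  shows "density_functional f \<in> distributions"
proof -
  obtain K where f: "integrable lborel f" and K: "compact K" "\<And>z. z \<notin> K \<Longrightarrow> f z = 0"
    using assms by (auto simp: compact_density_def)
  have int: "integrable lborel (\<lambda>z. f z * g z)" if "smooth g" for g
    by (rule compact_density_integrable[OF assms smooth_continuous_on[OF that]])
  have lin: "density_functional f (\<lambda>z. a * g z + b * h z) = a * density_functional f g + b * density_functional f h"
    if "smooth g" "smooth h" for g h a b
  proof -
    have "smooth (\<lambda>z. a * g z + b * h z)" using that by (intro smooth_intros)
    moreover have "(\<integral>z. f z * (a * g z + b * h z) \<partial>lborel) = (\<integral>z. a * (f z * g z) + b * (f z * h z) \<partial>lborel)"
      by (simp add: algebra_simps)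
    ultimately show ?thesis
      using that int by (simp add: density_functional_def smooth_functions_def)
  qed
  have bound: "\<bar>density_functional f g\<bar> \<le> (\<integral>z. \<bar>f z\<bar> \<partial>lborel) * max 0 M"
    if g: "smooth g" and M: "\<And>z. z \<in> K \<Longrightarrow> \<bar>g z\<bar> \<le> M" for g M
  proof -
    have "\<bar>f z * g z\<bar> \<le> \<bar>f z\<bar> * max 0 M" for z
    proof (cases "z \<in> K")
      case True
      from M[OF this] show ?thesis unfolding abs_mult by (intro mult_left_mono) auto
    qed (simp add: K(2))
    then have "(\<integral>z. \<bar>f z * g z\<bar> \<partial>lborel) \<le> (\<integral>z. \<bar>f z\<bar> * max 0 M \<partial>lborel)"
      using f int[OF g] by (intro integral_mono integrable_abs integrable_mult_left) auto
    moreover have "\<bar>\<integral>z. f z * g z \<partial>lborel\<bar> \<le> (\<integral>z. \<bar>f z * g z\<bar> \<partial>lborel)"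
      by (rule integral_abs_bound)
    ultimately have "\<bar>\<integral>z. f z * g z \<partial>lborel\<bar> \<le> (\<integral>z. \<bar>f z\<bar> * max 0 M \<partial>lborel)" by linarith
    then show ?thesis using g by (simp add: density_functional_def smooth_functions_def)
  qed
  show ?thesis
    unfolding distributions_def mem_Collect_eq
  proof (intro conjI exI[of _ K] exI[of _ "0 :: nat"] exI[of _ "\<integral>z. \<bar>f z\<bar> \<partial>lborel"] ballI allI impI)
    fix g :: "'k phase \<Rightarrow> real" and M
    assume "g \<in> smooth_functions"
      "\<forall>z\<in>K. \<forall>vs. set vs \<subseteq> Basis \<and> length vs \<le> 0 \<longrightarrow> \<bar>iter_deriv vs g z\<bar> \<le> M"
    then show "\<bar>density_functional f g\<bar> \<le> (\<integral>z. \<bar>f z\<bar> \<partial>lborel) * max 0 M"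
      by (intro bound) (auto simp: smooth_functions_def)
  qed (use lin K(1) in \<open>auto simp: smooth_functions_def density_functional_def[of f h for h]\<close>)
qed

lemma compact_density_weighted:
  fixes f :: "'k::finite phase \<Rightarrow> real"
  assumes "compact_density f"
  shows "integrable lborel (\<lambda>z. (1 + (norm z)\<^sup>2) * f z)"
  using compact_density_integrable[OF assms, of "\<lambda>z. 1 + (norm z)\<^sup>2"]
  by (simp add: mult.commute continuous_intros)

theorem theorem3p7:
  shows
    "group (jac_group :: 'k::finite triple monoid) \<and>
     group (quant_group :: (('k phase \<Rightarrow> 'k phase) \<times> real) monoid) \<and>
     group (aut_group :: ('k phase \<times> real \<Rightarrow> 'k phase \<times> real) monoid) \<and>
     (quant_to_aut :: ('k phase \<Rightarrow> 'k phase) \<times> real \<Rightarrow> 'k phase \<times> real \<Rightarrow> 'k phase \<times> real)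
       \<in> iso quant_group aut_group \<and>
     (group_inclusion :: 'k triple \<Rightarrow> ('k phase \<Rightarrow> 'k phase) \<times> real)
       \<in> hom jac_group quant_group \<and>
     inj_on group_inclusion (carrier (jac_group :: 'k triple monoid)) \<and>
     (lie_inclusion :: 'k triple \<Rightarrow> 'k phase \<Rightarrow> real) \<in> jac \<rightarrow> smooth_functions \<and>
     inj_on lie_inclusion (jac :: 'k triple set) \<and>
     (\<forall>A\<in>jac. \<forall>B\<in>jac. \<forall>a b. lie_inclusion (a *\<^sub>R A + b *\<^sub>R B :: 'k triple) =
        (\<lambda>z. a * lie_inclusion A z + b * lie_inclusion B z)) \<and>
     (\<forall>A\<in>jac. \<forall>B\<in>jac. (jac_bracket A B :: 'k triple) \<in> jac \<and>
        lie_inclusion (jac_bracket A B) = poisson_bracket (lie_inclusion A) (lie_inclusion B)) \<and>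
     poisson_map
       (distributions :: (('k phase \<Rightarrow> real) \<Rightarrow> real) set) smooth_functions poisson_bracket
       (jac_dual :: ('k triple \<Rightarrow> real) set) jac jac_bracket smooth_on_jac_dual
       (dual_map jac lie_inclusion) \<and>
     (\<forall>T \<in> (distributions :: (('k phase \<Rightarrow> real) \<Rightarrow> real) set).
        jac_dual_to_triple (dual_map jac lie_inclusion T) = moments T) \<and>
     (\<forall>f :: 'k phase \<Rightarrow> real. compact_density f \<longrightarrow>
        density_functional f \<in> distributions \<and>
        moments (density_functional f) = density_moments f) \<and>
     (\<forall>f :: 'k phase \<Rightarrow> real. integrable lborel (\<lambda>z. (1 + (norm z)\<^sup>2) * f z) \<longrightarrow>
        jac_dual_to_triple (dual_map jac lie_inclusion (density_functional f))
          = density_moments f)"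
proof (intro conjI ballI allI impI)
  show "group (jac_group :: 'k triple monoid)" by (rule group_jac_group)
  show "group (quant_group :: (('k phase \<Rightarrow> 'k phase) \<times> real) monoid)" by (rule group_quant_group)
  show "group (aut_group :: ('k phase \<times> real \<Rightarrow> 'k phase \<times> real) monoid)" by (rule group_aut_group)
  show "(quant_to_aut :: ('k phase \<Rightarrow> 'k phase) \<times> real \<Rightarrow> _) \<in> iso quant_group aut_group"
    by (rule quant_to_aut_iso)
  show "(group_inclusion :: 'k triple \<Rightarrow> _) \<in> hom jac_group quant_group" by (rule group_inclusion_hom)
  show "inj_on group_inclusion (carrier (jac_group :: 'k triple monoid))"
    by (rule inj_on_subset[OF inj_group_inclusion subset_UNIV])
  show "(lie_inclusion :: 'k triple \<Rightarrow> _) \<in> jac \<rightarrow> smooth_functions"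
    by (rule Pi_I) (simp add: lie_inclusion_eq smooth_quadratic smooth_functions_def)
  show "inj_on lie_inclusion (jac :: 'k triple set)"
    using inj_on_quadratic by (simp add: lie_inclusion_eq cong: inj_on_cong)
next
  fix A B :: "'k triple" and a b
  assume "A \<in> jac" "B \<in> jac"
  then show "lie_inclusion (a *\<^sub>R A + b *\<^sub>R B) = (\<lambda>z. a * lie_inclusion A z + b * lie_inclusion B z)"
    by (simp add: lie_inclusion_eq jac_subspace quadratic_linear)
next
  fix A B :: "'k triple"
  assume "A \<in> jac" "B \<in> jac"
  then show "jac_bracket A B \<in> jac"
    and "lie_inclusion (jac_bracket A B) = poisson_bracket (lie_inclusion A) (lie_inclusion B)"
    by (rule jac_bracket_closed, rule lie_inclusion_bracket)
next
  show "poisson_map (distributions :: (('k phase \<Rightarrow> real) \<Rightarrow> real) set) smooth_functions poisson_bracket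
       (jac_dual :: ('k triple \<Rightarrow> real) set) jac jac_bracket smooth_on_jac_dual (dual_map jac lie_inclusion)"
    by (rule poisson_map_dual_map)
next
  fix T :: "('k phase \<Rightarrow> real) \<Rightarrow> real"
  assume "T \<in> distributions"
  then show "jac_dual_to_triple (dual_map jac lie_inclusion T) = moments T"
    by (intro linear_on_smooth_moments distributions_linear)
next
  fix f :: "'k phase \<Rightarrow> real"
  assume "compact_density f"
  then show "density_functional f \<in> distributions" "moments (density_functional f) = density_moments f"
    by (rule compact_density_distribution, intro moments_density compact_density_weighted)
next
  fix f :: "'k phase \<Rightarrow> real"
  assume "integrable lborel (\<lambda>z. (1 + (norm z)\<^sup>2) * f z)"
  then show "jac_dual_to_triple (dual_map jac lie_inclusion (density_functional f)) = density_moments f"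
    by (rule density_to_triple)
qed

end
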